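(* Let $HG$ be the Heawood graph and let $f:HG\to\mathbb{R}^{3}$ be a Legendrian embedding. Then \[ TB_{8}(f)=TB_{6}(f),\quad TB_{10}(f)=5\,TB_{6}(f),\quad TB_{12}(f)=4\,TB_{6}(f),\quad TB_{14}(f)=2\,TB_{6}(f). \] Therefore \[ TB(f)=13\,TB_{6}(f). \]
   Context: The Heawood graph $HG$ has vertices $u_i,v_i$ ($i\in\mathbb{Z}/7\mathbb{Z}$) and the $21$ edges $u_iv_i$, $u_iv_{i-1}$, $v_iu_{i-2}$. $\mathbb{R}^3$ carries the standard contact structure $\xi_{\rm std}$. A Legendrian embedding of a finite graph $G$ is an embedding $f:G\to\mathbb{R}^3$ whose edges are everywhere tangent to the contact planes (with, at each vertex, the outgoing tangent directions of the incident edges pairwise distinct); each cycle is then mapped to a (piecewise smooth) Legendrian knot, whose Thurston–Bennequin number $\mathrm{tb}$ is defined as usual (after Legendrian smoothing at the vertices). A $k$-cycle is a subgraph with $k$ edges homeomorphic to a circle; $\Gamma(G)$ and $\Gamma_k(G)$ denote the sets of all cycles and of all $k$-cycles of $G$. Define \[ TB(f)=\sum_{\gamma\in\Gamma(G)}\mathrm{tb}(f(\gamma)),\qquad TB_{k}(f)=\sum_{\gamma\in\Gamma_{k}(G)}\mathrm{tb}(f(\gamma)). \] *)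

theory Defs
  imports "HOL-Analysis.Analysis" "HOL-Library.Numeral_Type"
begin

text \<open>
  A simple graph without isolated vertices is given by its set of edges, an edge being a
  two-element set of vertices. Its geometric realisation lives in the space of real-valued
  functions on the vertices: the vertex \<open>v\<close> is the unit vector \<open>axis v 1\<close> and an edge is the
  segment joining its two end points.
\<close>

definition realization :: "'v::finite set set \<Rightarrow> (real ^ 'v) set" where
  "realization E = (\<Union>(v, w) \<in> {(v, w). {v, w} \<in> E}. closed_segment (axis v 1) (axis w 1))"

definition cycles :: "'v::finite set set \<Rightarrow> 'v set set set" where
  "cycles E = {C. C \<subseteq> E \<and> realization C homeomorphic sphere (0::complex) 1}"

definition k_cycles :: "'v::finite set set \<Rightarrow> nat \<Rightarrow> 'v set set set" where
  "k_cycles E k = {C \<in> cycles E. card C = k}"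

text \<open>\<open>Hu i\<close> and \<open>Hv i\<close> are the vertices $u_i$ and $v_i$; the index type \<open>7\<close> is the ring of
  integers modulo 7.\<close>

datatype heawood_vertex = Hu 7 | Hv 7

instance heawood_vertex :: finite
proof
  have "UNIV = range Hu \<union> range Hv"
    by (metis UNIV_eq_I UnCI heawood_vertex.exhaust rangeI)
  then show "finite (UNIV :: heawood_vertex set)"
    by (metis finite_UnI finite_code finite_imageI)
qed

definition heawood :: "heawood_vertex set set" where
  "heawood = (\<Union>i. {{Hu i, Hv i}, {Hu i, Hv (i - 1)}, {Hv i, Hu (i - 2)}})"

text \<open>$C^\infty$ curves on \<open>S\<close>; at the end points of a closed interval the derivatives are
  one-sided.\<close>

definition smooth_curve_on :: "real set \<Rightarrow> (real \<Rightarrow> real ^ 3) \<Rightarrow> bool" where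
  "smooth_curve_on S g \<longleftrightarrow>
     (\<exists>D :: nat \<Rightarrow> real \<Rightarrow> real ^ 3. D 0 = g \<and>
        (\<forall>n. \<forall>t\<in>S. (D n has_vector_derivative D (Suc n) t) (at t within S)))"

text \<open>The standard contact structure is the kernel of $dz - y\,dx$.\<close>

definition contact_plane :: "real ^ 3 \<Rightarrow> (real ^ 3) set" where
  "contact_plane p = {d. d $ 3 - p $ 2 * d $ 1 = 0}"

definition legendrian_on :: "real set \<Rightarrow> (real \<Rightarrow> real ^ 3) \<Rightarrow> bool" where
  "legendrian_on S g \<longleftrightarrow> smooth_curve_on S g \<and>
     (\<forall>t\<in>S. vector_derivative g (at t within S) \<noteq> 0 \<and>
             vector_derivative g (at t within S) \<in> contact_plane (g t))"

text \<open>A smooth Legendrian knot, parametrised as a periodic curve with period \<open>L\<close>.\<close>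

definition legendrian_knot :: "real \<Rightarrow> (real \<Rightarrow> real ^ 3) \<Rightarrow> bool" where
  "legendrian_knot L h \<longleftrightarrow>
     L > 0 \<and> legendrian_on UNIV h \<and> (\<forall>t. h (t + L) = h t) \<and> inj_on h {0..<L}"

definition edge_curve ::
  "(real ^ 'v \<Rightarrow> real ^ 3) \<Rightarrow> 'v::finite \<Rightarrow> 'v \<Rightarrow> real \<Rightarrow> real ^ 3" where
  "edge_curve f v w = f \<circ> linepath (axis v 1) (axis w 1)"

definition outgoing_direction ::
  "(real ^ 'v \<Rightarrow> real ^ 3) \<Rightarrow> 'v::finite \<Rightarrow> 'v \<Rightarrow> real ^ 3" where
  "outgoing_direction f v w = sgn (vector_derivative (edge_curve f v w) (at 0 within {0..1}))"

definition legendrian_embedding ::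
  "'v::finite set set \<Rightarrow> (real ^ 'v \<Rightarrow> real ^ 3) \<Rightarrow> bool" where
  "legendrian_embedding E f \<longleftrightarrow>
     embedding_map (top_of_set (realization E)) euclidean f \<and>
     (\<forall>v w. {v, w} \<in> E \<longrightarrow> legendrian_on {0..1} (edge_curve f v w)) \<and>
     (\<forall>v w w'. {v, w} \<in> E \<and> {v, w'} \<in> E \<and> w \<noteq> w' \<longrightarrow>
        outgoing_direction f v w \<noteq> outgoing_direction f v w')"

text \<open>The linking number of two disjoint closed curves of period \<open>L\<close>, by Gauss' integral.\<close>

definition linking_number ::
  "real \<Rightarrow> (real \<Rightarrow> real ^ 3) \<Rightarrow> (real \<Rightarrow> real ^ 3) \<Rightarrow> real" where
  "linking_number L g h =
     1 / (4 * pi) * integral {0..L} (\<lambda>s. integral {0..L} (\<lambda>t.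
       (g s - h t) \<bullet> cross3 (vector_derivative g (at s)) (vector_derivative h (at t))
         / norm (g s - h t) ^ 3))"

text \<open>The linking number of a Legendrian knot with its push-off along $\partial_z$, which is
  transverse to the contact planes. It does not depend on the size \<open>\<epsilon>\<close> of the push-off as long
  as \<open>\<epsilon>\<close> is positive and small.\<close>

definition tb :: "real \<Rightarrow> (real \<Rightarrow> real ^ 3) \<Rightarrow> real" where
  "tb L h = (THE x. \<forall>\<^sub>F \<epsilon> in at_right 0. linking_number L h (\<lambda>t. h t + \<epsilon> *\<^sub>R axis 3 1) = x)"

definition traverses :: "'v list \<Rightarrow> 'v set set \<Rightarrow> bool" where
  "traverses vs C \<longleftrightarrow>
     distinct vs \<and> C = {{vs ! i, vs ! ((i + 1) mod length vs)} | i. i < length vs}"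

text \<open>The closed curve of period \<open>length vs\<close> that runs through the \<open>i\<close>-th edge of the cycle on
  \<open>{i..i+1}\<close>. It is smooth except for possible corners at integer times.\<close>

definition cycle_curve ::
  "(real ^ 'v \<Rightarrow> real ^ 3) \<Rightarrow> 'v::finite list \<Rightarrow> real \<Rightarrow> real ^ 3" where
  "cycle_curve f vs t =
     (let k = length vs; i = nat (\<lfloor>t\<rfloor> mod int k)
      in edge_curve f (vs ! i) (vs ! ((i + 1) mod k)) (frac t))"

text \<open>
  The curve \<open>h\<close> arises from the closed curve \<open>c\<close> of period \<open>k\<close> by rounding the corners at the
  integer times: it is changed only in disjoint balls around the corners, each of which \<open>c\<close>
  meets in a single arc. The projection to the \<open>xy\<close>-plane is an isomorphism on each contact
  plane. The two one-sided tangents of \<open>c\<close> at a corner do not point in opposite directions, so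
  near the corner the tangents of \<open>c\<close> lie in an open half plane \<open>{d. 0 < a \<bullet> d}\<close> with \<open>a\<close>
  horizontal. Requiring the same of \<open>h\<close> means that \<open>h\<close> turns through the smaller angle: no
  zigzag (which would change the Thurston--Bennequin number) and no local knot is inserted.
\<close>

definition rounds_corners ::
  "nat \<Rightarrow> (real \<Rightarrow> real ^ 3) \<Rightarrow> (real \<Rightarrow> real ^ 3) \<Rightarrow> bool" where
  "rounds_corners k c h \<longleftrightarrow>
     (\<exists>r>0.
        (\<forall>i<k. \<forall>j<k. i \<noteq> j \<longrightarrow> disjnt (ball (c (real i)) r) (ball (c (real j)) r)) \<and>
        (\<forall>t. (\<forall>i<k. c t \<notin> ball (c (real i)) r) \<longrightarrow> h t = c t) \<and>
        (\<forall>i<k. \<exists>p q a.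
           real i - 1 < p \<and> p < real i \<and> real i < q \<and> q < real i + 1 \<and> a $ 3 = 0 \<and>
           (\<forall>t\<in>{real i - 1..<real i - 1 + real k}. c t \<in> ball (c (real i)) r \<longleftrightarrow> t \<in> {p<..<q}) \<and>
           (\<forall>t\<in>{p<..<q}. h t \<in> ball (c (real i)) r \<and>
              0 < a \<bullet> vector_derivative h (at t) \<and>
              (t \<noteq> real i \<longrightarrow> 0 < a \<bullet> vector_derivative c (at t)))))"

definition legendrian_smoothing ::
  "(real ^ 'v \<Rightarrow> real ^ 3) \<Rightarrow> 'v::finite set set \<Rightarrow> (real \<Rightarrow> real ^ 3) \<Rightarrow> bool" where
  "legendrian_smoothing f C h \<longleftrightarrow>
     legendrian_knot (real (card C)) h \<and>
     (\<exists>vs. traverses vs C \<and> rounds_corners (length vs) (cycle_curve f vs) h)"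

text \<open>Every cycle of a Legendrian embedding has a Legendrian smoothing, and all its smoothings
  have the same Thurston--Bennequin number.\<close>

definition cycle_tb :: "(real ^ 'v \<Rightarrow> real ^ 3) \<Rightarrow> 'v::finite set set \<Rightarrow> real" where
  "cycle_tb f C = tb (real (card C)) (SOME h. legendrian_smoothing f C h)"

definition TB_k :: "'v::finite set set \<Rightarrow> (real ^ 'v \<Rightarrow> real ^ 3) \<Rightarrow> nat \<Rightarrow> real" where
  "TB_k E f k = (\<Sum>C\<in>k_cycles E k. cycle_tb f C)"

definition TB :: "'v::finite set set \<Rightarrow> (real ^ 'v \<Rightarrow> real ^ 3) \<Rightarrow> real" where
  "TB E f = (\<Sum>C\<in>cycles E. cycle_tb f C)"

end

theory Submission
  imports Defs
begin

text \<open>After rounding its corners, a cycle has as Thurston--Bennequin number the Gauss linking integral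
  of the rounded curve with its small vertical push-off. The Gauss form is closed, so this integral
  does not change when the rounded curve is deformed linearly back to the cycle itself, as long as the curve
  and the push-off stay disjoint. The resulting integral splits over ordered pairs of edges:
  reversing an edge changes its sign, hence it is
  \<open>\<Sum>e e'. x e * x e' * D e e'\<close>, where \<open>x\<close> is the signed incidence vector of the
  cycle and \<open>D\<close> depends on \<open>f\<close> only. Therefore \<open>TB_k\<close> depends linearly on the matrix
  \<open>M_k = \<Sum>x. x x\<^sup>T\<close>, summed over the cycles of length \<open>k\<close>, and an enumeration of the 213 cycles of the
  Heawood graph shows that \<open>M_8, M_10, M_12, M_14\<close> are \<open>1, 5, 4, 2\<close> times \<open>M_6\<close>.\<close>

subsection \<open>Smooth curves on intervals\<close>

text \<open>Since \<open>cycle_tb\<close> selects a smoothing by \<open>SOME\<close>, a smoothing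
  must be constructed for every cycle, and the value must then be computed for an arbitrary
  smoothing. The obstacle is disjointness from the push-off for nearly equal parameters, where the
  two curves are as close as the push-off is small. It is met by a horizontal direction in which the
  rounded curve and the polygon both increase locally: a vertical shift is invisible to it, and
  convex combinations still increase. Inside the balls \<open>rounds_corners\<close> provides such a
  direction; the delicate parameter is a time at which the curve leaves one ball and enters the next
  at once, the balls then being tangent. Corners do no harm in the Gauss integral because the
  boundary terms of a homotopy contain position and velocity of an end point, but not the tangent of
  the piece ending there. The matrix \<open>D\<close> also depends on the size of the push-off, so
  one size must serve all the finitely many cycles. The multiples 1, 1, 5, 4, 2 for the lengths 6,
  8, 10, 12, 14 add up to 13.\<close>

primrec cdiff :: "nat \<Rightarrow> real set \<Rightarrow> (real \<Rightarrow> 'a::real_normed_vector) \<Rightarrow> bool" where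
  "cdiff 0 S f \<longleftrightarrow> continuous_on S f"
| "cdiff (Suc n) S f \<longleftrightarrow>
     (\<exists>f'. (\<forall>t\<in>S. (f has_vector_derivative f' t) (at t within S)) \<and> cdiff n S f')"

text \<open>The classes \<open>cdiff n\<close> of finite order carry the inductions for products and
  compositions, and \<open>cdiff (Suc 0)\<close> is the regularity used for the Gauss integrals.
  Derivatives are taken within the set, hence one-sided at end points.\<close>

definition smooth_on :: "real set \<Rightarrow> (real \<Rightarrow> 'a::real_normed_vector) \<Rightarrow> bool" where
  "smooth_on S f \<longleftrightarrow> (\<forall>n. cdiff n S f)"

lemma cdiff_cong: "(\<And>t. t \<in> S \<Longrightarrow> f t = g t) \<Longrightarrow> cdiff n S f \<longleftrightarrow> cdiff n S g"
proof (cases n)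
  case 0
  then show "(\<And>t. t \<in> S \<Longrightarrow> f t = g t) \<Longrightarrow> ?thesis" by (simp cong: continuous_on_cong)
next
  case (Suc m)
  assume eq: "\<And>t. t \<in> S \<Longrightarrow> f t = g t"
  have "(f has_vector_derivative d) (at t within S) \<longleftrightarrow> (g has_vector_derivative d) (at t within S)"
    if "t \<in> S" for t d
    using that eq has_vector_derivative_transform[of t S] by metis
  then show ?thesis using Suc by simp
qed

lemma cdiff_subset: "cdiff n S f \<Longrightarrow> T \<subseteq> S \<Longrightarrow> cdiff n T f"
proof (induction n arbitrary: f)
  case 0
  then show ?case using continuous_on_subset by auto
next
  case (Suc n)
  then obtain f' where f': "\<forall>t\<in>S. (f has_vector_derivative f' t) (at t within S)" "cdiff n S f'"
    by auto
  then have "\<forall>t\<in>T. (f has_vector_derivative f' t) (at t within T)"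
    using Suc.prems(2) has_vector_derivative_within_subset by (metis subset_iff)
  then show ?case using Suc.IH[OF f'(2) Suc.prems(2)] by auto
qed

lemma cdiff_Suc: "cdiff (Suc n) S f \<Longrightarrow> cdiff n S f"
proof (induction n arbitrary: f)
  case 0
  then show ?case
    by (simp add: continuous_on_eq_continuous_within) (meson has_vector_derivative_continuous)
next
  case (Suc n)
  then show ?case by (metis cdiff.simps(2))
qed

lemma cdiff_const: "cdiff n S (\<lambda>t. a)"
proof (induction n arbitrary: a)
  case (Suc n)
  then show ?case by simp (intro exI[of _ "\<lambda>t. 0"] conjI ballI has_vector_derivative_const)
qed simp

lemma cdiff_id: "cdiff n S (\<lambda>t. t)"
proof (cases n)
  case (Suc m)
  then show ?thesis by simp (intro exI[of _ "\<lambda>t. 1"] conjI ballI has_vector_derivative_id cdiff_const)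
qed simp

lemma cdiff_linear:
  assumes "bounded_linear L"
  shows "cdiff n S f \<Longrightarrow> cdiff n S (\<lambda>t. L (f t))"
proof (induction n arbitrary: f)
  case 0
  then show ?case using bounded_linear.continuous_on[OF assms] by simp
next
  case (Suc n)
  then obtain f' where f': "\<forall>t\<in>S. (f has_vector_derivative f' t) (at t within S)" "cdiff n S f'"
    by auto
  then show ?case
    using Suc.IH[OF f'(2)] bounded_linear.has_vector_derivative[OF assms]
    by (simp, intro exI[of _ "\<lambda>t. L (f' t)"]) auto
qed

lemma cdiff_add: "cdiff n S f \<Longrightarrow> cdiff n S g \<Longrightarrow> cdiff n S (\<lambda>t. f t + g t)"
proof (induction n arbitrary: f g)
  case 0
  then show ?case by (simp add: continuous_on_add)
next
  case (Suc n)
  then obtain f' g' where f': "\<forall>t\<in>S. (f has_vector_derivative f' t) (at t within S)" "cdiff n S f'"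
    and g': "\<forall>t\<in>S. (g has_vector_derivative g' t) (at t within S)" "cdiff n S g'"
    by auto
  then show ?case
    using Suc.IH[OF f'(2) g'(2)]
    by (simp, intro exI[of _ "\<lambda>t. f' t + g' t"]) (auto intro: has_vector_derivative_add)
qed

lemma cdiff_bilinear:
  assumes "bounded_bilinear b"
  shows "cdiff n S f \<Longrightarrow> cdiff n S g \<Longrightarrow> cdiff n S (\<lambda>t. b (f t) (g t))"
proof (induction n arbitrary: f g)
  case 0
  then show ?case using bounded_bilinear.continuous_on[OF assms] by simp
next
  case (Suc n)
  then obtain f' g' where f': "\<forall>t\<in>S. (f has_vector_derivative f' t) (at t within S)" "cdiff n S f'"
    and g': "\<forall>t\<in>S. (g has_vector_derivative g' t) (at t within S)" "cdiff n S g'"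
    by auto
  have "cdiff n S (\<lambda>t. b (f t) (g' t) + b (f' t) (g t))"
    by (intro cdiff_add Suc.IH cdiff_Suc[OF Suc.prems(1)] cdiff_Suc[OF Suc.prems(2)] f'(2) g'(2))
  then show ?case
    using f' g' bounded_bilinear.has_vector_derivative[OF assms]
    by (simp, intro exI[of _ "\<lambda>t. b (f t) (g' t) + b (f' t) (g t)"]) auto
qed

lemma cdiff_compose:
  fixes \<phi> :: "real \<Rightarrow> real"
  shows "cdiff n T f \<Longrightarrow> cdiff n S \<phi> \<Longrightarrow> \<phi> ` S \<subseteq> T \<Longrightarrow> cdiff n S (\<lambda>t. f (\<phi> t))"
proof (induction n arbitrary: f)
  case 0
  then show ?case using continuous_on_compose2 by auto
next
  case (Suc n)
  then obtain f' \<phi>' where f': "\<forall>t\<in>T. (f has_vector_derivative f' t) (at t within T)" "cdiff n T f'"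
    and p': "\<forall>t\<in>S. (\<phi> has_vector_derivative \<phi>' t) (at t within S)" "cdiff n S \<phi>'"
    by auto
  have d: "((\<lambda>t. f (\<phi> t)) has_vector_derivative \<phi>' t *\<^sub>R f' (\<phi> t)) (at t within S)" if "t \<in> S" for t
  proof -
    have "(f has_vector_derivative f' (\<phi> t)) (at (\<phi> t) within \<phi> ` S)"
      using f' Suc.prems that by (meson has_vector_derivative_within_subset image_subset_iff)
    then show ?thesis
      using vector_diff_chain_within[of \<phi> "\<phi>' t" t S f "f' (\<phi> t)"] p' that by (auto simp: o_def)
  qed
  have "cdiff n S (\<lambda>t. \<phi>' t *\<^sub>R f' (\<phi> t))"
    by (rule cdiff_bilinear[OF bounded_bilinear_scaleR p'(2)
          Suc.IH[OF f'(2) cdiff_Suc[OF Suc.prems(2)] Suc.prems(3)]])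
  with d show ?case by (auto intro!: exI[of _ "\<lambda>t. \<phi>' t *\<^sub>R f' (\<phi> t)"])
qed

lemma smooth_onI_deriv:
  assumes "\<And>t. t \<in> S \<Longrightarrow> (f has_vector_derivative f' t) (at t within S)" "smooth_on S f'"
  shows "smooth_on S f"
  unfolding smooth_on_def
proof
  fix n
  have "cdiff (Suc n) S f" using assms by (auto simp: smooth_on_def)
  then show "cdiff n S f" by (rule cdiff_Suc)
qed

lemma smooth_on_cong: "(\<And>t. t \<in> S \<Longrightarrow> f t = g t) \<Longrightarrow> smooth_on S f \<longleftrightarrow> smooth_on S g"
  using cdiff_cong[of S f g] by (simp add: smooth_on_def)

lemma smooth_on_subset: "smooth_on S f \<Longrightarrow> T \<subseteq> S \<Longrightarrow> smooth_on T f"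
  using cdiff_subset[of _ S f T] unfolding smooth_on_def by blast

lemma smooth_on_const: "smooth_on S (\<lambda>t. a)"
  by (simp add: smooth_on_def cdiff_const)

lemma smooth_on_id: "smooth_on S (\<lambda>t. t)"
  by (simp add: smooth_on_def cdiff_id)

lemma smooth_on_linear: "bounded_linear L \<Longrightarrow> smooth_on S f \<Longrightarrow> smooth_on S (\<lambda>t. L (f t))"
  by (simp add: smooth_on_def cdiff_linear)

lemma smooth_on_add: "smooth_on S f \<Longrightarrow> smooth_on S g \<Longrightarrow> smooth_on S (\<lambda>t. f t + g t)"
  by (simp add: smooth_on_def cdiff_add)

lemma smooth_on_scaleR: "smooth_on S f \<Longrightarrow> smooth_on S g \<Longrightarrow> smooth_on S (\<lambda>t. f t *\<^sub>R g t)"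
  by (simp add: smooth_on_def cdiff_bilinear[OF bounded_bilinear_scaleR])

lemma smooth_on_mult:
  fixes f g :: "real \<Rightarrow> real"
  shows "smooth_on S f \<Longrightarrow> smooth_on S g \<Longrightarrow> smooth_on S (\<lambda>t. f t * g t)"
  by (simp add: smooth_on_def cdiff_bilinear[OF bounded_bilinear_mult])

lemma smooth_on_minus: "smooth_on S f \<Longrightarrow> smooth_on S (\<lambda>t. - f t)"
  by (rule smooth_on_linear[OF bounded_linear_minus[OF bounded_linear_ident]])

lemma smooth_on_diff: "smooth_on S f \<Longrightarrow> smooth_on S g \<Longrightarrow> smooth_on S (\<lambda>t. f t - g t)"
  using smooth_on_add[of S f "\<lambda>t. - g t"] smooth_on_minus[of S g] by simp

lemma smooth_on_nth: "smooth_on S f \<Longrightarrow> smooth_on S (\<lambda>t. f t $ i)"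
  by (rule smooth_on_linear[OF bounded_linear_vec_nth])

lemma smooth_on_compose:
  fixes \<phi> :: "real \<Rightarrow> real"
  shows "smooth_on T f \<Longrightarrow> smooth_on S \<phi> \<Longrightarrow> \<phi> ` S \<subseteq> T \<Longrightarrow> smooth_on S (\<lambda>t. f (\<phi> t))"
  using cdiff_compose[of _ T f S \<phi>] unfolding smooth_on_def by blast

lemmas smooth_intros = smooth_on_const smooth_on_id smooth_on_add smooth_on_diff smooth_on_minus
  smooth_on_mult smooth_on_scaleR smooth_on_nth

lemma smooth_on_continuous: "smooth_on S f \<Longrightarrow> continuous_on S f"
  unfolding smooth_on_def by (metis cdiff.simps(1))

lemma cdiff_vector_derivative:
  assumes "\<And>t. t \<in> S \<Longrightarrow> at t within S \<noteq> bot"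
  shows "cdiff (Suc n) S f \<longleftrightarrow>
    (\<forall>t\<in>S. (f has_vector_derivative vector_derivative f (at t within S)) (at t within S)) \<and>
    cdiff n S (\<lambda>t. vector_derivative f (at t within S))" (is "_ \<longleftrightarrow> ?R")
proof
  assume "cdiff (Suc n) S f"
  then obtain f' where f': "\<forall>t\<in>S. (f has_vector_derivative f' t) (at t within S)" "cdiff n S f'"
    by auto
  then have "f' t = vector_derivative f (at t within S)" if "t \<in> S" for t
    using that assms by (metis vector_derivative_within)
  then show ?R using f' cdiff_cong[of S f'] by auto
qed auto

lemma smooth_on_has_vector_derivative:
  assumes "smooth_on S f" "t \<in> S" "at t within S \<noteq> bot"
  shows "(f has_vector_derivative vector_derivative f (at t within S)) (at t within S)"
proof -
  have "cdiff 1 S f" using assms smooth_on_def by blast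
  then obtain f' where "(f has_vector_derivative f' t) (at t within S)" using assms(2) by auto
  then show ?thesis by (metis assms(3) vector_derivative_within)
qed

lemma smooth_on_vector_derivative:
  assumes "smooth_on S f" "\<And>t. t \<in> S \<Longrightarrow> at t within S \<noteq> bot"
  shows "smooth_on S (\<lambda>t. vector_derivative f (at t within S))"
  using assms(1) cdiff_vector_derivative[OF assms(2), where f=f] unfolding smooth_on_def by blast

text \<open>The witness sequence for \<open>smooth_curve_on\<close> is the iterated
  \<open>vector_derivative\<close>, which returns the actual derivative because derivatives are
  unique at accumulation points of \<open>S\<close>.\<close>

lemma smooth_on_curve:
  fixes g :: "real \<Rightarrow> real ^ 3"
  assumes "\<And>t. t \<in> S \<Longrightarrow> at t within S \<noteq> bot"
  shows "smooth_curve_on S g \<longleftrightarrow> smooth_on S g"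
proof
  assume "smooth_curve_on S g"
  then obtain D where D: "D 0 = g"
    "\<And>n t. t \<in> S \<Longrightarrow> (D n has_vector_derivative D (Suc n) t) (at t within S)"
    unfolding smooth_curve_on_def by blast
  have "cdiff n S (D m)" for n m
  proof (induction n arbitrary: m)
    case 0
    then show ?case using D(2)
      by (simp add: continuous_on_eq_continuous_within) (meson has_vector_derivative_continuous)
  next
    case (Suc n)
    then show ?case using D(2) by auto
  qed
  then show "smooth_on S g" using D(1) by (auto simp: smooth_on_def)
next
  assume g: "smooth_on S g"
  define D where "D n = ((\<lambda>f t. vector_derivative f (at t within S)) ^^ n) g" for n
  have "smooth_on S (D n)" for n
    by (induction n) (use g assms smooth_on_vector_derivative in \<open>auto simp: D_def\<close>)
  then have "(D n has_vector_derivative D (Suc n) t) (at t within S)" if "t \<in> S" for t n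
    using smooth_on_has_vector_derivative[OF _ that assms[OF that], of "D n"] by (simp add: D_def)
  moreover have "D 0 = g" by (simp add: D_def)
  ultimately show "smooth_curve_on S g" unfolding smooth_curve_on_def by blast
qed

text \<open>On open sets \<open>vector_derivative f (at t)\<close> does not refer to the
  neighbourhood, so the locally found derivatives are restrictions of a single function and the
  induction on the order goes through. This is what glues a rounded curve together.\<close>

lemma smooth_on_local:
  fixes f :: "real \<Rightarrow> 'a::real_normed_vector"
  assumes "\<And>t. t \<in> S \<Longrightarrow> \<exists>U. open U \<and> t \<in> U \<and> smooth_on U f" "open S"
  shows "smooth_on S f"
proof -
  have nb: "at t within U \<noteq> bot" if "open U" "t \<in> U" for t :: real and U
    using at_within_open[OF that(2,1)] by simp
  have "cdiff n S f" if "\<And>t. t \<in> S \<Longrightarrow> \<exists>U. open U \<and> t \<in> U \<and> cdiff n U f" for n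
    using that
  proof (induction n arbitrary: f)
    case 0
    have "isCont f t" if "t \<in> S" for t
      using 0[OF that] continuous_on_eq_continuous_at by auto
    then show ?case by (simp add: continuous_at_imp_continuous_on)
  next
    case (Suc n)
    have *: "(f has_vector_derivative vector_derivative f (at t)) (at t) \<and>
        (\<exists>U. open U \<and> t \<in> U \<and> cdiff n U (\<lambda>t. vector_derivative f (at t)))" if t: "t \<in> S" for t
    proof -
      obtain U where U: "open U" "t \<in> U" "cdiff (Suc n) U f" using Suc.prems[OF t] by blast
      have "(\<forall>t\<in>U. (f has_vector_derivative vector_derivative f (at t within U)) (at t within U))"
        and "cdiff n U (\<lambda>t. vector_derivative f (at t within U))"
        using U cdiff_vector_derivative[of U n f] nb by auto
      then show ?thesis
        using U cdiff_cong[of U "\<lambda>t. vector_derivative f (at t within U)" "\<lambda>t. vector_derivative f (at t)"]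
        by (auto simp: at_within_open_NO_MATCH)
    qed
    then have "cdiff n S (\<lambda>t. vector_derivative f (at t))"
      by (intro Suc.IH) simp
    moreover have "\<forall>t\<in>S. (f has_vector_derivative vector_derivative f (at t)) (at t within S)"
      using * assms(2) by (simp add: at_within_open_NO_MATCH)
    ultimately show ?case
      unfolding cdiff.simps by (intro exI[of _ "\<lambda>t. vector_derivative f (at t)"] conjI)
  qed
  then show ?thesis using assms(1) unfolding smooth_on_def by blast
qed

subsection \<open>Bump functions\<close>

text \<open>The classical function exp(-1/x), extended by 0 and multiplied by powers of 1/x. With
  these powers the family is closed under differentiation up to linear combinations, so one
  induction over the order proves all members smooth.\<close>

definition flat :: "nat \<Rightarrow> real \<Rightarrow> real" where
  "flat k x = (if x > 0 then (1 / x) ^ k * exp (- (1 / x)) else 0)"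

lemma flat_tendsto_0: "(flat k \<longlongrightarrow> 0) (at 0)"
proof -
  have "((\<lambda>x::real. (1 / x) ^ k * exp (- (1 / x))) \<longlongrightarrow> 0) (at_right 0)"
  proof -
    have "((\<lambda>x::real. x ^ k / exp x) \<longlongrightarrow> 0) at_top" by (rule tendsto_power_div_exp_0)
    then have "((\<lambda>x::real. (inverse x) ^ k / exp (inverse x)) \<longlongrightarrow> 0) (at_right 0)"
      by (rule filterlim_compose) (rule filterlim_inverse_at_top_right)
    moreover have "(inverse x) ^ k / exp (inverse x) = (1 / x) ^ k * exp (- (1 / x))" for x :: real
      by (simp add: exp_minus inverse_eq_divide)
    ultimately show ?thesis by simp
  qed
  then have "(flat k \<longlongrightarrow> 0) (at_right 0)"
    by (rule Lim_transform_eventually) (auto simp: eventually_at_right_field flat_def intro: exI[of _ 1])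
  moreover have "(flat k \<longlongrightarrow> 0) (at_left 0)"
    by (rule Lim_transform_eventually[OF tendsto_const])
      (auto simp: eventually_at_left_field flat_def intro: exI[of _ "-1"])
  ultimately show ?thesis by (simp add: filterlim_at_split)
qed

lemma flat_deriv:
  "(flat k has_vector_derivative flat (k + 2) x - real k * flat (k + 1) x) (at x)"
proof -
  consider "x > 0" | "x < 0" | "x = 0" by linarith
  then show ?thesis
  proof cases
    case 1
    have "((\<lambda>x. (1 / x) ^ k * exp (- (1 / x))) has_real_derivative
        flat (k + 2) x - real k * flat (k + 1) x) (at x)"
    proof (cases k)
      case 0
      then show ?thesis using 1
        by (auto intro!: derivative_eq_intros simp: flat_def power2_eq_square)
    next
      case (Suc m)
      then show ?thesis using 1
        by (auto intro!: derivative_eq_intros simp del: power_Suc simp add: flat_def power_add)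
          (simp add: field_simps power2_eq_square)
    qed
    then have "(flat k has_real_derivative flat (k + 2) x - real k * flat (k + 1) x) (at x)"
      by (rule DERIV_cong_ev[THEN iffD1, rotated -1])
        (use 1 in \<open>auto simp: eventually_nhds flat_def intro!: exI[of _ "{0<..}"]\<close>)
    then show ?thesis by (simp add: has_real_derivative_iff_has_vector_derivative)
  next
    case 2
    have "((\<lambda>x. 0) has_real_derivative 0) (at x)" by simp
    then have "(flat k has_real_derivative 0) (at x)"
      by (rule DERIV_cong_ev[THEN iffD1, rotated -1])
        (use 2 in \<open>auto simp: eventually_nhds flat_def intro!: exI[of _ "{..<0}"]\<close>)
    then show ?thesis using 2 by (simp add: has_real_derivative_iff_has_vector_derivative flat_def)
  next
    case 3
    \<comment> \<open>The difference quotient at 0 is \<open>flat (Suc k)\<close> itself, whose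
      limit is already known.\<close>
    have "((\<lambda>h. flat k h / h) \<longlongrightarrow> 0) (at 0)"
      by (rule Lim_transform_eventually[OF flat_tendsto_0[of "Suc k"]])
        (auto simp: flat_def eventually_at_filter)
    then have "(flat k has_real_derivative 0) (at 0)"
      by (simp add: DERIV_def flat_def)
    then show ?thesis using 3 by (simp add: has_real_derivative_iff_has_vector_derivative flat_def)
  qed
qed

lemma smooth_on_flat: "smooth_on S (flat k)"
proof -
  have "cdiff n UNIV (flat k)" for n k
  proof (induction n arbitrary: k)
    case 0
    have "isCont (flat k) x" for x
      using has_vector_derivative_continuous[OF flat_deriv] .
    then show ?case by (simp add: continuous_at_imp_continuous_on)
  next
    case (Suc n)
    have "cdiff n UNIV (\<lambda>x. flat (k + 2) x + (- real k) *\<^sub>R flat (k + 1) x)"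
      by (intro cdiff_add cdiff_linear[OF bounded_linear_scaleR_right] Suc)
    then show ?case using flat_deriv[of k]
      by (auto intro!: exI[of _ "\<lambda>x. flat (k + 2) x - real k * flat (k + 1) x"])
  qed
  then show ?thesis using cdiff_subset[of _ UNIV] unfolding smooth_on_def by blast
qed

definition bump :: "real \<Rightarrow> real" where "bump x = flat 0 x * flat 0 (1 - x)"

lemma bump_pos: "0 < x \<Longrightarrow> x < 1 \<Longrightarrow> 0 < bump x"
  and bump_nonneg: "0 \<le> bump x"
  and bump_zero: "x \<le> 0 \<or> 1 \<le> x \<Longrightarrow> bump x = 0"
  by (auto simp: bump_def flat_def)

lemma smooth_on_bump: "smooth_on S bump"
proof -
  have "smooth_on S (\<lambda>x. flat 0 x * flat 0 (1 - x))"
    by (intro smooth_intros smooth_on_flat smooth_on_compose[OF smooth_on_flat[of UNIV]]) auto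
  then show ?thesis by (simp add: bump_def[abs_def])
qed

lemma antiderivative_ex:
  fixes f :: "real \<Rightarrow> real"
  assumes "continuous_on {a<..<b} f"
  shows "\<exists>F. \<forall>x\<in>{a<..<b}. (F has_vector_derivative f x) (at x)"
proof (cases "a < b")
  case True
  have "\<exists>F. \<forall>x::real. ereal a < ereal x \<longrightarrow> ereal x < ereal b \<longrightarrow> (F has_vector_derivative f x) (at x)"
    by (rule einterval_antiderivative)
      (use True assms in \<open>auto simp: continuous_on_eq_continuous_at\<close>)
  then show ?thesis by (auto simp: Ball_def)
qed simp

text \<open>The step is the normalised antiderivative of \<open>bump\<close>. Its derivative is
  exported as well because the sign of \<open>\<sigma>'\<close> is needed to keep reparametrisations
  monotone.\<close>

lemma smooth_step_ex:
  "\<exists>\<sigma> \<sigma>' :: real \<Rightarrow> real. smooth_on UNIV \<sigma>' \<and> (\<forall>x. (\<sigma> has_vector_derivative \<sigma>' x) (at x)) \<and>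
     (\<forall>x\<le>0. \<sigma> x = 0) \<and> (\<forall>x\<ge>1. \<sigma> x = 1) \<and> (\<forall>x. 0 \<le> \<sigma> x \<and> \<sigma> x \<le> 1) \<and> (\<forall>x. 0 \<le> \<sigma>' x)"
proof -
  have "\<exists>F. \<forall>x::real. -\<infinity> < ereal x \<longrightarrow> ereal x < \<infinity> \<longrightarrow> (F has_vector_derivative bump x) (at x)"
    by (rule einterval_antiderivative)
      (use smooth_on_continuous[OF smooth_on_bump[of UNIV]] in \<open>auto simp: continuous_on_eq_continuous_at\<close>)
  then obtain F where F: "\<And>x. (F has_real_derivative bump x) (at x)"
    by (auto simp: has_real_derivative_iff_has_vector_derivative)
  have mono: "F x \<le> F y" if "x \<le> y" for x y
    using DERIV_nonneg_imp_nondecreasing[OF that] F bump_nonneg by blast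
  have F01: "F 0 < F 1"
  proof (rule DERIV_pos_imp_increasing_open[of 0 1 F])
    show "\<And>x. 0 < x \<Longrightarrow> x < 1 \<Longrightarrow> \<exists>y. DERIV F x :> y \<and> 0 < y" using F bump_pos by blast
    show "continuous_on {0..1} F" by (rule continuous_at_imp_continuous_on) (use F DERIV_isCont in blast)
  qed simp
  have cont: "continuous_on A F" for A
    by (rule continuous_at_imp_continuous_on) (use F DERIV_isCont in blast)
  have c0: "F x = F 0" if "x \<le> 0" for x
  proof (cases "x = 0")
    case False
    then have x: "x < 0" using that by simp
    have "F 0 = F x"
    proof (rule DERIV_isconst_end[OF x cont])
      fix z :: real assume "x < z" "z < 0"
      then show "DERIV F z :> 0" using F[of z] bump_zero[of z] by simp
    qed
    then show ?thesis ..
  qed simp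
  have c1: "F x = F 1" if "1 \<le> x" for x
  proof (cases "x = 1")
    case False
    then have x: "1 < x" using that by simp
    show "F x = F 1"
    proof (rule DERIV_isconst_end[OF x cont])
      fix z :: real assume "1 < z" "z < x"
      then show "DERIV F z :> 0" using F[of z] bump_zero[of z] by simp
    qed
  qed simp
  define \<sigma> where "\<sigma> x = (F x - F 0) / (F 1 - F 0)" for x
  define \<sigma>' where "\<sigma>' x = bump x * (1 / (F 1 - F 0))" for x
  have "(\<sigma> has_real_derivative \<sigma>' x) (at x)" for x
    unfolding \<sigma>_def \<sigma>'_def using F F01 by (auto intro!: derivative_eq_intros F)
  moreover have "smooth_on UNIV \<sigma>'"
    unfolding \<sigma>'_def[abs_def] by (intro smooth_intros smooth_on_bump)
  moreover have "\<forall>x. 0 \<le> \<sigma> x \<and> \<sigma> x \<le> 1"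
  proof
    fix x
    have "F 0 \<le> F x \<and> F x \<le> F 1" using mono[of 0 x] c0[of x] mono[of x 1] c1[of x] by linarith
    then show "0 \<le> \<sigma> x \<and> \<sigma> x \<le> 1" using F01 by (simp add: \<sigma>_def)
  qed
  moreover have "\<forall>x\<le>0. \<sigma> x = 0" "\<forall>x\<ge>1. \<sigma> x = 1"
    unfolding \<sigma>_def by (auto dest: c0 c1 simp: F01[THEN less_imp_neq, symmetric])
  moreover have "\<forall>x. 0 \<le> \<sigma>' x"
    using bump_nonneg F01 by (auto simp: \<sigma>'_def)
  ultimately show ?thesis
    unfolding has_real_derivative_iff_has_vector_derivative
    by (intro exI[of _ \<sigma>, OF exI[of _ \<sigma>']] conjI) simp_all
qed

subsection \<open>Invariance of the Gauss integral\<close>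

lemma bounded_bilinear_cross3: "bounded_bilinear cross3"
  using bilinear_cross bilinear_conv_bounded_bilinear by blast

lemmas has_vector_derivative_cross3 = bounded_bilinear.has_vector_derivative[OF bounded_bilinear_cross3]
lemmas has_vector_derivative_inner = bounded_bilinear.has_vector_derivative[OF bounded_bilinear_inner]

lemma has_derivative_inverse_norm_cube:
  fixes D :: "real \<Rightarrow> 'a::real_inner"
  assumes "(D has_vector_derivative V) (at x within S)" "D x \<noteq> 0"
  shows "((\<lambda>x. 1 / norm (D x) ^ 3) has_vector_derivative - 3 * (D x \<bullet> V) / norm (D x) ^ 5) (at x within S)"
proof -
  have "(D has_derivative (\<lambda>h. h *\<^sub>R V)) (at x within S)"
    using assms by (simp add: has_vector_derivative_def)
  then have "((\<lambda>x. norm (D x)) has_derivative (\<lambda>h. (h *\<^sub>R V) \<bullet> sgn (D x))) (at x within S)"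
    using has_derivative_norm[OF assms(2)] by (rule has_derivative_compose)
  then have "((\<lambda>x. norm (D x)) has_real_derivative (V \<bullet> sgn (D x))) (at x within S)"
    unfolding has_field_derivative_def by (simp add: mult_commute_abs)
  then have "((\<lambda>x. 1 / norm (D x) ^ 3) has_real_derivative
      - (3 * norm (D x) ^ 2 * (V \<bullet> sgn (D x))) / (norm (D x) ^ 3) ^ 2) (at x within S)"
    using assms(2) by (auto intro!: derivative_eq_intros simp: power2_eq_square)
  also have "- (3 * norm (D x) ^ 2 * (V \<bullet> sgn (D x))) / (norm (D x) ^ 3) ^ 2
      = - 3 * (D x \<bullet> V) / norm (D x) ^ 5"
    using assms(2)
    by (simp add: sgn_div_norm inner_commute field_simps eval_nat_numeral)
  finally show ?thesis by (simp add: has_real_derivative_iff_has_vector_derivative)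
qed

text \<open>The solid angle 2-form at the point \<open>D\<close>, evaluated on \<open>X\<close> and
  \<open>Y\<close>; divided by 4 pi it is the integrand of Gauss' linking integral.\<close>

definition gauss_form :: "real^3 \<Rightarrow> real^3 \<Rightarrow> real^3 \<Rightarrow> real" where
  "gauss_form D X Y = D \<bullet> cross3 X Y / norm D ^ 3"

definition gauss_form_deriv ::
  "real^3 \<Rightarrow> real^3 \<Rightarrow> real^3 \<Rightarrow> real^3 \<Rightarrow> real^3 \<Rightarrow> real^3 \<Rightarrow> real" where
  "gauss_form_deriv D X Y D' X' Y' =
     (D' \<bullet> cross3 X Y + D \<bullet> cross3 X' Y + D \<bullet> cross3 X Y') / norm D ^ 3
     - 3 * (D \<bullet> cross3 X Y) * (D \<bullet> D') / norm D ^ 5"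

lemma has_vector_derivative_gauss_form:
  assumes "(D has_vector_derivative D') (at x within S)" "(X has_vector_derivative X') (at x within S)"
    "(Y has_vector_derivative Y') (at x within S)" "D x \<noteq> 0"
  shows "((\<lambda>x. gauss_form (D x) (X x) (Y x)) has_vector_derivative
      gauss_form_deriv (D x) (X x) (Y x) D' X' Y') (at x within S)"
proof -
  have "((\<lambda>x. D x \<bullet> cross3 (X x) (Y x) * (1 / norm (D x) ^ 3)) has_vector_derivative
      D x \<bullet> cross3 (X x) (Y x) * (- 3 * (D x \<bullet> D') / norm (D x) ^ 5) +
      (D x \<bullet> (cross3 (X x) Y' + cross3 X' (Y x)) + D' \<bullet> cross3 (X x) (Y x)) * (1 / norm (D x) ^ 3))
      (at x within S)"
    by (intro has_vector_derivative_mult has_derivative_inverse_norm_cube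
        has_vector_derivative_inner has_vector_derivative_cross3 assms)
  then show ?thesis
    by (simp add: gauss_form_def gauss_form_deriv_def inner_add_right algebra_simps
        add_divide_distrib diff_divide_distrib)
qed

lemma continuous_on_gauss_form:
  fixes D X Y :: "'b::t2_space \<Rightarrow> real^3"
  assumes "continuous_on S D" "continuous_on S X" "continuous_on S Y" "\<And>x. x \<in> S \<Longrightarrow> D x \<noteq> 0"
  shows "continuous_on S (\<lambda>x. gauss_form (D x) (X x) (Y x))"
  unfolding gauss_form_def
  by (intro continuous_intros continuous_on_cross assms) (use assms in auto)

lemma continuous_on_gauss_form_deriv:
  fixes D X Y :: "'b::t2_space \<Rightarrow> real^3"
  assumes "continuous_on S D" "continuous_on S X" "continuous_on S Y"
    "continuous_on S D'" "continuous_on S X'" "continuous_on S Y'" "\<And>x. x \<in> S \<Longrightarrow> D x \<noteq> 0"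
  shows "continuous_on S (\<lambda>x. gauss_form_deriv (D x) (X x) (Y x) (D' x) (X' x) (Y' x))"
  unfolding gauss_form_deriv_def
  by (intro continuous_intros continuous_on_cross assms) (use assms in auto)

text \<open>The 2-form \<open>D \<mapsto> gauss_form D\<close> is closed. Here \<open>D = A(s) - B(t)\<close> depends on a third
  parameter, \<open>X\<close>, \<open>-Y\<close> and \<open>V\<close> are its partial derivatives, and \<open>U\<close>, \<open>-W\<close> the mixed ones of \<open>V\<close>.\<close>

lemma gauss_form_closed:
  assumes "D \<noteq> 0"
  shows "gauss_form_deriv D X Y V U W =
    gauss_form_deriv D V Y X U 0 - gauss_form_deriv D X V (- Y) 0 (- W)"
proof -
  define r where "r = norm D"
  have r: "r \<noteq> 0" using assms by (simp add: r_def)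
  have DD: "r ^ 2 = D \<bullet> D" by (simp add: r_def power2_norm_eq_inner)
  \<comment> \<open>Cramer's rule D det(V,X,Y) = V det(D,X,Y) + X det(V,D,Y) + Y det(V,X,D), paired
    with D.\<close>
  have key: "(D \<bullet> D) * (V \<bullet> cross3 X Y) =
      (D \<bullet> cross3 X Y) * (D \<bullet> V) - (D \<bullet> cross3 V Y) * (D \<bullet> X) - (D \<bullet> cross3 X V) * (D \<bullet> Y)"
    unfolding inner_vec_def sum_3 cross_components inner_real_def by algebra
  have triple: "X \<bullet> cross3 V Y = - (V \<bullet> cross3 X Y)" "Y \<bullet> cross3 X V = - (V \<bullet> cross3 X Y)"
    unfolding inner_vec_def sum_3 cross_components inner_real_def by algebra+
  have e: "x / r ^ 3 - y / r ^ 5 = ((D \<bullet> D) * x - y) / r ^ 5" for x y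
    using r by (simp add: DD[symmetric] field_simps eval_nat_numeral)
  have n: "(D \<bullet> D) * (V \<bullet> cross3 X Y + D \<bullet> cross3 U Y + D \<bullet> cross3 X W) - 3 * (D \<bullet> cross3 X Y) * (D \<bullet> V) =
      ((D \<bullet> D) * (X \<bullet> cross3 V Y + D \<bullet> cross3 U Y + D \<bullet> cross3 V 0) - 3 * (D \<bullet> cross3 V Y) * (D \<bullet> X)) -
      ((D \<bullet> D) * (- Y \<bullet> cross3 X V + D \<bullet> cross3 0 V + D \<bullet> cross3 X (- W)) - 3 * (D \<bullet> cross3 X V) * (D \<bullet> - Y))"
    using key triple by (simp add: algebra_simps)
  show ?thesis
    unfolding gauss_form_deriv_def r_def[symmetric] e n by (simp add: diff_divide_distrib)
qed

section \<open>Linear homotopies of pairs of C^1 pieces\<close>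

abbreviation piece_deriv :: "(real \<Rightarrow> real^3) \<Rightarrow> real \<Rightarrow> real^3" where
  "piece_deriv g s \<equiv> vector_derivative g (at s within {0..1})"

definition gauss_integral :: "(real \<Rightarrow> real^3) \<Rightarrow> (real \<Rightarrow> real^3) \<Rightarrow> real" where
  "gauss_integral g h = integral {0..1} (\<lambda>s. integral {0..1} (\<lambda>t.
     gauss_form (g s - h t) (piece_deriv g s) (piece_deriv h t)))"

lemma unit_interval_nontrivial: "s \<in> {0..1} \<Longrightarrow> at s within {0..1::real} \<noteq> bot"
  using trivial_limit_within[of s "{0..1::real}"] islimpt_Icc[of 0 1 s] by auto

lemma C1_deriv:
  assumes "cdiff (Suc 0) {0..1} g"
  shows "s \<in> {0..1} \<Longrightarrow> (g has_vector_derivative piece_deriv g s) (at s within {0..1})"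
    and "continuous_on {0..1} (piece_deriv g)" and "continuous_on {0..1} g"
  using assms cdiff_vector_derivative[OF unit_interval_nontrivial, where f = g and n = 0]
    cdiff_Suc[of 0 "{0..1}" g] by auto

text \<open>The two pieces move linearly in \<open>l\<close> with velocities \<open>u\<close> and
  \<open>w\<close>. Linear motion makes the mixed derivatives the tangents of \<open>u\<close> and
  \<open>w\<close>, so C^1 pieces suffice and no second derivative in the curve parameters
  occurs.\<close>

locale gauss_homotopy =
  fixes a u b w :: "real \<Rightarrow> real^3"
  assumes C1: "cdiff (Suc 0) {0..1} a" "cdiff (Suc 0) {0..1} u"
      "cdiff (Suc 0) {0..1} b" "cdiff (Suc 0) {0..1} w"
    and disjoint: "\<And>l s t. l \<in> {0..1} \<Longrightarrow> s \<in> {0..1} \<Longrightarrow> t \<in> {0..1} \<Longrightarrow>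
      a s + l *\<^sub>R u s \<noteq> b t + l *\<^sub>R w t"
begin

definition D where "D l s t = a s + l *\<^sub>R u s - (b t + l *\<^sub>R w t)"
definition V where "V s t = u s - w t"
definition A' where "A' l s = piece_deriv a s + l *\<^sub>R piece_deriv u s"
definition B' where "B' l t = piece_deriv b t + l *\<^sub>R piece_deriv w t"

lemma D_nz: "l \<in> {0..1} \<Longrightarrow> s \<in> {0..1} \<Longrightarrow> t \<in> {0..1} \<Longrightarrow> D l s t \<noteq> 0"
  using disjoint by (simp add: D_def)

lemmas dl = C1_deriv(1)[OF C1(1)] C1_deriv(1)[OF C1(2)] C1_deriv(1)[OF C1(3)] C1_deriv(1)[OF C1(4)]

lemma conts:
  fixes p :: "'b::topological_space \<Rightarrow> real"
  assumes "continuous_on S p" "p ` S \<subseteq> {0..1}"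
  shows "continuous_on S (\<lambda>x. a (p x))" "continuous_on S (\<lambda>x. u (p x))"
    "continuous_on S (\<lambda>x. b (p x))" "continuous_on S (\<lambda>x. w (p x))"
    "continuous_on S (\<lambda>x. piece_deriv a (p x))" "continuous_on S (\<lambda>x. piece_deriv u (p x))"
    "continuous_on S (\<lambda>x. piece_deriv b (p x))" "continuous_on S (\<lambda>x. piece_deriv w (p x))"
  by (rule continuous_on_compose2[OF _ assms]; (rule C1_deriv(2,3)[OF C1(1)] C1_deriv(2,3)[OF C1(2)]
        C1_deriv(2,3)[OF C1(3)] C1_deriv(2,3)[OF C1(4)]))+

lemma D_deriv_l: "(\<lambda>l. D l s t) = (\<lambda>l. a s - b t + l *\<^sub>R V s t)"
  by (auto simp: D_def V_def algebra_simps)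

definition F where "F l s t = gauss_form (D l s t) (A' l s) (B' l t)"
text \<open>Inserting the velocity \<open>V\<close> for the first or for the second tangent gives
  the boundary densities \<open>P\<close> and \<open>Q\<close>. Closedness of the form says that the
  \<open>l\<close>-derivative of \<open>F\<close> is the \<open>s\<close>-derivative of
  \<open>P\<close> minus the \<open>t\<close>-derivative of \<open>Q\<close>.\<close>

definition P where "P l s t = gauss_form (D l s t) (V s t) (B' l t)"
definition Q where "Q l s t = gauss_form (D l s t) (A' l s) (V s t)"
definition P' where "P' l s t = gauss_form_deriv (D l s t) (V s t) (B' l t) (A' l s) (piece_deriv u s) 0"
definition Q' where
  "Q' l s t = gauss_form_deriv (D l s t) (A' l s) (V s t) (- B' l t) 0 (- piece_deriv w t)"

lemma F_deriv:
  assumes "l \<in> {0..1}" "s \<in> {0..1}" "t \<in> {0..1}"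
  shows "((\<lambda>l. F l s t) has_vector_derivative P' l s t - Q' l s t) (at l within {0..1})"
proof -
  have 1: "((\<lambda>l. D l s t) has_vector_derivative V s t) (at l within {0..1})"
    unfolding D_deriv_l by (auto intro!: derivative_eq_intros)
  have 2: "((\<lambda>l. A' l s) has_vector_derivative piece_deriv u s) (at l within {0..1})"
    unfolding A'_def by (auto intro!: derivative_eq_intros)
  have 3: "((\<lambda>l. B' l t) has_vector_derivative piece_deriv w t) (at l within {0..1})"
    unfolding B'_def by (auto intro!: derivative_eq_intros)
  show ?thesis
    unfolding F_def P'_def Q'_def gauss_form_closed[OF D_nz[OF assms], symmetric]
    by (rule has_vector_derivative_gauss_form[OF 1 2 3 D_nz[OF assms]])
qed

lemma P_deriv:
  assumes "l \<in> {0..1}" "s \<in> {0..1}" "t \<in> {0..1}"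
  shows "((\<lambda>s. P l s t) has_vector_derivative P' l s t) (at s within {0..1})"
proof -
  have 1: "((\<lambda>s. D l s t) has_vector_derivative A' l s) (at s within {0..1})"
    unfolding D_def A'_def by (auto intro!: derivative_eq_intros dl assms)
  have 2: "((\<lambda>s. V s t) has_vector_derivative piece_deriv u s) (at s within {0..1})"
    unfolding V_def by (auto intro!: derivative_eq_intros dl assms)
  show ?thesis
    unfolding P_def P'_def
    by (rule has_vector_derivative_gauss_form[OF 1 2 has_vector_derivative_const D_nz[OF assms]])
qed

lemma Q_deriv:
  assumes "l \<in> {0..1}" "s \<in> {0..1}" "t \<in> {0..1}"
  shows "((\<lambda>t. Q l s t) has_vector_derivative Q' l s t) (at t within {0..1})"
proof -
  have 1: "((\<lambda>t. D l s t) has_vector_derivative - B' l t) (at t within {0..1})"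
    unfolding D_def B'_def by (auto intro!: derivative_eq_intros dl assms)
  have 2: "((\<lambda>t. V s t) has_vector_derivative - piece_deriv w t) (at t within {0..1})"
    unfolding V_def by (auto intro!: derivative_eq_intros dl assms)
  show ?thesis
    unfolding Q_def Q'_def
    by (rule has_vector_derivative_gauss_form[OF 1 has_vector_derivative_const 2 D_nz[OF assms]])
qed

lemma cont_FPQ:
  fixes l s t :: "'b::t2_space \<Rightarrow> real"
  assumes "continuous_on S l" "l ` S \<subseteq> {0..1}" "continuous_on S s" "s ` S \<subseteq> {0..1}"
    "continuous_on S t" "t ` S \<subseteq> {0..1}"
  shows "continuous_on S (\<lambda>x. F (l x) (s x) (t x))" "continuous_on S (\<lambda>x. P' (l x) (s x) (t x))"
    "continuous_on S (\<lambda>x. Q' (l x) (s x) (t x))"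
proof -
  note c = conts[OF assms(3,4)] conts[OF assms(5,6)]
  have n: "D (l x) (s x) (t x) \<noteq> 0" if "x \<in> S" for x using D_nz that assms by blast
  have D: "continuous_on S (\<lambda>x. D (l x) (s x) (t x))" "continuous_on S (\<lambda>x. V (s x) (t x))"
    "continuous_on S (\<lambda>x. A' (l x) (s x))" "continuous_on S (\<lambda>x. B' (l x) (t x))"
    unfolding D_def V_def A'_def B'_def by (intro continuous_intros c assms(1))+
  show "continuous_on S (\<lambda>x. F (l x) (s x) (t x))" "continuous_on S (\<lambda>x. P' (l x) (s x) (t x))"
    "continuous_on S (\<lambda>x. Q' (l x) (s x) (t x))"
    unfolding F_def P'_def Q'_def
    by (intro continuous_on_gauss_form continuous_on_gauss_form_deriv continuous_intros D c n; assumption)+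
qed

lemma F_eq_gauss_integral:
  assumes "l \<in> {0..1}"
  shows "integral {0..1} (\<lambda>s. integral {0..1} (F l s)) =
    gauss_integral (\<lambda>s. a s + l *\<^sub>R u s) (\<lambda>t. b t + l *\<^sub>R w t)"
proof -
  have 1: "piece_deriv (\<lambda>s. a s + l *\<^sub>R u s) s = A' l s" if "s \<in> {0..1}" for s
    unfolding A'_def
    by (rule vector_derivative_within[OF unit_interval_nontrivial[OF that]])
      (auto intro!: derivative_eq_intros dl that)
  have 2: "piece_deriv (\<lambda>t. b t + l *\<^sub>R w t) t = B' l t" if "t \<in> {0..1}" for t
    unfolding B'_def
    by (rule vector_derivative_within[OF unit_interval_nontrivial[OF that]])
      (auto intro!: derivative_eq_intros dl that)
  show ?thesis
    unfolding gauss_integral_def F_def D_def by (intro integral_cong) (simp add: 1 2)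
qed

text \<open>Stokes' theorem on the unit square: after differentiation under the integral, the
  fundamental theorem is applied in \<open>s\<close> to \<open>P'\<close> and in \<open>t\<close> to
  \<open>Q'\<close>, which leaves only the ends of the two pieces.\<close>

lemma gauss_integral_deriv:
  assumes l: "l \<in> {0..1}"
  shows "((\<lambda>l. gauss_integral (\<lambda>s. a s + l *\<^sub>R u s) (\<lambda>t. b t + l *\<^sub>R w t)) has_vector_derivative
      integral {0..1} (\<lambda>t. P l 1 t - P l 0 t) - integral {0..1} (\<lambda>s. Q l s 1 - Q l s 0))
      (at l within {0..1})"
proof -
  let ?B = "cbox (0, 0) (1, 1) :: (real \<times> real) set"
  have B: "fst ` ?B \<subseteq> {0..1}" "snd ` ?B \<subseteq> {0..1}" by (auto simp: cbox_Pair_eq)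
  have cf: "continuous_on ?B (\<lambda>(s, t). F l s t)" if "l \<in> {0..1}" for l
    unfolding split_beta by (intro cont_FPQ continuous_intros B) (use that in auto)
  have cP: "continuous_on ?B (\<lambda>(s, t). P' l s t)" "continuous_on ?B (\<lambda>(s, t). Q' l s t)"
    if "l \<in> {0..1}" for l
    unfolding split_beta by (intro cont_FPQ continuous_intros B; use that in auto)+
  have d: "((\<lambda>l. integral ?B (\<lambda>(s, t). F l s t)) has_vector_derivative
     integral ?B (\<lambda>(s, t). P' l s t - Q' l s t)) (at l within {0..1})"
  proof (rule leibniz_rule_vector_derivative)
    show "((\<lambda>x. case z of (s, t) \<Rightarrow> F x s t) has_vector_derivative
        (case z of (s, t) \<Rightarrow> P' x s t - Q' x s t)) (at x within {0..1})"
      if "x \<in> {0..1}" "z \<in> ?B" for x z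
      using F_deriv that by (cases z) (auto simp: cbox_Pair_eq)
    show "(\<lambda>(s, t). F x s t) integrable_on ?B" if "x \<in> {0..1}" for x
      by (rule integrable_continuous[OF cf[OF that]])
    show "continuous_on ({0..1} \<times> ?B) (\<lambda>(x, z). case z of (s, t) \<Rightarrow> P' x s t - Q' x s t)"
      unfolding split_beta
      by (intro continuous_on_diff cont_FPQ continuous_intros) (auto simp: cbox_Pair_eq)
  qed (use l in auto)
  have eF: "integral ?B (\<lambda>(s, t). F l s t) = gauss_integral (\<lambda>s. a s + l *\<^sub>R u s) (\<lambda>t. b t + l *\<^sub>R w t)"
    if "l \<in> {0..1}" for l
    using integral_prod_continuous[OF cf[OF that]] F_eq_gauss_integral[OF that] by simp
  have ePQ: "integral ?B (\<lambda>(s, t). P' l s t - Q' l s t) =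
      integral {0..1} (\<lambda>t. P l 1 t - P l 0 t) - integral {0..1} (\<lambda>s. Q l s 1 - Q l s 0)"
  proof -
    have "integral ?B (\<lambda>(s, t). P' l s t - Q' l s t) =
        integral ?B (\<lambda>(s, t). P' l s t) - integral ?B (\<lambda>(s, t). Q' l s t)"
      using integral_diff[OF integrable_continuous[OF cP(1)[OF l]] integrable_continuous[OF cP(2)[OF l]]]
      by (simp add: case_prod_unfold)
    moreover have "integral ?B (\<lambda>(s, t). Q' l s t) = integral {0..1} (\<lambda>s. Q l s 1 - Q l s 0)"
    proof -
      have "integral {0..1} (\<lambda>t. Q' l s t) = Q l s 1 - Q l s 0" if "s \<in> {0..1}" for s
        by (rule integral_unique[OF fundamental_theorem_of_calculus]) (use Q_deriv l that in auto)
      moreover have "integral ?B (\<lambda>(s, t). Q' l s t) = integral {0..1} (\<lambda>s. integral {0..1} (Q' l s))"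
        using integral_prod_continuous[OF cP(2)[OF l]] by (simp only: box_real case_prod_conv)
      moreover have "integral {0..1} (\<lambda>s. integral {0..1} (Q' l s)) = integral {0..1} (\<lambda>s. Q l s 1 - Q l s 0)"
        by (rule integral_cong) fact
      ultimately show ?thesis by simp
    qed
    moreover have "integral ?B (\<lambda>(s, t). P' l s t) = integral {0..1} (\<lambda>t. P l 1 t - P l 0 t)"
    proof -
      have "integral {0..1} (\<lambda>s. P' l s t) = P l 1 t - P l 0 t" if "t \<in> {0..1}" for t
        by (rule integral_unique[OF fundamental_theorem_of_calculus]) (use P_deriv l that in auto)
      then have "integral {0..1} (\<lambda>t. integral {0..1} (\<lambda>s. P' l s t)) = integral {0..1} (\<lambda>t. P l 1 t - P l 0 t)"
        by (rule integral_cong)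
      \<comment> \<open>For \<open>P'\<close> the inner integral has to run over \<open>s\<close>,
        so the order of integration is exchanged.\<close>
      moreover have "integral ?B (\<lambda>(s, t). P' l s t) = integral {0..1} (\<lambda>t. integral {0..1} (\<lambda>s. P' l s t))"
        using integral_prod_continuous[OF cP(1)[OF l]] integral_swap_continuous[OF cP(1)[OF l]]
        by (simp only: box_real case_prod_conv)
      ultimately show ?thesis by simp
    qed
    ultimately show ?thesis by simp
  qed
  show ?thesis
    by (rule has_vector_derivative_transform[OF l eF[symmetric] d[unfolded ePQ]])
qed

end

lemma sum_cyclic_shift:
  fixes g :: "nat \<Rightarrow> 'a::comm_monoid_add"
  shows "(\<Sum>i<k. g (Suc i mod k)) = (\<Sum>i<k. g i)"
proof (cases k)
  case (Suc m)
  have "(\<Sum>i<Suc m. g (Suc i mod Suc m)) = (\<Sum>i<m. g (Suc i)) + g 0" by simp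
  also have "\<dots> = (\<Sum>i<Suc m. g i)" unfolding sum.lessThan_Suc_shift by (rule add.commute)
  finally show ?thesis using Suc by simp
qed simp

text \<open>The boundary term at an end of \<open>a i\<close> contains the values of
  \<open>a i\<close> and \<open>u i\<close> there, but not their derivatives. Hence the end of one
  piece and the start of the next contribute equally even across a corner, and the boundary terms
  cancel around the closed polygon.\<close>

lemma gauss_sum_homotopy:
  fixes a u b w :: "nat \<Rightarrow> real \<Rightarrow> real^3"
  assumes C1: "\<And>i. i < k \<Longrightarrow> cdiff (Suc 0) {0..1} (a i)" "\<And>i. i < k \<Longrightarrow> cdiff (Suc 0) {0..1} (u i)"
      "\<And>i. i < k \<Longrightarrow> cdiff (Suc 0) {0..1} (b i)" "\<And>i. i < k \<Longrightarrow> cdiff (Suc 0) {0..1} (w i)"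
    and closed: "\<And>i. i < k \<Longrightarrow> a i 1 = a (Suc i mod k) 0" "\<And>i. i < k \<Longrightarrow> u i 1 = u (Suc i mod k) 0"
      "\<And>i. i < k \<Longrightarrow> b i 1 = b (Suc i mod k) 0" "\<And>i. i < k \<Longrightarrow> w i 1 = w (Suc i mod k) 0"
    and disjoint: "\<And>i j l s t. i < k \<Longrightarrow> j < k \<Longrightarrow> l \<in> {0..1} \<Longrightarrow> s \<in> {0..1} \<Longrightarrow> t \<in> {0..1} \<Longrightarrow>
      a i s + l *\<^sub>R u i s \<noteq> b j t + l *\<^sub>R w j t"
  shows "(\<Sum>i<k. \<Sum>j<k. gauss_integral (\<lambda>s. a i s + u i s) (\<lambda>t. b j t + w j t)) =
    (\<Sum>i<k. \<Sum>j<k. gauss_integral (a i) (b j))"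
proof -
  have H: "gauss_homotopy (a i) (u i) (b j) (w j)" if "i < k" "j < k" for i j
    by unfold_locales (use C1 disjoint that in auto)
  define J where "J l = (\<Sum>i<k. \<Sum>j<k. gauss_integral (\<lambda>s. a i s + l *\<^sub>R u i s) (\<lambda>t. b j t + l *\<^sub>R w j t))" for l
  define p where "p l i j s = integral {0..1} (\<lambda>t. gauss_homotopy.P (a i) (u i) (b j) (w j) l s t)" for l i j s
  define q where "q l i j t = integral {0..1} (\<lambda>s. gauss_homotopy.Q (a i) (u i) (b j) (w j) l s t)" for l i j t
  have J': "(J has_vector_derivative 0) (at l within {0..1})" if l: "l \<in> {0..1}" for l
  proof -
    have "(J has_vector_derivative
        (\<Sum>i<k. \<Sum>j<k. (p l i j 1 - p l i j 0) - (q l i j 1 - q l i j 0))) (at l within {0..1})"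
      unfolding J_def
    proof (intro has_vector_derivative_sum)
      fix i j assume "i \<in> {..<k}" "j \<in> {..<k}"
      then interpret gauss_homotopy "a i" "u i" "b j" "w j" using H by simp
      have "(\<lambda>t. P l s t) integrable_on {0..1}" "(\<lambda>t. Q l t s) integrable_on {0..1}" if "s \<in> {0..1}" for s
        unfolding P_def Q_def D_def V_def A'_def B'_def
        using that l D_nz[OF l, unfolded D_def]
        by (intro integrable_continuous_real continuous_on_gauss_form continuous_intros
            C1_deriv(2,3) C1; auto)+
      then show "((\<lambda>x. gauss_integral (\<lambda>s. a i s + x *\<^sub>R u i s) (\<lambda>t. b j t + x *\<^sub>R w j t))
          has_vector_derivative p l i j 1 - p l i j 0 - (q l i j 1 - q l i j 0)) (at l within {0..1})"
        using gauss_integral_deriv[OF l] by (simp add: p_def q_def integral_diff)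
    qed
    moreover have "p l i j 1 = p l (Suc i mod k) j 0" if "i < k" "j < k" for i j
    proof -
      interpret gauss_homotopy "a i" "u i" "b j" "w j" using H that by simp
      interpret h2: gauss_homotopy "a (Suc i mod k)" "u (Suc i mod k)" "b j" "w j" using H that by simp
      show ?thesis
        unfolding p_def P_def h2.P_def D_def h2.D_def V_def h2.V_def B'_def h2.B'_def
        using closed that by simp
    qed
    then have "(\<Sum>i<k. \<Sum>j<k. p l i j 1 - p l i j 0) = 0"
      using sum_cyclic_shift[of "\<lambda>i. \<Sum>j<k. p l i j 0" k] by (simp add: sum_subtractf)
    moreover have "q l i j 1 = q l i (Suc j mod k) 0" if "i < k" "j < k" for i j
    proof -
      interpret gauss_homotopy "a i" "u i" "b j" "w j" using H that by simp
      interpret h2: gauss_homotopy "a i" "u i" "b (Suc j mod k)" "w (Suc j mod k)" using H that by simp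
      show ?thesis
        unfolding q_def Q_def h2.Q_def D_def h2.D_def V_def h2.V_def A'_def h2.A'_def
        using closed that by simp
    qed
    then have "(\<Sum>i<k. \<Sum>j<k. q l i j 1 - q l i j 0) = 0"
      using sum_cyclic_shift[of "\<lambda>j. q l i j 0" k for i] by (simp add: sum_subtractf)
    ultimately show ?thesis by (simp add: sum_subtractf)
  qed
  have "\<exists>c. \<forall>l\<in>{0..1}. J l = c"
    by (rule has_vector_derivative_zero_constant[of "{0..1}" J]) (use J' in auto)
  then have "J 1 = J 0" by force
  then show ?thesis by (simp add: J_def)
qed

section \<open>Cutting the linking integral into pieces of unit length\<close>

lemma integral_unit_pieces:
  fixes f :: "real \<Rightarrow> real"
  assumes "continuous_on {0..real k} f"
  shows "integral {0..real k} f = (\<Sum>i<k. integral {0..1} (\<lambda>s. f (real i + s)))"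
  using assms
proof (induction k)
  case (Suc k)
  have "integral {0..real (Suc k)} f = integral {0..real k} f + integral {real k..real (Suc k)} f"
    using Henstock_Kurzweil_Integration.integral_combine[OF _ _ integrable_continuous_real[OF Suc.prems], of "real k"] by simp
  moreover have "integral {real k..real (Suc k)} f = integral {0..1} (\<lambda>s. f (real k + s))"
    using integral_shift_Icc_real[of 0 1 f "real k"] by (simp add: o_def add.commute)
  moreover have "continuous_on {0..real k} f" using Suc.prems by (rule continuous_on_subset) auto
  ultimately show ?case using Suc.IH by simp
qed simp

lemma has_vector_derivative_shift:
  fixes p :: "real \<Rightarrow> 'a::real_normed_vector"
  assumes "(p has_vector_derivative d) (at (c + s) within (\<lambda>s. c + s) ` S)"
  shows "((\<lambda>s. p (c + s)) has_vector_derivative d) (at s within S)"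
proof -
  have "((\<lambda>s. c + s) has_vector_derivative 1) (at s within S)"
    by (auto intro!: derivative_eq_intros)
  from vector_diff_chain_within[OF this assms] show ?thesis by (simp add: o_def)
qed

lemma linking_number_pieces:
  assumes g: "\<And>t. (g has_vector_derivative g' t) (at t)" "continuous_on UNIV g'"
    and h: "\<And>t. (h has_vector_derivative h' t) (at t)" "continuous_on UNIV h'"
    and disj: "\<And>s t. g s \<noteq> h t"
  shows "linking_number (real k) g h =
    1 / (4 * pi) * (\<Sum>i<k. \<Sum>j<k. gauss_integral (\<lambda>s. g (real i + s)) (\<lambda>t. h (real j + t)))"
proof -
  define f where "f s t = gauss_form (g s - h t) (g' s) (h' t)" for s t
  have cg: "continuous_on S (\<lambda>x. g (p x))" "continuous_on S (\<lambda>x. g' (p x))"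
    "continuous_on S (\<lambda>x. h (p x))" "continuous_on S (\<lambda>x. h' (p x))"
    if "continuous_on S p" for p :: "'b::t2_space \<Rightarrow> real" and S
  proof -
    have *: "continuous_on UNIV g" "continuous_on UNIV h"
      using has_vector_derivative_continuous[OF g(1)] has_vector_derivative_continuous[OF h(1)]
      by (auto intro: continuous_at_imp_continuous_on)
    show "continuous_on S (\<lambda>x. g (p x))" "continuous_on S (\<lambda>x. g' (p x))"
      "continuous_on S (\<lambda>x. h (p x))" "continuous_on S (\<lambda>x. h' (p x))"
      by (rule continuous_on_compose2[OF *(1) that] continuous_on_compose2[OF *(2) that]
          continuous_on_compose2[OF g(2) that] continuous_on_compose2[OF h(2) that], simp)+
  qed
  have cf: "continuous_on S (\<lambda>x. f (p x) (q x))" if "continuous_on S p" "continuous_on S q"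
    for p q :: "'b::t2_space \<Rightarrow> real" and S
    unfolding f_def by (intro continuous_on_gauss_form continuous_intros cg that) (use disj in auto)
  have ci: "continuous_on {0..real k} (\<lambda>s. integral {0..1} (\<lambda>t. f s (real j + t)))" for j
  proof -
    have "continuous_on ({0..real k} \<times> cbox 0 1) (\<lambda>(s, t). f s (real j + t))"
      unfolding split_beta by (intro cf continuous_intros)
    from integral_continuous_on_param[OF this] show ?thesis by simp
  qed
  have "linking_number (real k) g h = 1 / (4 * pi) * integral {0..real k} (\<lambda>s. integral {0..real k} (f s))"
    unfolding linking_number_def f_def gauss_form_def
    by (simp add: vector_derivative_at[OF g(1)] vector_derivative_at[OF h(1)])
  also have "integral {0..real k} (\<lambda>s. integral {0..real k} (f s)) =
      integral {0..real k} (\<lambda>s. \<Sum>j<k. integral {0..1} (\<lambda>t. f s (real j + t)))"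
    by (intro integral_cong integral_unit_pieces cf continuous_intros)
  also have "\<dots> = (\<Sum>j<k. integral {0..real k} (\<lambda>s. integral {0..1} (\<lambda>t. f s (real j + t))))"
    by (intro integral_sum integrable_continuous_real ci) auto
  also have "\<dots> = (\<Sum>j<k. \<Sum>i<k. integral {0..1} (\<lambda>s. integral {0..1} (\<lambda>t. f (real i + s) (real j + t))))"
    by (intro sum.cong refl integral_unit_pieces ci)
  also have "\<dots> = (\<Sum>i<k. \<Sum>j<k. gauss_integral (\<lambda>s. g (real i + s)) (\<lambda>t. h (real j + t)))"
  proof -
    have d: "piece_deriv (\<lambda>s. p (real i + s)) s = p' (real i + s)"
      if "s \<in> {0..1}" "\<And>t. (p has_vector_derivative p' t) (at t)" for s i p p'
      by (intro vector_derivative_within[OF unit_interval_nontrivial[OF that(1)]]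
          has_vector_derivative_shift has_vector_derivative_at_within[OF that(2)])
    have "gauss_integral (\<lambda>s. g (real i + s)) (\<lambda>t. h (real j + t)) =
       integral {0..1} (\<lambda>s. integral {0..1} (\<lambda>t. f (real i + s) (real j + t)))" for i j
      unfolding gauss_integral_def f_def
      by (intro integral_cong) (simp add: d[OF _ g(1)] d[OF _ h(1)])
    then show ?thesis using sum.swap by simp
  qed
  finally show ?thesis .
qed

lemma gauss_integral_cong:
  assumes "\<And>s. s \<in> {0..1} \<Longrightarrow> g s = g' s" "\<And>t. t \<in> {0..1} \<Longrightarrow> h t = h' t"
  shows "gauss_integral g h = gauss_integral g' h'"
proof -
  have vd: "piece_deriv p s = piece_deriv q s"
    if "\<And>s. s \<in> {0..1} \<Longrightarrow> p s = q s" "s \<in> {0..1}" for p q :: "real \<Rightarrow> real^3" and s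
  proof -
    have "(p has_vector_derivative d) (at s within {0..1}) \<longleftrightarrow> (q has_vector_derivative d) (at s within {0..1})" for d
      using that has_vector_derivative_transform[of s "{0..1}"] by metis
    then show ?thesis by (simp add: vector_derivative_def)
  qed
  show ?thesis
    unfolding gauss_integral_def
    by (intro integral_cong) (simp only: vd[of g g', OF assms(1)] vd[of h h', OF assms(2)] assms)
qed

section \<open>Reversing the direction of a piece\<close>

lemma integral_unit_reflect:
  fixes f :: "real \<Rightarrow> real"
  shows "integral {0..1} (\<lambda>s. f (1 - s)) = integral {0..1} f"
proof -
  have "integral {0..1} (\<lambda>s. f (1 - s)) = integral {- 1..- 0} (\<lambda>s. f (1 + s))"
    using Henstock_Kurzweil_Integration.integral_reflect_real[of 0 "- 1" "\<lambda>s. f (1 + s)"] by simp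
  also have "\<dots> = integral {0..1} f"
    using integral_shift_Icc_real[of "- 1" 0 f 1] by (simp add: o_def)
  finally show ?thesis .
qed

lemma piece_deriv_reverse:
  assumes "cdiff (Suc 0) {0..1} g" "s \<in> {0..1}"
  shows "piece_deriv (\<lambda>s. g (1 - s)) s = - piece_deriv g (1 - s)"
proof (rule vector_derivative_within[OF unit_interval_nontrivial[OF assms(2)]])
  have "(g has_vector_derivative piece_deriv g (1 - s)) (at (1 - s) within (\<lambda>s. 1 - s) ` {0..1})"
    using C1_deriv(1)[OF assms(1), of "1 - s"] assms(2)
    by (auto intro: has_vector_derivative_within_subset)
  moreover have "((\<lambda>s. 1 - s) has_vector_derivative - 1) (at s within {0..1})"
    by (auto intro!: derivative_eq_intros)
  ultimately have "(g \<circ> (\<lambda>s. 1 - s) has_vector_derivative (- 1) *\<^sub>R piece_deriv g (1 - s)) (at s within {0..1})"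
    by (rule vector_diff_chain_within[rotated])
  then show "((\<lambda>s. g (1 - s)) has_vector_derivative - piece_deriv g (1 - s)) (at s within {0..1})"
    by (simp add: o_def)
qed

lemma gauss_integral_reverse:
  assumes "cdiff (Suc 0) {0..1} g" "cdiff (Suc 0) {0..1} h"
  shows "gauss_integral (\<lambda>s. g (1 - s)) h = - gauss_integral g h"
    and "gauss_integral g (\<lambda>t. h (1 - t)) = - gauss_integral g h"
proof -
  have m: "gauss_form D (- X) Y = - gauss_form D X Y" "gauss_form D X (- Y) = - gauss_form D X Y" for D X Y
    by (simp_all add: gauss_form_def)
  have "gauss_integral (\<lambda>s. g (1 - s)) h = integral {0..1} (\<lambda>s. - integral {0..1} (\<lambda>t.
     gauss_form (g (1 - s) - h t) (piece_deriv g (1 - s)) (piece_deriv h t)))"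
    unfolding gauss_integral_def
    by (intro integral_cong) (simp add: piece_deriv_reverse[OF assms(1)] m)
  also have "\<dots> = - integral {0..1} (\<lambda>s. integral {0..1} (\<lambda>t.
     gauss_form (g (1 - s) - h t) (piece_deriv g (1 - s)) (piece_deriv h t)))" by simp
  also have "\<dots> = - gauss_integral g h"
    using integral_unit_reflect[of "\<lambda>s. integral {0..1} (\<lambda>t.
      gauss_form (g s - h t) (piece_deriv g s) (piece_deriv h t))"]
    unfolding gauss_integral_def by simp
  finally show "gauss_integral (\<lambda>s. g (1 - s)) h = - gauss_integral g h" .
  have "integral {0..1} (\<lambda>t. gauss_form (g s - h (1 - t)) (piece_deriv g s) (piece_deriv (\<lambda>t. h (1 - t)) t)) =
      - integral {0..1} (\<lambda>t. gauss_form (g s - h t) (piece_deriv g s) (piece_deriv h t))" for s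
  proof -
    have "integral {0..1} (\<lambda>t. gauss_form (g s - h (1 - t)) (piece_deriv g s) (piece_deriv (\<lambda>t. h (1 - t)) t)) =
        integral {0..1} (\<lambda>t. - gauss_form (g s - h (1 - t)) (piece_deriv g s) (piece_deriv h (1 - t)))"
      by (intro integral_cong) (simp add: piece_deriv_reverse[OF assms(2)] m)
    also have "\<dots> = - integral {0..1} (\<lambda>t. gauss_form (g s - h (1 - t)) (piece_deriv g s) (piece_deriv h (1 - t)))"
      by simp
    also have "\<dots> = - integral {0..1} (\<lambda>t. gauss_form (g s - h t) (piece_deriv g s) (piece_deriv h t))"
      using integral_unit_reflect[of "\<lambda>t. gauss_form (g s - h t) (piece_deriv g s) (piece_deriv h t)"] by simp
    finally show ?thesis .
  qed
  then show "gauss_integral g (\<lambda>t. h (1 - t)) = - gauss_integral g h"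
    unfolding gauss_integral_def by simp
qed

subsection \<open>Rounding a corner\<close>

lemma smooth_on_UNIV_D:
  assumes "smooth_on UNIV f"
  shows "(f has_vector_derivative vector_derivative f (at t)) (at t)"
    "smooth_on UNIV (\<lambda>t. vector_derivative f (at t))"
  using smooth_on_has_vector_derivative[OF assms] smooth_on_vector_derivative[OF assms] by simp_all

lemma vector_derivative_eqI_open:
  assumes "(f has_vector_derivative f') (at t)" "open U" "t \<in> U" "\<And>s. s \<in> U \<Longrightarrow> g s = f s"
  shows "vector_derivative g (at t) = f'" "(g has_vector_derivative f') (at t)"
proof -
  show *: "(g has_vector_derivative f') (at t)"
    by (rule has_vector_derivative_transform_within_open[OF assms(1-3)]) (simp add: assms(4))
  then show "vector_derivative g (at t) = f'" by (rule vector_derivative_at)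
qed

text \<open>The smooth step is composed with an affine function of t^2, so no gluing at 0 is needed.
  The sign condition on \<open>t * \<rho>' t\<close> makes \<open>t * \<rho> t\<close>
  nondecreasing, which \<open>flattening_ex\<close> exploits.\<close>

lemma cutoff_ex:
  fixes \<alpha> \<beta> :: real
  assumes "0 < \<alpha>" "\<alpha> < \<beta>"
  shows "\<exists>\<rho> \<rho>'. smooth_on UNIV \<rho> \<and> (\<forall>t. (\<rho> has_vector_derivative \<rho>' t) (at t)) \<and>
    (\<forall>t. \<bar>t\<bar> \<le> \<alpha> \<longrightarrow> \<rho> t = 0) \<and> (\<forall>t. \<beta> \<le> \<bar>t\<bar> \<longrightarrow> \<rho> t = 1) \<and>
    (\<forall>t. 0 \<le> \<rho> t \<and> \<rho> t \<le> 1) \<and> (\<forall>t. 0 \<le> t * \<rho>' t)"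
proof -
  obtain \<sigma> \<sigma>' :: "real \<Rightarrow> real" where \<sigma>: "smooth_on UNIV \<sigma>'"
    "\<And>x. (\<sigma> has_vector_derivative \<sigma>' x) (at x)" "\<And>x. x \<le> 0 \<Longrightarrow> \<sigma> x = 0" "\<And>x. 1 \<le> x \<Longrightarrow> \<sigma> x = 1"
    "\<And>x. 0 \<le> \<sigma> x \<and> \<sigma> x \<le> 1" "\<And>x. 0 \<le> \<sigma>' x"
    using smooth_step_ex by metis
  define c where "c = 1 / (\<beta>\<^sup>2 - \<alpha>\<^sup>2)"
  have ab: "\<alpha>\<^sup>2 < \<beta>\<^sup>2" using assms by (intro power_strict_mono) auto
  then have c: "0 < c" by (simp add: c_def)
  define u where "u t = (t * t - \<alpha>\<^sup>2) * c" for t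
  have su: "smooth_on UNIV u" unfolding u_def[abs_def] by (intro smooth_intros)
  have s\<sigma>: "smooth_on UNIV \<sigma>" using \<sigma>(1,2) by (intro smooth_onI_deriv[of UNIV \<sigma> \<sigma>']) auto
  have du: "(u has_vector_derivative 2 * t * c) (at t)" for t
    unfolding u_def[abs_def] has_real_derivative_iff_has_vector_derivative[symmetric]
    by (auto intro!: derivative_eq_intros)
  have "((\<lambda>t. \<sigma> (u t)) has_vector_derivative 2 * t * c * \<sigma>' (u t)) (at t)" for t
    using vector_diff_chain_at[OF du \<sigma>(2)] by (simp add: o_def)
  moreover have "smooth_on UNIV (\<lambda>t. \<sigma> (u t))" by (rule smooth_on_compose[OF s\<sigma> su]) simp
  moreover have "\<sigma> (u t) = 0" if "\<bar>t\<bar> \<le> \<alpha>" for t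
  proof (rule \<sigma>(3))
    have "t\<^sup>2 \<le> \<alpha>\<^sup>2" using that assms(1) by (simp add: abs_le_square_iff[symmetric])
    then show "u t \<le> 0" using c by (simp add: u_def power2_eq_square mult_le_0_iff)
  qed
  moreover have "\<sigma> (u t) = 1" if "\<beta> \<le> \<bar>t\<bar>" for t
  proof (rule \<sigma>(4))
    have "\<beta>\<^sup>2 \<le> t\<^sup>2" using that assms by (simp add: abs_le_square_iff[symmetric])
    then show "1 \<le> u t" using ab by (simp add: u_def c_def power2_eq_square)
  qed
  moreover have "0 \<le> t * (2 * t * c * \<sigma>' (u t))" for t
  proof -
    have "0 \<le> (t * t) * (2 * c * \<sigma>' (u t))" using c \<sigma>(6)[of "u t"] by (intro mult_nonneg_nonneg[OF zero_le_square]) simp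
    moreover have "t * (2 * t * c * \<sigma>' (u t)) = (t * t) * (2 * c * \<sigma>' (u t))" by (simp only: mult_ac)
    ultimately show ?thesis by (simp only:)
  qed
  ultimately show ?thesis using \<sigma>(5)
    by (intro conjI allI impI exI[of _ "\<lambda>t. \<sigma> (u t)", OF exI[of _ "\<lambda>t. 2 * t * c * \<sigma>' (u t)"]]) simp_all
qed

text \<open>A time change that halts at the vertex: composing with it makes a curve with a corner at
  0 constant near 0, hence smooth, at the price of a vanishing velocity.\<close>

lemma flattening_ex:
  fixes \<delta> :: real
  assumes "0 < \<delta>"
  shows "\<exists>\<phi>. smooth_on UNIV \<phi> \<and> (\<forall>t. \<bar>t\<bar> \<le> \<delta> \<longrightarrow> \<phi> t = 0) \<and> (\<forall>t. 2 * \<delta> \<le> \<bar>t\<bar> \<longrightarrow> \<phi> t = t) \<and>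
    (\<forall>t. 0 \<le> vector_derivative \<phi> (at t)) \<and> (\<forall>t\<ge>0. 0 \<le> \<phi> t \<and> \<phi> t \<le> t) \<and> (\<forall>t\<le>0. t \<le> \<phi> t \<and> \<phi> t \<le> 0)"
proof -
  obtain \<rho> \<rho>' where \<rho>: "smooth_on UNIV \<rho>" "\<And>t. (\<rho> has_vector_derivative \<rho>' t) (at t)"
    "\<And>t. \<bar>t\<bar> \<le> \<delta> \<Longrightarrow> \<rho> t = 0" "\<And>t. 2 * \<delta> \<le> \<bar>t\<bar> \<Longrightarrow> \<rho> t = 1"
    "\<And>t. 0 \<le> \<rho> t \<and> \<rho> t \<le> 1" "\<And>t. 0 \<le> t * \<rho>' t"
    using cutoff_ex[of \<delta> "2 * \<delta>"] assms by auto
  have s: "smooth_on UNIV (\<lambda>t. t * \<rho> t)" by (intro smooth_intros \<rho>)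
  have "((\<lambda>t. t * \<rho> t) has_vector_derivative t * \<rho>' t + 1 * \<rho> t) (at t)" for t
    by (intro has_vector_derivative_mult has_vector_derivative_id \<rho>)
  from vector_derivative_at[OF this]
  have "0 \<le> vector_derivative (\<lambda>t. t * \<rho> t) (at t)" for t
    using \<rho>(5,6)[of t] by simp
  moreover have "0 \<le> t * \<rho> t \<and> t * \<rho> t \<le> t" if "0 \<le> t" for t
    using that \<rho>(5)[of t] by (simp add: mult_left_le)
  moreover have "t \<le> t * \<rho> t \<and> t * \<rho> t \<le> 0" if "t \<le> 0" for t
    using that \<rho>(5)[of t] mult_left_le[of "\<rho> t" "- t"] by (simp add: mult_nonpos_nonneg)
  ultimately show ?thesis using s \<rho>(3,4) by (intro exI[of _ "\<lambda>t. t * \<rho> t"]) auto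
qed

lemma plateau_ex:
  fixes \<alpha> \<beta> :: real
  assumes "0 < \<alpha>" "\<alpha> < \<beta>"
  shows "\<exists>\<psi>. smooth_on UNIV \<psi> \<and> (\<forall>t. \<bar>t\<bar> \<le> \<alpha> \<longrightarrow> \<psi> t = t) \<and> (\<forall>t. \<beta> \<le> \<bar>t\<bar> \<longrightarrow> \<psi> t = 0)"
proof -
  obtain \<rho> \<rho>' where \<rho>: "smooth_on UNIV \<rho> \<and> (\<forall>t. (\<rho> has_vector_derivative \<rho>' t) (at t)) \<and>
    (\<forall>t. \<bar>t\<bar> \<le> \<alpha> \<longrightarrow> \<rho> t = 0) \<and> (\<forall>t. \<beta> \<le> \<bar>t\<bar> \<longrightarrow> \<rho> t = 1) \<and>
    (\<forall>t. 0 \<le> \<rho> t \<and> \<rho> t \<le> 1) \<and> (\<forall>t. 0 \<le> t * \<rho>' t)"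
    using cutoff_ex[OF assms] by (elim exE)
  have "smooth_on UNIV (\<lambda>t. t * (1 - \<rho> t))" by (intro smooth_intros conjunct1[OF \<rho>])
  then show ?thesis using \<rho> by (intro exI[of _ "\<lambda>t. t * (1 - \<rho> t)"]) auto
qed

lemma legendrian_on_D:
  assumes "legendrian_on S c" "\<And>t. t \<in> S \<Longrightarrow> at t within S \<noteq> bot"
  shows "smooth_on S c" "continuous_on S c"
    and "t \<in> S \<Longrightarrow> (c has_vector_derivative vector_derivative c (at t within S)) (at t within S)"
    and "continuous_on S (\<lambda>t. vector_derivative c (at t within S))"
    and "t \<in> S \<Longrightarrow> vector_derivative c (at t within S) $ 3 = c t $ 2 * vector_derivative c (at t within S) $ 1"
    and "t \<in> S \<Longrightarrow> vector_derivative c (at t within S) \<noteq> 0"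
proof -
  show s: "smooth_on S c" using assms smooth_on_curve[OF assms(2)] by (auto simp: legendrian_on_def)
  then show "continuous_on S c" by (rule smooth_on_continuous)
  show "t \<in> S \<Longrightarrow> (c has_vector_derivative vector_derivative c (at t within S)) (at t within S)"
    by (rule smooth_on_has_vector_derivative[OF s _ assms(2)])
  show "continuous_on S (\<lambda>t. vector_derivative c (at t within S))"
    by (rule smooth_on_continuous[OF smooth_on_vector_derivative[OF s assms(2)]])
qed (use assms(1) in \<open>auto simp: legendrian_on_def contact_plane_def\<close>)

lemma Icc_nontrivial: "a < b \<Longrightarrow> t \<in> {a..b} \<Longrightarrow> at t within {a..b::real} \<noteq> bot"
  using trivial_limit_within[of t "{a..b}"] islimpt_Icc[of a b t] by auto

text \<open>The corner is first flattened by slowing down to a stop at the vertex (\<open>c \<circ> \<phi>\<close>); adding the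
  small perturbation \<open>\<eta> \<theta> w\<close> of the projection to the \<open>xy\<close>-plane makes the curve immersed again.
  A second hump of \<open>\<theta>\<close> away from the vertex corrects the enclosed area, so that the Legendrian
  lift closes up. Since \<open>\<theta> w\<close> has constant direction, the area is affine in \<open>\<eta>\<close>.\<close>

lemma corner_rounding:
  fixes c :: "real \<Rightarrow> real^3"
  assumes left: "legendrian_on {-1..0} c" and right: "legendrian_on {0..1} c"
    and d: "0 < d" "d < 1" and a3: "a $ 3 = 0"
    and posl: "\<And>t. t \<in> {-d..0} \<Longrightarrow> 0 < a \<bullet> vector_derivative c (at t within {-1..0})"
    and posr: "\<And>t. t \<in> {0..d} \<Longrightarrow> 0 < a \<bullet> vector_derivative c (at t within {0..1})"
    and ball: "\<And>t. t \<in> {-d<..<d} \<Longrightarrow> c t \<in> ball z r"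
  shows "\<exists>g \<rho>. 0 < \<rho> \<and> \<rho> < d \<and> smooth_on {-1<..<1} g \<and>
    (\<forall>t\<in>{-1<..<1}. vector_derivative g (at t) \<noteq> 0 \<and> vector_derivative g (at t) \<in> contact_plane (g t)) \<and>
    (\<forall>t. \<rho> \<le> \<bar>t\<bar> \<and> \<bar>t\<bar> < 1 \<longrightarrow> g t = c t) \<and>
    (\<forall>t. \<bar>t\<bar> < d \<longrightarrow> g t \<in> ball z r \<and> 0 < a \<bullet> vector_derivative g (at t))"
proof -
  define cl where "cl t = vector_derivative c (at t within {-1..0})" for t
  define cr where "cr t = vector_derivative c (at t within {0..1})" for t
  note L = legendrian_on_D[OF left Icc_nontrivial[of "-1" 0], folded cl_def, simplified]
  note R = legendrian_on_D[OF right Icc_nontrivial[of 0 1], folded cr_def, simplified]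
  define x y where "x = cr 0 $ 1" and "y = cr 0 $ 2"
  have inner3: "u \<bullet> v = u $ 1 * v $ 1 + u $ 2 * v $ 2 + u $ 3 * v $ 3" for u v :: "real^3"
    by (simp add: inner_vec_def sum_3)
  have acr: "0 < a $ 1 * x + a $ 2 * y"
    using posr[of 0] d a3 by (simp add: inner3 cr_def x_def y_def)
  \<comment> \<open>\<open>w\<close> is to be \<open>N\<close> times the horizontal right tangent
    \<open>(x, y)\<close> plus its rotation \<open>(- y, x)\<close>. A large \<open>N\<close> makes
    \<open>a \<bullet> w\<close> positive, and the rotated part makes \<open>w\<close> transverse to
    the right tangent.\<close>
  obtain N where N: "0 < N * (a $ 1 * x + a $ 2 * y) + (a $ 2 * x - a $ 1 * y)"
  proof
    show "0 < ((1 + \<bar>a $ 2 * x - a $ 1 * y\<bar>) / (a $ 1 * x + a $ 2 * y)) * (a $ 1 * x + a $ 2 * y)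
        + (a $ 2 * x - a $ 1 * y)" using acr by simp
  qed
  define w1 w2 where "w1 = N * x - y" and "w2 = N * y + x"
  define w :: "real^3" where "w = vector [w1, w2, 0]"
  have w: "w $ 1 = w1" "w $ 2 = w2" "w $ 3 = 0" by (simp_all add: w_def)
  have aw: "0 < a \<bullet> w" using N by (simp add: inner3 w w1_def w2_def algebra_simps)
  \<comment> \<open>\<open>K v\<close> is the determinant of the horizontal parts of
    \<open>v\<close> and \<open>w\<close>. It measures to first order how a perturbation along
    \<open>w\<close> changes the area integral of y dx, and it equals \<open>x * x + y * y\<close>
    at the right tangent for every \<open>N\<close>.\<close>
  define K where "K v = w2 * v $ 1 - w1 * v $ 2" for v :: "real^3"
  have xy: "0 < x * x + y * y" using acr by (auto simp: add_pos_nonneg sum_squares_gt_zero_iff)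
  have "K (cr 0) = x * x + y * y"
    by (simp add: K_def w1_def w2_def x_def y_def algebra_simps)
  then have K0: "0 < K (cr 0)" using xy by simp
  have "continuous_on {0..1} (\<lambda>t. K (cr t))" unfolding K_def by (intro continuous_intros R(4))
  then have "((\<lambda>t. K (cr t)) \<longlongrightarrow> K (cr 0)) (at 0 within {0..1})"
    by (simp add: continuous_on_def)
  from order_tendstoD(1)[OF this K0] obtain e where e: "0 < e"
    "\<And>t. t \<in> {0..1} \<Longrightarrow> t < e \<Longrightarrow> 0 < K (cr t)"
  proof -
    assume that: "\<And>e. 0 < e \<Longrightarrow> (\<And>t. t \<in> {0..1} \<Longrightarrow> t < e \<Longrightarrow> 0 < K (cr t)) \<Longrightarrow> thesis"
    assume "\<forall>\<^sub>F t in at 0 within {0..1}. 0 < K (cr t)"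
    then obtain e where e: "0 < e" "\<forall>t\<in>{0..1}. t \<noteq> 0 \<and> dist t 0 < e \<longrightarrow> 0 < K (cr t)"
      unfolding eventually_at by blast
    show thesis
    proof (rule that[OF e(1)])
      fix t :: real assume "t \<in> {0..1}" "t < e"
      then show "0 < K (cr t)" using e(2) K0 by (cases "t = 0") (auto simp: dist_real_def)
    qed
  qed
  \<comment> \<open>The scales used below: \<open>\<phi>\<close> is 0 up to \<open>\<delta>\<close>
    and the identity from \<open>2 * \<delta>\<close> on, \<open>\<psi>\<close> is the identity up
    to \<open>3 * \<delta>\<close>, and the correcting hump lives between
    \<open>3 * \<delta>\<close> and \<open>4 * \<delta>\<close>. The factor 5 leaves
    \<open>4 * \<delta>\<close> strictly below \<open>d\<close> and \<open>e\<close>.\<close>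
  define \<delta> where "\<delta> = min d e / 5"
  have \<delta>: "0 < \<delta>" "4 * \<delta> < d" "4 * \<delta> < e" using d e by (auto simp: \<delta>_def)
  then have \<delta>1: "4 * \<delta> < 1" using d by simp
  obtain \<phi> where \<phi>: "smooth_on UNIV \<phi>" "\<And>t. \<bar>t\<bar> \<le> \<delta> \<Longrightarrow> \<phi> t = 0" "\<And>t. 2 * \<delta> \<le> \<bar>t\<bar> \<Longrightarrow> \<phi> t = t"
    "\<And>t. 0 \<le> vector_derivative \<phi> (at t)" "\<And>t. 0 \<le> t \<Longrightarrow> 0 \<le> \<phi> t \<and> \<phi> t \<le> t" "\<And>t. t \<le> 0 \<Longrightarrow> t \<le> \<phi> t \<and> \<phi> t \<le> 0"
    using flattening_ex[OF \<delta>(1)] by metis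
  define \<phi>' where "\<phi>' t = vector_derivative \<phi> (at t)" for t
  have d\<phi>: "(\<phi> has_vector_derivative \<phi>' t) (at t)" for t
    unfolding \<phi>'_def by (rule smooth_on_UNIV_D[OF \<phi>(1)])
  have \<phi>'_pos: "0 \<le> \<phi>' t" for t using \<phi>(4) by (simp add: \<phi>'_def)
  have \<phi>'_0: "\<phi>' t = 0" if "\<bar>t\<bar> < \<delta>" for t
    unfolding \<phi>'_def
    by (rule vector_derivative_eqI_open(1)[of "\<lambda>t. 0" _ _ "{-\<delta><..<\<delta>}"]) (use that \<phi>(2) in auto)
  have \<phi>'_1: "\<phi>' t = 1" if "2 * \<delta> < \<bar>t\<bar>" for t
    unfolding \<phi>'_def
    by (rule vector_derivative_eqI_open(1)[of "\<lambda>t. t" _ _ "{..<- 2 * \<delta>} \<union> {2 * \<delta><..}"])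
      (use that \<phi>(3) in \<open>auto simp: abs_real_def split: if_splits\<close>)
  define J where "J = {-1<..<1::real}"
  have J: "open J" by (simp add: J_def)
  define p where "p t = c (\<phi> t)" for t
  \<comment> \<open>The tangent of \<open>c\<close> jumps at 0; the factor \<open>\<phi>'\<close>,
    which vanishes near 0, suppresses the jump in \<open>p'\<close>.\<close>
  define E where "E t = (if t < 0 then cl (\<phi> t) else cr (\<phi> t))" for t
  define p' where "p' t = \<phi>' t *\<^sub>R E t" for t
  have img: "\<phi> ` {-1<..<0} \<subseteq> {-1..0}" "\<phi> ` {0<..<1} \<subseteq> {0..1}"
  proof -
    have "\<phi> t \<in> {-1..0}" if "t \<in> {-1<..<0}" for t using \<phi>(6)[of t] that by auto
    then show "\<phi> ` {-1<..<0} \<subseteq> {-1..0}" by blast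
    have "\<phi> t \<in> {0..1}" if "t \<in> {0<..<1}" for t using \<phi>(5)[of t] that by auto
    then show "\<phi> ` {0<..<1} \<subseteq> {0..1}" by blast
  qed
  have sp: "smooth_on J p"
  proof (rule smooth_on_local[OF _ J])
    fix t assume t: "t \<in> J"
    consider "t < 0" | "0 < t" | "\<bar>t\<bar> < \<delta>" using \<delta> by linarith
    then show "\<exists>U. open U \<and> t \<in> U \<and> smooth_on U p"
    proof cases
      case 1
      have "smooth_on {-1<..<0} p" unfolding p_def
      proof (rule smooth_on_compose[OF L(1) smooth_on_subset[OF \<phi>(1)]])
        show "\<phi> ` {-1<..<0} \<subseteq> {-1..0}" by (rule img)
      qed simp
      then show ?thesis using 1 t by (intro exI[of _ "{-1<..<0}"]) (auto simp: J_def)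
    next
      case 2
      have "smooth_on {0<..<1} p" unfolding p_def
      proof (rule smooth_on_compose[OF R(1) smooth_on_subset[OF \<phi>(1)]])
        show "\<phi> ` {0<..<1} \<subseteq> {0..1}" by (rule img)
      qed simp
      then show ?thesis using 2 t by (intro exI[of _ "{0<..<1}"]) (auto simp: J_def)
    next
      case 3
      have "smooth_on {-\<delta><..<\<delta>} p"
      proof (rule smooth_on_cong[THEN iffD1, OF _ smooth_on_const[of _ "c 0"]])
        show "c 0 = p t" if "t \<in> {-\<delta><..<\<delta>}" for t
        proof -
          have "\<bar>t\<bar> \<le> \<delta>" using that by auto
          then show ?thesis using \<phi>(2) by (simp add: p_def)
        qed
      qed
      then show ?thesis using 3 by (intro exI[of _ "{-\<delta><..<\<delta>}"]) auto
    qed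
  qed
  have dp: "(p has_vector_derivative p' t) (at t)" if t: "t \<in> J" for t
  proof -
    consider "t < 0" | "0 < t" | "t = 0" using \<delta> by linarith
    then show ?thesis
    proof cases
      case 1
      have "(c has_vector_derivative cl (\<phi> t)) (at (\<phi> t) within {-1..0})"
        by (rule L(3)) (use 1 t \<phi>(6)[of t] in \<open>auto simp: J_def\<close>)
      then have "(c has_vector_derivative cl (\<phi> t)) (at (\<phi> t) within \<phi> ` {-1<..<0})"
        by (rule has_vector_derivative_within_subset[OF _ img(1)])
      from vector_diff_chain_within[OF has_vector_derivative_at_within[OF d\<phi>] this]
      have "(p has_vector_derivative p' t) (at t within {-1<..<0})"
        using 1 by (simp add: p_def[abs_def] o_def p'_def E_def)
      then show ?thesis using at_within_open[of t "{-1<..<0}"] 1 t by (simp add: J_def)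
    next
      case 2
      have "(c has_vector_derivative cr (\<phi> t)) (at (\<phi> t) within {0..1})"
        by (rule R(3)) (use 2 t \<phi>(5)[of t] in \<open>auto simp: J_def\<close>)
      then have "(c has_vector_derivative cr (\<phi> t)) (at (\<phi> t) within \<phi> ` {0<..<1})"
        by (rule has_vector_derivative_within_subset[OF _ img(2)])
      from vector_diff_chain_within[OF has_vector_derivative_at_within[OF d\<phi>] this]
      have "(p has_vector_derivative p' t) (at t within {0<..<1})"
        using 2 by (simp add: p_def[abs_def] o_def p'_def E_def)
      then show ?thesis using at_within_open[of t "{0<..<1}"] 2 t by (simp add: J_def)
    next
      case 3
      have "(p has_vector_derivative 0) (at t)"
        by (rule vector_derivative_eqI_open(2)[of "\<lambda>t. c 0" _ _ "{-\<delta><..<\<delta>}"])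
          (use 3 \<delta> \<phi>(2) in \<open>auto simp: p_def\<close>)
      then show ?thesis using \<phi>'_0[of t] 3 \<delta> by (simp add: p'_def)
    qed
  qed
  have sp': "smooth_on J p'"
  proof -
    have "smooth_on J (\<lambda>t. vector_derivative p (at t within J))"
      by (rule smooth_on_vector_derivative[OF sp]) (simp add: at_within_open[OF _ J])
    moreover have "vector_derivative p (at t within J) = p' t" if "t \<in> J" for t
      using vector_derivative_at[OF dp[OF that]] at_within_open[OF that J] by simp
    ultimately show ?thesis by (rule smooth_on_cong[THEN iffD1, rotated])
  qed
  have cp: "p' t $ 3 = p t $ 2 * p' t $ 1" if "t \<in> J" for t
    using that L(5)[of "\<phi> t"] R(5)[of "\<phi> t"] \<phi>(5,6)[of t]
    by (auto simp: p'_def E_def p_def J_def mult_ac)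
  \<comment> \<open>A uniform lower bound of the \<open>a\<close>-component of the tangents, against
    which the perturbation can be made small.\<close>
  obtain m where m: "0 < m" "\<And>t. \<bar>t\<bar> \<le> d \<Longrightarrow> m \<le> a \<bullet> E t"
  proof -
    have "continuous_on {-d..0} (\<lambda>t. a \<bullet> cl t)" "continuous_on {0..d} (\<lambda>t. a \<bullet> cr t)"
      using d by (intro continuous_intros continuous_on_subset[OF L(4)] continuous_on_subset[OF R(4)]; auto)+
    then obtain tl tr where t: "tl \<in> {-d..0}" "\<forall>t\<in>{-d..0}. a \<bullet> cl tl \<le> a \<bullet> cl t"
      "tr \<in> {0..d}" "\<forall>t\<in>{0..d}. a \<bullet> cr tr \<le> a \<bullet> cr t"
      using continuous_attains_inf[of "{-d..0}" "\<lambda>t. a \<bullet> cl t"]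
        continuous_attains_inf[of "{0..d}" "\<lambda>t. a \<bullet> cr t"] d by auto
    show ?thesis
    proof (rule that[of "min (a \<bullet> cl tl) (a \<bullet> cr tr)"])
      show "0 < min (a \<bullet> cl tl) (a \<bullet> cr tr)"
        using posl[OF t(1)] posr[OF t(3)] by (simp add: cl_def cr_def)
      fix t assume "\<bar>t\<bar> \<le> d"
      then have "t < 0 \<Longrightarrow> \<phi> t \<in> {-d..0}" "\<not> t < 0 \<Longrightarrow> \<phi> t \<in> {0..d}"
        using \<phi>(5,6)[of t] by auto
      then show "min (a \<bullet> cl tl) (a \<bullet> cr tr) \<le> a \<bullet> E t"
        using t(2,4) by (auto simp: E_def min_le_iff_disj)
    qed
  qed
  obtain \<psi> where \<psi>: "smooth_on UNIV \<psi>" "\<And>t. \<bar>t\<bar> \<le> 3 * \<delta> \<Longrightarrow> \<psi> t = t" "\<And>t. 4 * \<delta> \<le> \<bar>t\<bar> \<Longrightarrow> \<psi> t = 0"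
    using plateau_ex[of "3 * \<delta>" "4 * \<delta>"] \<delta>(1) by auto
  \<comment> \<open>The hump sits where \<open>\<phi>\<close> is already the identity and
    \<open>K\<close> is still positive, so it changes the area by a nonzero amount, as
    \<open>FB\<close> records.\<close>
  define \<beta> where "\<beta> t = bump ((t - 3 * \<delta>) * (1 / \<delta>))" for t
  have s\<beta>: "smooth_on UNIV \<beta>"
    unfolding \<beta>_def by (intro smooth_on_compose[OF smooth_on_bump[of UNIV]] smooth_intros) simp
  have \<beta>0: "\<beta> t = 0" if "t \<le> 3 * \<delta> \<or> 4 * \<delta> \<le> t" for t
    unfolding \<beta>_def using that \<delta>(1) by (intro bump_zero) (auto simp: field_simps)
  have \<beta>pos: "0 < \<beta> t" if "3 * \<delta> < t" "t < 4 * \<delta>" for t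
    unfolding \<beta>_def using that \<delta>(1) by (intro bump_pos) (auto simp: field_simps)
  have sK: "smooth_on J (\<lambda>t. K (p' t))" unfolding K_def by (intro smooth_intros sp')
  have s\<psi>J: "smooth_on J \<psi>" "smooth_on J \<beta>" using smooth_on_subset[OF \<psi>(1)] smooth_on_subset[OF s\<beta>] by auto
  obtain F\<psi> F\<beta> where F: "\<And>t. t \<in> J \<Longrightarrow> (F\<psi> has_vector_derivative \<psi> t * K (p' t)) (at t)"
    "\<And>t. t \<in> J \<Longrightarrow> (F\<beta> has_vector_derivative \<beta> t * K (p' t)) (at t)"
    using antiderivative_ex[of "-1" 1 "\<lambda>t. \<psi> t * K (p' t)"] antiderivative_ex[of "-1" 1 "\<lambda>t. \<beta> t * K (p' t)"]
      smooth_on_continuous[OF smooth_on_mult[OF s\<psi>J(1) sK]] smooth_on_continuous[OF smooth_on_mult[OF s\<psi>J(2) sK]]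
    unfolding J_def by blast
  have sub: "{-(4 * \<delta>)..4 * \<delta>} \<subseteq> J" using \<delta>1 by (auto simp: J_def)
  have FB: "F\<beta> (-(4 * \<delta>)) < F\<beta> (4 * \<delta>)"
  proof -
    have *: "0 < K (p' t)" if "3 * \<delta> < t" "t < 4 * \<delta>" for t
      using that e(2)[of t] \<delta> \<delta>1 \<phi>'_1[of t] \<phi>(3)[of t] by (simp add: p'_def E_def)
    have nn: "0 \<le> \<beta> t * K (p' t)" if "t \<in> J" for t
      using *[of t] \<beta>pos[of t] \<beta>0[of t] by (cases "3 * \<delta> < t \<and> t < 4 * \<delta>") auto
    have "F\<beta> (-(4 * \<delta>)) \<le> F\<beta> (3 * \<delta>)"
    proof (rule DERIV_nonneg_imp_nondecreasing[where f = F\<beta>])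
      fix t assume "-(4 * \<delta>) \<le> t" "t \<le> 3 * \<delta>"
      then have "t \<in> J" using \<delta>1 \<delta>(1) by (auto simp: J_def)
      then show "\<exists>y. DERIV F\<beta> t :> y \<and> 0 \<le> y"
        using F(2) nn has_real_derivative_iff_has_vector_derivative by blast
    qed (use \<delta> in auto)
    also have "F\<beta> (3 * \<delta>) < F\<beta> (4 * \<delta>)"
    proof (rule DERIV_pos_imp_increasing_open[where f = F\<beta>])
      fix t assume t: "3 * \<delta> < t" "t < 4 * \<delta>"
      then have "t \<in> J" using \<delta>1 \<delta>(1) by (auto simp: J_def)
      then show "\<exists>y. DERIV F\<beta> t :> y \<and> 0 < y"
        using F(2) *[OF t] \<beta>pos[OF t] has_real_derivative_iff_has_vector_derivative mult_pos_pos by blast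
    next
      show "continuous_on {3 * \<delta>..4 * \<delta>} F\<beta>"
        using has_vector_derivative_continuous[OF F(2)] sub \<delta>(1)
        by (intro continuous_at_imp_continuous_on) (auto simp: subset_iff)
    qed (use \<delta> in auto)
    finally show ?thesis .
  qed
  \<comment> \<open>This weight makes the integral of \<open>\<theta> t * K (p' t)\<close> over the
    perturbed interval vanish, so that \<open>Q\<close> below is 0 at both ends.\<close>
  define \<kappa> where "\<kappa> = - (F\<psi> (4 * \<delta>) - F\<psi> (-(4 * \<delta>))) / (F\<beta> (4 * \<delta>) - F\<beta> (-(4 * \<delta>)))"
  define \<theta> where "\<theta> t = \<psi> t + \<kappa> * \<beta> t" for t
  have s\<theta>: "smooth_on UNIV \<theta>" unfolding \<theta>_def by (intro smooth_intros \<psi> s\<beta>)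
  define \<theta>' where "\<theta>' t = vector_derivative \<theta> (at t)" for t
  have d\<theta>: "(\<theta> has_vector_derivative \<theta>' t) (at t)" and s\<theta>': "smooth_on UNIV \<theta>'" for t
    unfolding \<theta>'_def by (rule smooth_on_UNIV_D[OF s\<theta>])+
  have \<theta>0: "\<theta> t = 0" if "4 * \<delta> \<le> \<bar>t\<bar>" for t
    using that \<psi>(3)[OF that] \<beta>0[of t] \<delta> by (auto simp: \<theta>_def abs_real_def split: if_splits)
  have \<theta>'_1: "\<theta>' t = 1" if "\<bar>t\<bar> < 3 * \<delta>" for t
    unfolding \<theta>'_def
    by (rule vector_derivative_eqI_open(1)[of "\<lambda>t. t" _ _ "{-(3 * \<delta>)<..<3 * \<delta>}"])
      (use that \<psi>(2) \<beta>0 in \<open>auto simp: \<theta>_def\<close>)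
  have \<theta>'_0: "\<theta>' t = 0" if "4 * \<delta> < \<bar>t\<bar>" for t
    unfolding \<theta>'_def
    by (rule vector_derivative_eqI_open(1)[of "\<lambda>t. 0" _ _ "{..<-(4 * \<delta>)} \<union> {4 * \<delta><..}"])
      (use that \<theta>0 \<delta>(1) in auto)
  define Q where "Q t = (F\<psi> t + \<kappa> * F\<beta> t) - (F\<psi> (-(4 * \<delta>)) + \<kappa> * F\<beta> (-(4 * \<delta>)))" for t
  have dQ: "(Q has_vector_derivative \<theta> t * K (p' t)) (at t)" if "t \<in> J" for t
  proof -
    have "(Q has_real_derivative \<psi> t * K (p' t) + \<kappa> * (\<beta> t * K (p' t))) (at t)"
      unfolding Q_def using F[OF that, folded has_real_derivative_iff_has_vector_derivative]
      by (auto intro!: derivative_eq_intros)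
    then show ?thesis by (simp add: \<theta>_def algebra_simps has_real_derivative_iff_has_vector_derivative)
  qed
  have Qe: "Q (-(4 * \<delta>)) = 0" "Q (4 * \<delta>) = 0"
    using FB by (auto simp: Q_def \<kappa>_def field_simps)
  have Q0: "Q t = 0" if t: "t \<in> J" "4 * \<delta> \<le> \<bar>t\<bar>" for t
  proof -
    have z: "(Q has_real_derivative 0) (at s within S)" if "s \<in> J" "4 * \<delta> \<le> \<bar>s\<bar>" for s S
      using has_vector_derivative_at_within[OF dQ[OF that(1)]] \<theta>0[OF that(2)]
      by (simp add: has_real_derivative_iff_has_vector_derivative)
    show ?thesis
    proof (cases "0 \<le> t")
      case True
      have "(Q has_real_derivative 0) (at s within {4 * \<delta>..t})" if "s \<in> {4 * \<delta>..t}" for s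
        by (rule z) (use True t that \<delta>(1) in \<open>auto simp: J_def\<close>)
      then obtain C where "\<And>s. s \<in> {4 * \<delta>..t} \<Longrightarrow> Q s = C"
        using has_field_derivative_zero_constant[OF convex_real_interval(5)] by metis
      from this[of t] this[of "4 * \<delta>"] show ?thesis using Qe(2) True t(2) by auto
    next
      case False
      have "(Q has_real_derivative 0) (at s within {t..-(4 * \<delta>)})" if "s \<in> {t..-(4 * \<delta>)}" for s
        by (rule z) (use False t that \<delta>(1) in \<open>auto simp: J_def\<close>)
      then obtain C where "\<And>s. s \<in> {t..-(4 * \<delta>)} \<Longrightarrow> Q s = C"
        using has_field_derivative_zero_constant[OF convex_real_interval(5)] by metis
      from this[of t] this[of "-(4 * \<delta>)"] show ?thesis using Qe(1) False t(2) by auto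
    qed
  qed
  have sQ: "smooth_on J Q"
    by (rule smooth_onI_deriv[OF has_vector_derivative_at_within[OF dQ]])
      (auto intro!: smooth_intros sK smooth_on_subset[OF s\<theta>])
  define e3 :: "real^3" where "e3 = axis 3 1"
  have e3: "e3 $ 1 = 0" "e3 $ 2 = 0" "e3 $ 3 = 1" by (auto simp: e3_def axis_def)
  define G1 where "G1 t = \<theta> t *\<^sub>R w + (w1 * (\<theta> t * p t $ 2) + Q t) *\<^sub>R e3" for t
  define G2 where "G2 t = (w1 * w2 * (\<theta> t * \<theta> t) * (1 / 2)) *\<^sub>R e3" for t
  have sG: "smooth_on J G1" "smooth_on J G2"
    unfolding G1_def G2_def by (intro smooth_intros smooth_on_subset[OF s\<theta>] sp sQ; simp)+
  have G0: "G1 t = 0" "G2 t = 0" if "t \<in> J" "4 * \<delta> \<le> \<bar>t\<bar>" for t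
    using that \<theta>0[OF that(2)] Q0[OF that] by (auto simp: G1_def G2_def)
  have cpt: "compact {-(4 * \<delta>)..4 * \<delta>}" by simp
  obtain K1 K2 where KK: "0 < K1" "0 < K2" "\<And>t. \<bar>t\<bar> \<le> 4 * \<delta> \<Longrightarrow> norm (G1 t) \<le> K1"
    "\<And>t. \<bar>t\<bar> \<le> 4 * \<delta> \<Longrightarrow> norm (G2 t) \<le> K2"
  proof -
    have "bounded (G1 ` {-(4 * \<delta>)..4 * \<delta>})" "bounded (G2 ` {-(4 * \<delta>)..4 * \<delta>})"
      using continuous_on_subset[OF smooth_on_continuous[OF sG(1)] sub]
        continuous_on_subset[OF smooth_on_continuous[OF sG(2)] sub]
      by (auto intro!: compact_imp_bounded compact_continuous_image)
    then obtain K1 K2 where "0 < K1" "0 < K2" "\<forall>v\<in>G1 ` {-(4 * \<delta>)..4 * \<delta>}. norm v \<le> K1"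
      "\<forall>v\<in>G2 ` {-(4 * \<delta>)..4 * \<delta>}. norm v \<le> K2"
      unfolding bounded_pos by metis
    then show ?thesis by (intro that[of K1 K2]) (auto simp: abs_le_iff)
  qed
  obtain M where M: "0 < M" "\<And>t. \<bar>\<theta>' t\<bar> \<le> M"
  proof -
    have "bounded (\<theta>' ` {-(4 * \<delta>)..4 * \<delta>})"
      using continuous_on_subset[OF smooth_on_continuous[OF s\<theta>']]
      by (auto intro!: compact_imp_bounded compact_continuous_image)
    then obtain M where "0 < M" "\<forall>v\<in>\<theta>' ` {-(4 * \<delta>)..4 * \<delta>}. norm v \<le> M"
      unfolding bounded_pos by metis
    then have "\<bar>\<theta>' t\<bar> \<le> M" for t
      using \<theta>'_0[of t] by (cases "\<bar>t\<bar> \<le> 4 * \<delta>") (auto simp: abs_le_iff)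
    then show ?thesis using that \<open>0 < M\<close> by blast
  qed
  obtain \<epsilon> where \<epsilon>: "0 < \<epsilon>" "\<And>t. \<bar>t\<bar> \<le> 4 * \<delta> \<Longrightarrow> dist z (p t) \<le> r - \<epsilon>"
  proof -
    have "continuous_on {-(4 * \<delta>)..4 * \<delta>} (\<lambda>t. dist z (p t))"
      by (intro continuous_intros continuous_on_subset[OF smooth_on_continuous[OF sp] sub])
    then obtain s where s: "s \<in> {-(4 * \<delta>)..4 * \<delta>}" "\<forall>t\<in>{-(4 * \<delta>)..4 * \<delta>}. dist z (p t) \<le> dist z (p s)"
      using continuous_attains_sup[of "{-(4 * \<delta>)..4 * \<delta>}" "\<lambda>t. dist z (p t)"] \<delta> by auto
    have "\<phi> s \<in> {-d<..<d}" using s(1) \<phi>(5,6)[of s] \<delta>(2) by (cases "0 \<le> s") auto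
    from ball[OF this] have "dist z (p s) < r" by (simp add: p_def)
    moreover have "dist z (p t) \<le> dist z (p s)" if "\<bar>t\<bar> \<le> 4 * \<delta>" for t
      using s(2) that by (auto simp: abs_le_iff)
    ultimately show ?thesis using that[of "r - dist z (p s)"] by auto
  qed
  \<comment> \<open>The bounds serve in turn to get \<open>\<eta> * \<eta> \<le> \<eta>\<close>, to
    stay in the ball, and to keep the \<open>a\<close>-component of the tangent positive.\<close>
  define \<eta> where "\<eta> = min (min 1 (\<epsilon> / (2 * (K1 + K2)))) (m / (2 * M * (a \<bullet> w)))"
  have \<eta>: "0 < \<eta>" "\<eta> \<le> 1" "\<eta> \<le> \<epsilon> / (2 * (K1 + K2))" "\<eta> \<le> m / (2 * M * (a \<bullet> w))"
    using \<epsilon>(1) KK(1,2) m(1) M(1) aw by (auto simp: \<eta>_def)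
  have \<eta>K: "\<eta> * (K1 + K2) < \<epsilon>" using \<eta>(3) KK(1,2) \<epsilon>(1) by (simp add: field_simps)
  have \<eta>M: "\<eta> * M * (a \<bullet> w) < m"
  proof -
    have "\<eta> * (2 * M * (a \<bullet> w)) \<le> m" using \<eta>(4) M(1) aw by (simp add: pos_le_divide_eq)
    moreover have "0 < \<eta> * M * (a \<bullet> w)" using \<eta>(1) M(1) aw by simp
    ultimately show ?thesis by (simp add: mult_ac)
  qed
  define g where "g t = p t + \<eta> *\<^sub>R G1 t + (\<eta> * \<eta>) *\<^sub>R G2 t" for t
  define g' where "g' t = p' t + \<eta> *\<^sub>R (\<theta>' t *\<^sub>R w +
      (w1 * (\<theta> t * p' t $ 2 + \<theta>' t * p t $ 2) + \<theta> t * K (p' t)) *\<^sub>R e3) +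
      (\<eta> * \<eta>) *\<^sub>R ((w1 * w2 * (\<theta> t * \<theta>' t)) *\<^sub>R e3)" for t
  have sg: "smooth_on J g" unfolding g_def by (intro smooth_intros sp sG)
  have dg: "(g has_vector_derivative g' t) (at t)" if t: "t \<in> J" for t
  proof -
    have p2: "((\<lambda>t. p t $ 2) has_real_derivative p' t $ 2) (at t)"
      using bounded_linear.has_vector_derivative[OF bounded_linear_vec_nth dp[OF t]]
      by (simp add: has_real_derivative_iff_has_vector_derivative)
    note d = d\<theta>[of t, folded has_real_derivative_iff_has_vector_derivative]
      dQ[OF t, folded has_real_derivative_iff_has_vector_derivative]
    have 1: "((\<lambda>t. w1 * (\<theta> t * p t $ 2) + Q t) has_real_derivative
        (w1 * (\<theta> t * p' t $ 2 + \<theta>' t * p t $ 2) + \<theta> t * K (p' t))) (at t)"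
      by (auto intro!: derivative_eq_intros d p2)
    have 2: "((\<lambda>t. w1 * w2 * (\<theta> t * \<theta> t) * (1 / 2)) has_real_derivative w1 * w2 * (\<theta> t * \<theta>' t)) (at t)"
      by (auto intro!: derivative_eq_intros d)
    have s: "((\<lambda>t. f t *\<^sub>R v) has_vector_derivative f' *\<^sub>R v) (at t)"
      if "(f has_real_derivative f') (at t)" for f f' and v :: "real^3"
      using has_vector_derivative_scaleR[OF that has_vector_derivative_const[of v]] by simp
    show ?thesis
      unfolding g_def g'_def G1_def G2_def
      by (intro has_vector_derivative_add dp[OF t] s 1 2 d
          bounded_linear.has_vector_derivative[OF bounded_linear_scaleR_right])
  qed
  have g'c: "g' t \<in> contact_plane (g t)" if "t \<in> J" for t
    using cp[OF that]
    by (simp add: contact_plane_def g'_def g_def G1_def G2_def e3 w K_def algebra_simps)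
  have ag': "a \<bullet> g' t = \<phi>' t * (a \<bullet> E t) + \<eta> * \<theta>' t * (a \<bullet> w)" for t
    using a3 by (simp add: g'_def p'_def inner3 e3 w algebra_simps)
  \<comment> \<open>Up to \<open>3 * \<delta>\<close> the slope of \<open>\<theta>\<close> is 1, so
    the perturbation itself gives positivity even where the flattened curve stands still. Beyond,
    \<open>\<phi>'\<close> is 1 and the bound \<open>m\<close> outweighs the perturbation.\<close>
  have ag'_pos: "0 < a \<bullet> g' t" if "\<bar>t\<bar> < d" for t
  proof (cases "\<bar>t\<bar> < 3 * \<delta>")
    case True
    have "0 \<le> \<phi>' t * (a \<bullet> E t)"
      using \<phi>'_pos m(1) m(2)[of t] that by (intro mult_nonneg_nonneg) auto
    then show ?thesis using \<theta>'_1[OF True] ag' \<eta>(1) aw by (simp add: add_nonneg_pos)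
  next
    case False
    have "- (\<eta> * M * (a \<bullet> w)) \<le> \<eta> * \<theta>' t * (a \<bullet> w)"
      using M(2)[of t] \<eta>(1) aw mult_right_mono[of "- M" "\<theta>' t" "\<eta> * (a \<bullet> w)"] by (auto simp: mult_ac)
    then show ?thesis using False \<phi>'_1[of t] m(2)[of t] that \<eta>M \<delta>(1) by (simp add: ag')
  qed
  have gc: "g t = c t" if "4 * \<delta> \<le> \<bar>t\<bar>" "\<bar>t\<bar> < 1" for t
    using G0[of t] that \<phi>(3)[of t] \<delta>(1) by (auto simp: g_def p_def J_def abs_less_iff)
  have gball: "g t \<in> ball z r" if "\<bar>t\<bar> < d" for t
  proof (cases "4 * \<delta> \<le> \<bar>t\<bar>")
    case True
    then show ?thesis using gc[OF True] that d ball[of t] by (auto simp: abs_less_iff)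
  next
    case False
    then have t: "\<bar>t\<bar> \<le> 4 * \<delta>" by simp
    have "norm (g t - p t) \<le> \<eta> * norm (G1 t) + \<eta> * \<eta> * norm (G2 t)"
      unfolding g_def using norm_triangle_ineq[of "\<eta> *\<^sub>R G1 t" "(\<eta> * \<eta>) *\<^sub>R G2 t"] \<eta>(1) by (simp add: add.assoc)
    also have "\<dots> \<le> \<eta> * K1 + \<eta> * K2"
      using \<eta>(1,2) KK(3,4)[OF t] KK(2)
      by (intro add_mono mult_mono) (auto simp: mult_left_le)
    also have "\<dots> < \<epsilon>" using \<eta>K by (simp add: distrib_left)
    finally show ?thesis
      using \<epsilon>(2)[OF t] dist_triangle[of z "g t" "p t"] by (simp add: dist_norm norm_minus_commute)
  qed
  have g'nz: "g' t \<noteq> 0" if t: "t \<in> J" for t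
  proof (cases "\<bar>t\<bar> < d")
    case True
    then show ?thesis using ag'_pos[OF True] by auto
  next
    case False
    then have b: "4 * \<delta> < \<bar>t\<bar>" using \<delta> by simp
    have "(\<phi> t) = t" "\<phi>' t = 1" using \<phi>(3)[of t] \<phi>'_1[of t] b \<delta>(1) by auto
    then have "E t \<noteq> 0" using L(6)[of t] R(6)[of t] t by (auto simp: E_def J_def)
    then show ?thesis using \<theta>'_0[OF b] \<theta>0[of t] \<open>\<phi>' t = 1\<close> b by (simp add: g'_def p'_def)
  qed
  have vdg: "vector_derivative g (at t) = g' t" if "t \<in> J" for t
    by (rule vector_derivative_at[OF dg[OF that]])
  have "\<forall>t\<in>{-1<..<1}. vector_derivative g (at t) \<noteq> 0 \<and> vector_derivative g (at t) \<in> contact_plane (g t)"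
    using g'c g'nz vdg by (simp add: J_def)
  moreover have "0 < a \<bullet> vector_derivative g (at t)" if "\<bar>t\<bar> < d" for t
  proof -
    have "t \<in> J" using that d(2) by (auto simp: J_def)
    then show ?thesis using ag'_pos[OF that] vdg by simp
  qed
  moreover have "smooth_on {-1<..<1} g" using sg by (simp add: J_def)
  moreover have "0 < 4 * \<delta>" using \<delta>(1) by simp
  ultimately show ?thesis using \<delta>(2) gc gball by blast
qed

subsection \<open>Closed piecewise Legendrian curves\<close>

lemma inner_real3: "u \<bullet> v = u $ 1 * v $ 1 + u $ 2 * v $ 2 + u $ 3 * v $ 3" for u v :: "real^3"
  by (simp add: inner_vec_def sum_3)

text \<open>The direction \<open>a\<close> bisects the horizontal projections of \<open>L\<close>
  and \<open>R\<close>. It fails only if these are opposite, the equality case of Cauchy-Schwarz;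
  since the projection is injective on a contact plane, \<open>L\<close> and \<open>R\<close> would
  then be opposite too.\<close>

lemma contact_half_plane:
  assumes "L \<in> contact_plane p" "R \<in> contact_plane p" "L \<noteq> 0" "R \<noteq> 0" "sgn L \<noteq> - sgn R"
  shows "\<exists>a. a $ 3 = 0 \<and> 0 < a \<bullet> L \<and> 0 < a \<bullet> R"
proof -
  define hor :: "real^3 \<Rightarrow> real^3" where "hor v = vector [v $ 1, v $ 2, 0]" for v
  have hor: "hor v $ 1 = v $ 1" "hor v $ 2 = v $ 2" "hor v $ 3 = 0" for v by (simp_all add: hor_def)
  have lift: "v = w" if "v \<in> contact_plane p" "w \<in> contact_plane p" "hor v = hor w" for v w
  proof -
    have "v $ 1 = w $ 1" "v $ 2 = w $ 2" using that(3) hor by metis+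
    moreover have "v $ 3 = w $ 3" using that(1,2) calculation by (simp add: contact_plane_def)
    ultimately show ?thesis by (simp add: vec_eq_iff forall_3)
  qed
  have z: "0 \<in> contact_plane p" and sc: "\<And>s v. v \<in> contact_plane p \<Longrightarrow> s *\<^sub>R v \<in> contact_plane p"
    by (auto simp: contact_plane_def algebra_simps)
  have hsc: "hor (s *\<^sub>R v) = s *\<^sub>R hor v" for s v by (simp add: vec_eq_iff forall_3 hor)
  have nz: "hor L \<noteq> 0" "hor R \<noteq> 0"
    using lift[OF assms(1) z] lift[OF assms(2) z] assms(3,4) hsc[of 0 0] by auto
  define a where "a = norm (hor R) *\<^sub>R hor L + norm (hor L) *\<^sub>R hor R"
  have "- (hor L \<bullet> hor R) \<noteq> norm (hor L) * norm (hor R)"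
  proof
    assume "- (hor L \<bullet> hor R) = norm (hor L) * norm (hor R)"
    then have "hor L \<bullet> (- hor R) = norm (hor L) * norm (- hor R)" by simp
    then have e: "norm (hor L) *\<^sub>R (- hor R) = norm (hor R) *\<^sub>R hor L"
      by (subst (asm) norm_cauchy_schwarz_eq) simp
    define s where "s = norm (hor L) / norm (hor R)"
    have s: "0 < s" using nz by (simp add: s_def)
    have "hor L = (1 / norm (hor R)) *\<^sub>R (norm (hor R) *\<^sub>R hor L)" using nz by simp
    also have "\<dots> = (- s) *\<^sub>R hor R" unfolding e[symmetric] by (simp add: s_def)
    finally have "hor L = hor ((- s) *\<^sub>R R)" by (simp only: hsc)
    then have "L = (- s) *\<^sub>R R" by (rule lift[OF assms(1) sc[OF assms(2)]])
    then have "sgn L = - sgn R" using s by (simp add: sgn_scaleR Real_Vector_Spaces.sgn_minus)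
    then show False using assms(5) by simp
  qed
  moreover have "- (hor L \<bullet> hor R) \<le> norm (hor L) * norm (hor R)"
    using Cauchy_Schwarz_ineq2[of "hor L" "hor R"] by linarith
  ultimately have pos: "0 < norm (hor L) * norm (hor R) + hor L \<bullet> hor R" by linarith
  have "a \<bullet> v = a \<bullet> hor v" for v by (simp add: inner_real3 hor a_def)
  moreover have "a \<bullet> hor L = norm (hor L) * (norm (hor L) * norm (hor R) + hor L \<bullet> hor R)"
    "a \<bullet> hor R = norm (hor R) * (norm (hor L) * norm (hor R) + hor L \<bullet> hor R)"
  proof -
    have nn: "v \<bullet> v = norm v * norm v" for v :: "real^3"
      by (simp add: power2_norm_eq_inner[symmetric] power2_eq_square)
    show "a \<bullet> hor L = norm (hor L) * (norm (hor L) * norm (hor R) + hor L \<bullet> hor R)"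
      "a \<bullet> hor R = norm (hor R) * (norm (hor L) * norm (hor R) + hor L \<bullet> hor R)"
      unfolding a_def inner_add_left inner_scaleR_left nn inner_commute[of "hor R" "hor L"]
      by (simp_all add: algebra_simps)
  qed
  ultimately show ?thesis
    using pos nz by (intro exI[of _ a]) (simp add: a_def hor)
qed

text \<open>Near 0 all tangents have positive inner products with each other, so every chord from
  \<open>c 0\<close> has a positive inner product with the tangent at its end. This is why a small
  ball around a corner meets each of the two edges there in one arc.\<close>

lemma radial_strict_mono:
  fixes c c' :: "real \<Rightarrow> 'a::real_inner"
  assumes d: "\<And>t. t \<in> {0..1} \<Longrightarrow> (c has_vector_derivative c' t) (at t within {0..1})"
    and c': "continuous_on {0..1} c'" "c' 0 \<noteq> 0"
  shows "\<exists>d>0. \<forall>e\<in>{0<..d}. e \<le> 1 \<and> strict_mono_on {0..e} (\<lambda>t. dist (c 0) (c t))"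
proof -
  have n: "0 < norm (c' 0) / 3" using c'(2) by simp
  obtain d0 where d0: "0 < d0" "\<And>t. t \<in> {0..1} \<Longrightarrow> t < d0 \<Longrightarrow> norm (c' t - c' 0) < norm (c' 0) / 3"
  proof -
    have "\<exists>d>0. \<forall>t\<in>{0..1}. dist t 0 < d \<longrightarrow> dist (c' t) (c' 0) < norm (c' 0) / 3"
      using bspec[OF c'(1)[unfolded continuous_on_iff], of 0] n by (simp only: atLeastAtMost_iff order_refl zero_le_one simp_thms)
    then obtain d where "d > 0" and d: "\<And>t. t \<in> {0..1} \<Longrightarrow> dist t 0 < d \<Longrightarrow> dist (c' t) (c' 0) < norm (c' 0) / 3"
      by blast
    show ?thesis
    proof (rule that[OF \<open>d > 0\<close>])
      show "norm (c' t - c' 0) < norm (c' 0) / 3" if "t \<in> {0..1}" "t < d" for t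
        using d[of t] that by (simp add: dist_norm)
    qed
  qed
  define e0 where "e0 = min 1 (d0 / 2)"
  have e0: "0 < e0" "e0 \<le> 1" "e0 < d0" using d0(1) by (auto simp: e0_def)
  \<comment> \<open>The tolerance of one third suffices because 1/3 + 1/3 + 1/9 is less than
    1.\<close>
  have pos: "0 < c' s \<bullet> c' t" if "s \<in> {0..e0}" "t \<in> {0..e0}" for s t
  proof -
    define N where "N = norm (c' 0)"
    define u v where "u = c' s - c' 0" and "v = c' t - c' 0"
    have uv: "norm u < N / 3" "norm v < N / 3" "0 < N"
      using d0(2)[of s] d0(2)[of t] that e0 n by (auto simp: u_def v_def N_def)
    have "c' s \<bullet> c' t = N * N + c' 0 \<bullet> v + u \<bullet> c' 0 + u \<bullet> v"
      by (simp add: u_def v_def N_def inner_diff_left inner_diff_right power2_norm_eq_inner[symmetric]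
          power2_eq_square[symmetric])
    moreover have "\<bar>c' 0 \<bullet> v\<bar> \<le> N * (N / 3)" "\<bar>u \<bullet> c' 0\<bar> \<le> (N / 3) * N" "\<bar>u \<bullet> v\<bar> \<le> (N / 3) * (N / 3)"
      using uv by (intro order_trans[OF Cauchy_Schwarz_ineq2] mult_mono; simp add: N_def)+
    moreover have "N * (N / 3) + (N / 3) * N + (N / 3) * (N / 3) < N * N"
      using uv(3) by (simp add: field_simps)
    ultimately show ?thesis by linarith
  qed
  have dw: "(c has_vector_derivative c' t) (at t within {0..e})" if "t \<in> {0..e}" "e \<le> e0" for t e
    by (rule has_vector_derivative_within_subset[OF d]) (use that e0 in auto)
  have chord: "0 < (c t - c 0) \<bullet> c' s" if ts: "0 < t" "t \<le> e0" "s \<in> {0..e0}" for s t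
  proof -
    have "((\<lambda>x. c x \<bullet> c' s) has_derivative (\<lambda>h. h * (c' x \<bullet> c' s))) (at x within {0..t})"
      if "x \<in> {0..t}" for x
      using bounded_linear.has_vector_derivative[OF bounded_linear_inner_left dw[OF that ts(2)], of "c' s"]
      by (simp add: has_vector_derivative_def)
    then obtain x where x: "x \<in> {0<..<t}" "c t \<bullet> c' s - c 0 \<bullet> c' s = (t - 0) * (c' x \<bullet> c' s)"
      using mvt_simple[OF ts(1), of "\<lambda>x. c x \<bullet> c' s" "\<lambda>x h. h * (c' x \<bullet> c' s)"] by auto
    moreover have "0 < c' x \<bullet> c' s" using pos[of x s] x(1) ts by auto
    ultimately show ?thesis using ts(1) by (simp add: inner_diff_left)
  qed
  have "strict_mono_on {0..e} (\<lambda>t. dist (c 0) (c t))" if "0 < e" "e \<le> e0" for e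
  proof (rule strict_mono_onI)
    fix x y assume xy: "x \<in> {0..e}" "y \<in> {0..e}" "x < y"
    let ?f = "\<lambda>t. (c t - c 0) \<bullet> (c t - c 0)"
    have fd: "(?f has_derivative (\<lambda>h. h * (2 * ((c t - c 0) \<bullet> c' t)))) (at t within {x..y})"
      if "t \<in> {x..y}" for t
    proof -
      have "(c has_vector_derivative c' t) (at t within {x..y})"
        by (rule has_vector_derivative_within_subset[OF d]) (use that xy \<open>e \<le> e0\<close> e0 in auto)
      then have "((\<lambda>t. c t - c 0) has_vector_derivative c' t) (at t within {x..y})"
        by (auto intro!: derivative_eq_intros)
      from has_vector_derivative_inner[OF this this] show ?thesis
        by (simp add: has_vector_derivative_def inner_commute)
    qed
    obtain t where t: "t \<in> {x<..<y}" "?f y - ?f x = (y - x) * (2 * ((c t - c 0) \<bullet> c' t))"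
      using mvt_simple[OF xy(3), of ?f "\<lambda>t h. h * (2 * ((c t - c 0) \<bullet> c' t))"] fd by auto
    have "0 < (c t - c 0) \<bullet> c' t" using chord[of t t] t(1) xy \<open>e \<le> e0\<close> by auto
    then have "?f x < ?f y" using t(2) xy(3) by (metis diff_gt_0_iff_gt mult_pos_pos zero_less_numeral)
    then show "dist (c 0) (c x) < dist (c 0) (c y)"
      unfolding dist_norm norm_minus_commute[of "c 0"] norm_lt .
  qed
  then show ?thesis using e0 by (intro exI[of _ e0]) auto
qed

section \<open>Translating the parameter\<close>

lemma legendrian_on_shift:
  assumes leg: "legendrian_on {x + l..x + u} c" and "l < u"
  shows "legendrian_on {l..u} (\<lambda>\<tau>. c (x + \<tau>))"
    and "\<tau> \<in> {l..u} \<Longrightarrow> vector_derivative (\<lambda>\<tau>. c (x + \<tau>)) (at \<tau> within {l..u}) =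
      vector_derivative c (at (x + \<tau>) within {x + l..x + u})"
proof -
  have nt: "at \<tau> within {l..u} \<noteq> bot" if "\<tau> \<in> {l..u}" for \<tau>
    by (rule Icc_nontrivial[OF \<open>l < u\<close> that])
  have img: "(\<lambda>\<tau>. x + \<tau>) ` {l..u} = {x + l..x + u}" by simp
  note L = legendrian_on_D[OF leg Icc_nontrivial]
  have d: "((\<lambda>\<tau>. c (x + \<tau>)) has_vector_derivative vector_derivative c (at (x + \<tau>) within {x + l..x + u}))
      (at \<tau> within {l..u})" if "\<tau> \<in> {l..u}" for \<tau>
    by (rule has_vector_derivative_shift, unfold img) (use L(3) that \<open>l < u\<close> in auto)
  show vd: "vector_derivative (\<lambda>\<tau>. c (x + \<tau>)) (at \<tau> within {l..u}) =
      vector_derivative c (at (x + \<tau>) within {x + l..x + u})" if "\<tau> \<in> {l..u}" for \<tau>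
    by (rule vector_derivative_within[OF nt[OF that] d[OF that]])
  have "smooth_on {l..u} (\<lambda>\<tau>. c (x + \<tau>))"
    by (rule smooth_on_compose[OF L(1)]) (use \<open>l < u\<close> in \<open>auto intro!: smooth_intros\<close>)
  then show "legendrian_on {l..u} (\<lambda>\<tau>. c (x + \<tau>))"
    using leg vd smooth_on_curve[of "{l..u}" "\<lambda>\<tau>. c (x + \<tau>)"] nt unfolding legendrian_on_def by auto
qed

lemma legendrian_on_open_subset:
  assumes leg: "legendrian_on S c" and S: "\<And>t. t \<in> S \<Longrightarrow> at t within S \<noteq> bot"
    and U: "open U" "U \<subseteq> S" "t \<in> U"
  shows "(c has_vector_derivative vector_derivative c (at t)) (at t)"
    "vector_derivative c (at t) = vector_derivative c (at t within S)"
proof -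
  have "(c has_vector_derivative vector_derivative c (at t within S)) (at t within U)"
    by (rule has_vector_derivative_within_subset[OF legendrian_on_D(3)[OF leg S]]) (use U in auto)
  then have *: "(c has_vector_derivative vector_derivative c (at t within S)) (at t)"
    using at_within_open[OF U(3,1)] by simp
  then show e: "vector_derivative c (at t) = vector_derivative c (at t within S)"
    by (rule vector_derivative_at)
  show "(c has_vector_derivative vector_derivative c (at t)) (at t)" unfolding e by (rule *)
qed

lemma has_vector_derivative_translate:
  "((\<lambda>x. f (s + x)) has_vector_derivative d) (at t) \<longleftrightarrow> (f has_vector_derivative d) (at (s + t))"
proof
  assume "(f has_vector_derivative d) (at (s + t))"
  then show "((\<lambda>x. f (s + x)) has_vector_derivative d) (at t)"
    by (rule has_vector_derivative_shift[OF has_vector_derivative_at_within])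
next
  assume "((\<lambda>x. f (s + x)) has_vector_derivative d) (at t)"
  then have "((\<lambda>x. f (s + x)) has_vector_derivative d) (at (- s + (s + t)))" by simp
  from has_vector_derivative_shift[OF has_vector_derivative_at_within[OF this], of UNIV]
  show "(f has_vector_derivative d) (at (s + t))" by simp
qed

lemma vector_derivative_translate:
  "vector_derivative (\<lambda>x. f (s + x)) (at t) = vector_derivative f (at (s + t))"
  by (simp add: vector_derivative_def has_vector_derivative_translate)

lemma periodic_int:
  fixes f :: "real \<Rightarrow> 'a"
  assumes "\<And>t. f (t + L) = f t"
  shows "f (t + of_int m * L) = f t"
proof (induction m arbitrary: t rule: int_induct[of _ 0])
  case (step1 i)
  have "f (t + of_int (i + 1) * L) = f (t + of_int i * L + L)" by (simp add: algebra_simps)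
  then show ?case using step1 assms by simp
next
  case (step2 i)
  have "f (t + of_int (i - 1) * L) = f (t + of_int (i - 1) * L + L)" by (simp add: assms)
  also have "\<dots> = f (t + of_int i * L)" by (simp add: algebra_simps)
  finally show ?case using step2 by simp
qed simp

lemma periodic_vector_derivative:
  assumes "\<And>t. f (t + L) = f t"
  shows "vector_derivative f (at (t + of_int m * L)) = vector_derivative f (at t)"
proof -
  have "(\<lambda>x. f (of_int m * L + x)) = f" using periodic_int[of f L _ m] assms by (auto simp: add.commute)
  then show ?thesis
    using vector_derivative_translate[of f "of_int m * L" t] by (simp add: add.commute)
qed

text \<open>The condition \<open>corner\<close> excludes cusps: the direction of arrival is not
  opposite to that of departure. Edges are indexed by all integers rather than residues, so that
  neighbours of a corner are simply \<open>j - 1\<close> and \<open>j + 1\<close>.\<close>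

locale legendrian_polygon =
  fixes k :: nat and c :: "real \<Rightarrow> real^3"
  assumes k: "3 \<le> k"
    and periodic: "c (t + real k) = c t"
    and inj: "inj_on c {0..<real k}"
    and leg: "legendrian_on {real_of_int j..real_of_int j + 1} c"
    and corner: "sgn (vector_derivative c (at (real_of_int j) within {real_of_int j - 1..real_of_int j})) \<noteq>
      - sgn (vector_derivative c (at (real_of_int j) within {real_of_int j..real_of_int j + 1}))"
begin

lemma per: "c (t + of_int m * real k) = c t"
  using periodic by (rule periodic_int)

lemma inj_mod: "c s = c t \<Longrightarrow> \<exists>m::int. s = t + of_int m * real k"
proof -
  assume eq: "c s = c t"
  define n where "n x = \<lfloor>x / real k\<rfloor>" for x
  have kp: "0 < real k" using k by simp
  have r: "x - of_int (n x) * real k \<in> {0..<real k}" for x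
  proof -
    have "of_int (n x) \<le> x / real k" "x / real k < of_int (n x) + 1" by (auto simp: n_def)
    then show ?thesis using kp by (simp add: field_simps)
  qed
  have "c (x - of_int (n x) * real k) = c x" for x using per[of x "- n x"] by simp
  then have "s - of_int (n s) * real k = t - of_int (n t) * real k"
    using inj_onD[OF inj _ r r] eq by metis
  then have "s = t + of_int (n s - n t) * real k" by (simp add: algebra_simps)
  then show ?thesis by blast
qed

lemma leg_left: "legendrian_on {-1..0} (\<lambda>\<tau>. c (of_int j + \<tau>))"
  and leg_right: "legendrian_on {0..1} (\<lambda>\<tau>. c (of_int j + \<tau>))"
  and vd_left: "\<tau> \<in> {-1..0} \<Longrightarrow> vector_derivative (\<lambda>\<tau>. c (of_int j + \<tau>)) (at \<tau> within {-1..0}) =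
    vector_derivative c (at (of_int j + \<tau>) within {of_int j - 1..of_int j})"
  and vd_right: "\<tau> \<in> {0..1} \<Longrightarrow> vector_derivative (\<lambda>\<tau>. c (of_int j + \<tau>)) (at \<tau> within {0..1}) =
    vector_derivative c (at (of_int j + \<tau>) within {of_int j..of_int j + 1})"
  using legendrian_on_shift[of "of_int j" "-1" 0 c] legendrian_on_shift[of "of_int j" 0 1 c]
    leg[of "j - 1"] leg[of j] by auto

lemma noninteger:
  assumes "of_int j < t" "t < of_int j + 1"
  shows "(c has_vector_derivative vector_derivative c (at t)) (at t)"
    "vector_derivative c (at t) = vector_derivative c (at t within {of_int j..of_int j + 1})"
proof -
  let ?U = "{real_of_int j<..<of_int j + 1}" and ?S = "{real_of_int j..of_int j + 1}"
  have U: "?U \<subseteq> ?S" "t \<in> ?U" and S: "s \<in> ?S \<Longrightarrow> at s within ?S \<noteq> bot" for s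
    using assms Icc_nontrivial[of "real_of_int j" "of_int j + 1" s] by auto
  show "(c has_vector_derivative vector_derivative c (at t)) (at t)"
    by (rule legendrian_on_open_subset(1)[OF leg S open_greaterThanLessThan U])
  show "vector_derivative c (at t) = vector_derivative c (at t within ?S)"
    by (rule legendrian_on_open_subset(2)[OF leg S open_greaterThanLessThan U])
qed

lemma cont: "continuous_on UNIV c"
proof -
  have cs: "continuous_on {of_int j..of_int j + 1} c" for j
    by (rule legendrian_on_D(2)[OF leg Icc_nontrivial]) auto
  have "isCont c t" for t
  proof -
    define j where "j = \<lfloor>t\<rfloor>"
    have "continuous_on ({of_int (j - 1)..of_int (j - 1) + 1} \<union> {of_int j..of_int j + 1}) c"
      by (intro continuous_on_closed_Un cs closed_atLeastAtMost)
    moreover have "{of_int (j - 1)..of_int (j - 1) + 1} \<union> {of_int j..of_int j + 1} = {of_int j - 1..of_int j + (1::real)}"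
      by auto
    ultimately have "continuous_on {of_int j - 1..of_int j + 1} c" by simp
    then have "continuous_on {of_int j - 1<..<of_int j + 1} c" by (rule continuous_on_subset) auto
    moreover have "t \<in> {of_int j - 1<..<of_int j + 1}" by (auto simp: j_def) linarith+
    ultimately show ?thesis by (simp add: continuous_on_eq_continuous_at)
  qed
  then show ?thesis by (simp add: continuous_at_imp_continuous_on)
qed

text \<open>Both one-sided tangents lie in the same contact plane and are not opposite, so
  \<open>contact_half_plane\<close> applies at the corner itself; continuity of the tangents on each
  side extends the inequality to a short interval.\<close>

lemma corner_half_plane:
  "\<exists>a d. a $ 3 = 0 \<and> 0 < d \<and> d < 1 \<and>
     (\<forall>\<tau>\<in>{-d..0}. 0 < a \<bullet> vector_derivative (\<lambda>\<tau>. c (of_int j + \<tau>)) (at \<tau> within {-1..0})) \<and>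
     (\<forall>\<tau>\<in>{0..d}. 0 < a \<bullet> vector_derivative (\<lambda>\<tau>. c (of_int j + \<tau>)) (at \<tau> within {0..1}))"
proof -
  let ?c = "\<lambda>\<tau>. c (of_int j + \<tau>)"
  note L = legendrian_on_D[OF leg_left[of j] Icc_nontrivial[of "-1" 0], simplified]
  note R = legendrian_on_D[OF leg_right[of j] Icc_nontrivial[of 0 1], simplified]
  obtain a where a: "a $ 3 = 0" "0 < a \<bullet> vector_derivative ?c (at 0 within {-1..0})"
    "0 < a \<bullet> vector_derivative ?c (at 0 within {0..1})"
  proof -
    have "\<exists>a. a $ 3 = 0 \<and> 0 < a \<bullet> vector_derivative ?c (at 0 within {-1..0}) \<and>
      0 < a \<bullet> vector_derivative ?c (at 0 within {0..1})"
    proof (rule contact_half_plane[of _ "?c 0"])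
      show "sgn (vector_derivative ?c (at 0 within {-1..0})) \<noteq> - sgn (vector_derivative ?c (at 0 within {0..1}))"
        using corner[of j] vd_left[of 0 j] vd_right[of 0 j] by simp
    qed (use L(5,6)[of 0] R(5,6)[of 0] in \<open>auto simp: contact_plane_def\<close>)
    then show ?thesis using that by blast
  qed
  have T: "((\<lambda>\<tau>. a \<bullet> vector_derivative ?c (at \<tau> within {-1..0})) \<longlongrightarrow>
      a \<bullet> vector_derivative ?c (at 0 within {-1..0})) (at 0 within {-1..0})"
    "((\<lambda>\<tau>. a \<bullet> vector_derivative ?c (at \<tau> within {0..1})) \<longlongrightarrow>
      a \<bullet> vector_derivative ?c (at 0 within {0..1})) (at 0 within {0..1})"
    using L(4) R(4) by (auto intro!: tendsto_intros simp: continuous_on_def)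
  obtain dl where dl: "0 < dl"
    "\<forall>\<tau>\<in>{-1..0}. \<tau> \<noteq> 0 \<and> dist \<tau> 0 < dl \<longrightarrow> 0 < a \<bullet> vector_derivative ?c (at \<tau> within {-1..0})"
    using order_tendstoD(1)[OF T(1) a(2)] unfolding eventually_at by blast
  obtain dr where dr: "0 < dr"
    "\<forall>\<tau>\<in>{0..1}. \<tau> \<noteq> 0 \<and> dist \<tau> 0 < dr \<longrightarrow> 0 < a \<bullet> vector_derivative ?c (at \<tau> within {0..1})"
    using order_tendstoD(1)[OF T(2) a(3)] unfolding eventually_at by blast
  note d = dl(1) dr(1) dl(2) dr(2)
  define e where "e = min (1 / 2) (min dl dr / 2)"
  have e: "0 < e" "e < 1" "e < dl" "e < dr" using d(1,2) by (auto simp: e_def)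
  have "0 < a \<bullet> vector_derivative ?c (at \<tau> within {-1..0})" if "\<tau> \<in> {-e..0}" for \<tau>
    using d(3) a(2) that e by (cases "\<tau> = 0") (auto simp: dist_real_def)
  moreover have "0 < a \<bullet> vector_derivative ?c (at \<tau> within {0..1})" if "\<tau> \<in> {0..e}" for \<tau>
    using d(4) a(3) that e by (cases "\<tau> = 0") (auto simp: dist_real_def)
  ultimately show ?thesis using a(1) e by (intro exI[of _ a] exI[of _ e]) auto
qed

text \<open>Near the corner the distance from it is strictly monotone on each side, which gives a
  unique exit time \<open>p\<close> or \<open>q\<close>. On the rest of the period it has a positive
  minimum by compactness and injectivity, so a smaller ball is not met again.\<close>

lemma corner_window:
  assumes "0 < d"
  shows "\<forall>\<^sub>F r in at_right 0. \<exists>p q. - d < p \<and> p < 0 \<and> 0 < q \<and> q < d \<and>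
    (\<forall>\<tau>\<in>{-1..<real k - 1}. c (of_int j + \<tau>) \<in> ball (c (of_int j)) r \<longleftrightarrow> \<tau> \<in> {p<..<q})"
proof -
  let ?c = "\<lambda>\<tau>. c (of_int j + \<tau>)"
  define N where "N \<tau> = dist (?c 0) (?c \<tau>)" for \<tau>
  note L = legendrian_on_D[OF leg_left[of j] Icc_nontrivial[of "-1" 0], simplified]
  note R = legendrian_on_D[OF leg_right[of j] Icc_nontrivial[of 0 1], simplified]
  obtain d1 where d1: "0 < d1" "\<forall>e\<in>{0<..d1}. e \<le> 1 \<and> strict_mono_on {0..e} N"
    using radial_strict_mono[OF R(3) R(4) R(6)[of 0], simplified] unfolding N_def by auto
  obtain d2 where d2: "0 < d2" "\<forall>e\<in>{0<..d2}. e \<le> 1 \<and> strict_mono_on {0..e} (\<lambda>\<tau>. N (- \<tau>))"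
  proof -
    have "((\<lambda>\<tau>. ?c (- \<tau>)) has_vector_derivative - vector_derivative ?c (at (- \<tau>) within {-1..0})) (at \<tau> within {0..1})"
      if "\<tau> \<in> {0..1}" for \<tau>
    proof -
      have "(uminus has_vector_derivative - 1) (at \<tau> within {0..1})"
        by (auto intro!: derivative_eq_intros)
      moreover have "(?c has_vector_derivative vector_derivative ?c (at (- \<tau>) within {-1..0}))
          (at (- \<tau>) within uminus ` {0..1})"
        using L(3)[of "- \<tau>"] that by simp
      ultimately show ?thesis using vector_diff_chain_within[of uminus "- 1" \<tau> "{0..1}" ?c] by (simp add: o_def)
    qed
    moreover have "continuous_on {0..1} (\<lambda>\<tau>. - vector_derivative ?c (at (- \<tau>) within {-1..0}))"
      by (intro continuous_intros continuous_on_compose2[OF L(4)]) auto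
    ultimately show ?thesis
      using radial_strict_mono[of "\<lambda>\<tau>. ?c (- \<tau>)" "\<lambda>\<tau>. - vector_derivative ?c (at (- \<tau>) within {-1..0})"]
        L(6)[of 0] that by (auto simp: N_def[abs_def])
  qed
  define e where "e = min (d / 2) (min d1 d2)"
  have e: "0 < e" "e < d" "e \<le> 1" and m1: "strict_mono_on {0..e} N" and m2: "strict_mono_on {0..e} (\<lambda>\<tau>. N (- \<tau>))"
    using assms d1 d2 by (auto simp: e_def)
  have Nc: "continuous_on S N" for S
    unfolding N_def by (intro continuous_intros continuous_on_compose2[OF cont]) auto
  \<comment> \<open>The period is closed up at \<open>real k - 1\<close> to obtain a compact set;
    the added point has the same image as \<open>-1\<close>, which already belongs to it.\<close>
  define A where "A = {-1..-e} \<union> {e..real k - 1}"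
  have A: "compact A" "- e \<in> A" "e \<in> A" using k e by (auto simp: A_def compact_Un)
  obtain s where s: "s \<in> A" "\<forall>\<tau>\<in>A. N s \<le> N \<tau>"
    using continuous_attains_inf[OF A(1) _ Nc] A(2) by blast
  have Ns: "0 < N s"
  proof (rule ccontr)
    assume "\<not> 0 < N s"
    then have "?c s = ?c 0" by (simp add: N_def)
    then obtain m :: int where m: "s = of_int m * real k" using inj_mod by force
    have sb: "s \<noteq> 0" "-1 \<le> s" "s \<le> real k - 1" using s(1) e k by (auto simp: A_def)
    show False
    proof (cases "m \<le> -1")
      case True
      then have "of_int m * real k \<le> -1 * real k" by (intro mult_right_mono) auto
      then show False using sb m k by simp
    next
      case False
      then have "1 \<le> m" using sb m by (cases "m = 0") auto
      then have "1 * real k \<le> of_int m * real k" by (intro mult_right_mono) auto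
      then show False using sb m by simp
    qed
  qed
  have "\<exists>p q. - d < p \<and> p < 0 \<and> 0 < q \<and> q < d \<and>
    (\<forall>\<tau>\<in>{-1..<real k - 1}. ?c \<tau> \<in> ball (c (of_int j)) r \<longleftrightarrow> \<tau> \<in> {p<..<q})" if r: "0 < r" "r < N s" for r
  proof -
    have N0: "N 0 = 0" by (simp add: N_def)
    obtain q where q: "0 \<le> q" "q \<le> e" "N q = r"
      using IVT'[of N 0 r e] Nc N0 r e s(2) A(3) by force
    obtain p where p: "- e \<le> p" "p \<le> 0" "N p = r"
      using IVT2'[of N 0 r "-e"] Nc N0 r e s(2) A(2) by force
    have pq: "p < 0" "0 < q" using p q N0 r by (auto simp: less_le)
    have "N \<tau> < r \<longleftrightarrow> \<tau> \<in> {p<..<q}" if t: "\<tau> \<in> {-1..<real k - 1}" for \<tau>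
    proof -
      consider "\<tau> \<in> A" | "0 \<le> \<tau>" "\<tau> < e" | "- e < \<tau>" "\<tau> \<le> 0" using t by (fastforce simp: A_def)
      then show ?thesis
      proof cases
        case 1
        then have "\<tau> \<notin> {p<..<q}" using p q by (auto simp: A_def)
        then show ?thesis using 1 s(2) r by force
      next
        case 2
        have "N \<tau> < N q \<longleftrightarrow> \<tau> < q" using strict_mono_on_less[OF m1, of \<tau> q] 2 q by auto
        then show ?thesis using q(3) 2 pq by auto
      next
        case 3
        have "N (- (- \<tau>)) < N (- (- p)) \<longleftrightarrow> - \<tau> < - p" using strict_mono_on_less[OF m2, of "- \<tau>" "- p"] 3 p by auto
        then show ?thesis using p(3) 3 pq by auto
      qed
    qed
    then show ?thesis using p q pq e by (intro exI[of _ p] exI[of _ q]) (auto simp: N_def)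
  qed
  then show ?thesis using Ns by (auto simp: eventually_at_right_field)
qed

end

context legendrian_polygon
begin

lemma separated_balls:
  "\<forall>\<^sub>F r in at_right 0. \<forall>i<k. \<forall>j<k. i \<noteq> j \<longrightarrow> disjnt (ball (c (real i)) r) (ball (c (real j)) r)"
proof -
  have *: "\<forall>\<^sub>F r in at_right 0. disjnt (ball (c (real i)) r) (ball (c (real j)) r)"
    if "i < k" "j < k" "i \<noteq> j" for i j
  proof -
    have "c (real i) \<noteq> c (real j)" using inj_onD[OF inj, of "real i" "real j"] that by auto
    then have pos: "0 < dist (c (real i)) (c (real j)) / 2" by simp
    have "disjnt (ball (c (real i)) r) (ball (c (real j)) r)"
      if "r < dist (c (real i)) (c (real j)) / 2" for r
      unfolding disjnt_iff
    proof clarify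
      fix x assume "x \<in> ball (c (real i)) r" "x \<in> ball (c (real j)) r"
      then have "dist (c (real i)) (c (real j)) < r + r"
        using dist_triangle_less_add[of "c (real i)" x r "c (real j)" r] by (simp add: dist_commute)
      then show False using that by simp
    qed
    then show ?thesis using pos unfolding eventually_at_right_field by blast
  qed
  have "\<forall>\<^sub>F r in at_right 0. \<forall>i\<in>{..<k}. \<forall>j\<in>{..<k} - {i}. disjnt (ball (c (real i)) r) (ball (c (real j)) r)"
    by (intro eventually_ball_finite ballI *) auto
  then show ?thesis by (rule eventually_mono) auto
qed

text \<open>Without existence the choice in \<open>cycle_tb\<close> would say nothing. The local
  roundings of the corners are glued at the half-integers, in a neighbourhood of which they all
  coincide with \<open>c\<close>.\<close>

lemma smoothing_exists:
  "\<exists>h. legendrian_on UNIV h \<and> (\<forall>t. h (t + real k) = h t) \<and> rounds_corners k c h"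
proof -
  define cc where "cc i \<tau> = c (real i + \<tau>)" for i \<tau>
  define HP where "HP i a d \<longleftrightarrow> a $ 3 = 0 \<and> 0 < d \<and> d < 1 \<and>
     (\<forall>\<tau>\<in>{-d..0}. 0 < a \<bullet> vector_derivative (cc i) (at \<tau> within {-1..0})) \<and>
     (\<forall>\<tau>\<in>{0..d}. 0 < a \<bullet> vector_derivative (cc i) (at \<tau> within {0..1}))" for i a d
  have "\<exists>a d. HP i a d" for i
    using corner_half_plane[of "int i"] by (simp add: HP_def cc_def[abs_def])
  then obtain a d where "\<forall>i. HP i (a i) (d i)" by metis
  then have HP: "a i $ 3 = 0" "0 < d i" "d i < 1"
    "\<And>\<tau>. \<tau> \<in> {-d i..0} \<Longrightarrow> 0 < a i \<bullet> vector_derivative (cc i) (at \<tau> within {-1..0})"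
    "\<And>\<tau>. \<tau> \<in> {0..d i} \<Longrightarrow> 0 < a i \<bullet> vector_derivative (cc i) (at \<tau> within {0..1})" for i
    by (auto simp: HP_def)
  have ll: "legendrian_on {-1..0} (cc i)" and lr: "legendrian_on {0..1} (cc i)" for i
    using leg_left[of "int i"] leg_right[of "int i"] by (simp_all add: cc_def[abs_def])
  define e where "e i = min (d i) (1 / 2)" for i
  have e: "0 < e i" "e i \<le> d i" "e i \<le> 1 / 2" for i using HP(2)[of i] by (auto simp: e_def)
  define WIN where "WIN r i p q \<longleftrightarrow> - e i < p \<and> p < 0 \<and> 0 < q \<and> q < e i \<and>
    (\<forall>\<tau>\<in>{-1..<real k - 1}. cc i \<tau> \<in> ball (c (real i)) r \<longleftrightarrow> \<tau> \<in> {p<..<q})" for r i p q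
  have "\<forall>\<^sub>F r in at_right 0. \<exists>p q. WIN r i p q" for i
    using corner_window[OF e(1)[of i], of "int i"] by (simp add: WIN_def cc_def)
  then have "\<forall>\<^sub>F r in at_right 0. \<forall>i\<in>{..<k}. \<exists>p q. WIN r i p q"
    by (intro eventually_ball_finite) simp_all
  then have "\<forall>\<^sub>F r in at_right 0. 0 < r \<and> (\<forall>i\<in>{..<k}. \<exists>p q. WIN r i p q) \<and>
      (\<forall>i<k. \<forall>j<k. i \<noteq> j \<longrightarrow> disjnt (ball (c (real i)) r) (ball (c (real j)) r))"
    by (intro eventually_conj separated_balls eventually_at_right_less)
  then obtain r where r: "0 < r" "\<forall>i\<in>{..<k}. \<exists>p q. WIN r i p q"
      "\<forall>i<k. \<forall>j<k. i \<noteq> j \<longrightarrow> disjnt (ball (c (real i)) r) (ball (c (real j)) r)"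
    using eventually_happens'[OF trivial_limit_at_right_real] by blast
  obtain p q where "\<forall>i\<in>{..<k}. WIN r i (p i) (q i)" using r(2) by metis
  then have W: "- e i < p i" "p i < 0" "0 < q i" "q i < e i"
    "\<And>\<tau>. \<tau> \<in> {-1..<real k - 1} \<Longrightarrow> cc i \<tau> \<in> ball (c (real i)) r \<longleftrightarrow> \<tau> \<in> {p i<..<q i}" if "i < k" for i
    using that by (auto simp: WIN_def)
  have Wb: "cc i \<tau> \<in> ball (c (real i)) r" if "i < k" "p i < \<tau>" "\<tau> < q i" for i \<tau>
    using W[OF that(1)] e(3)[of i] that k by simp
  \<comment> \<open>The largest symmetric interval inside the window, since
    \<open>corner_rounding\<close> is stated for symmetric intervals whereas \<open>- p i\<close>
    and \<open>q i\<close> differ in general.\<close>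
  define dd where "dd i = min (- p i) (q i)" for i
  have dd: "0 < dd i" "dd i < 1" "dd i \<le> d i" "dd i < 1 / 2" if "i < k" for i
    using W(1-4)[OF that] e(2,3)[of i] by (auto simp: dd_def)
  define CR where "CR i g \<rho> \<longleftrightarrow> 0 < \<rho> \<and> \<rho> < dd i \<and> smooth_on {-1<..<1} g \<and>
    (\<forall>t\<in>{-1<..<1}. vector_derivative g (at t) \<noteq> 0 \<and> vector_derivative g (at t) \<in> contact_plane (g t)) \<and>
    (\<forall>t. \<rho> \<le> \<bar>t\<bar> \<and> \<bar>t\<bar> < 1 \<longrightarrow> g t = cc i t) \<and>
    (\<forall>t. \<bar>t\<bar> < dd i \<longrightarrow> g t \<in> ball (c (real i)) r \<and> 0 < a i \<bullet> vector_derivative g (at t))" for i g \<rho>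
  have "\<exists>g \<rho>. CR i g \<rho>" if i: "i < k" for i
    unfolding CR_def
  proof (rule corner_rounding[OF ll lr dd(1,2)[OF i] HP(1)])
    show "0 < a i \<bullet> vector_derivative (cc i) (at t within {-1..0})" if "t \<in> {-dd i..0}" for t
      using HP(4)[of t i] that dd(3)[OF i] by simp
    show "0 < a i \<bullet> vector_derivative (cc i) (at t within {0..1})" if "t \<in> {0..dd i}" for t
      using HP(5)[of t i] that dd(3)[OF i] by simp
    show "cc i t \<in> ball (c (real i)) r" if "t \<in> {-dd i<..<dd i}" for t
      by (rule Wb[OF i]) (use that in \<open>auto simp: dd_def\<close>)
  qed
  then have "\<forall>i\<in>{..<k}. \<exists>g \<rho>. CR i g \<rho>" by simp
  then obtain g \<rho> where "\<forall>i\<in>{..<k}. CR i (g i) (\<rho> i)" by metis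
  then have G: "0 < \<rho> i" "\<rho> i < dd i" "smooth_on {-1<..<1} (g i)"
    "\<And>t. t \<in> {-1<..<1} \<Longrightarrow> vector_derivative (g i) (at t) \<noteq> 0 \<and>
        vector_derivative (g i) (at t) \<in> contact_plane (g i t)"
    "\<And>t. \<rho> i \<le> \<bar>t\<bar> \<Longrightarrow> \<bar>t\<bar> < 1 \<Longrightarrow> g i t = cc i t"
    "\<And>t. \<bar>t\<bar> < dd i \<Longrightarrow> g i t \<in> ball (c (real i)) r \<and> 0 < a i \<bullet> vector_derivative (g i) (at t)"
    if "i < k" for i
    using that by (auto simp: CR_def)
  \<comment> \<open>The nearest integer, with ties rounded up: each time is governed by the corner
    closest to it.\<close>
  define near where "near t = \<lfloor>t + 1 / 2\<rfloor>" for t :: real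
  define idx where "idx j = nat (j mod int k)" for j
  define h where "h t = g (idx (near t)) (t - of_int (near t))" for t
  have kp: "0 < int k" using k by simp
  have idx: "idx j < k" for j using kp by (simp add: idx_def nat_less_iff)
  have idx_nat: "idx (int i) = i" if "i < k" for i using that by (simp add: idx_def)
  have cc_idx: "cc (idx j) \<tau> = c (of_int j + \<tau>)" for j \<tau>
  proof -
    have "real (idx j) = of_int (j mod int k)" using kp by (simp add: idx_def)
    also have "\<dots> = of_int j + of_int (- (j div int k)) * real k"
      by (simp add: minus_div_mult_eq_mod[symmetric])
    finally have "real (idx j) + \<tau> = of_int j + \<tau> + of_int (- (j div int k)) * real k" by simp
    then show ?thesis unfolding cc_def by (simp only: per)
  qed
  have near: "near t = j" if "\<bar>t - of_int j\<bar> < 1 / 2" for t j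
    unfolding near_def by (rule floor_unique) (use that in linarith)+
  have near_le: "\<bar>t - of_int (near t)\<bar> \<le> 1 / 2" for t
    unfolding near_def abs_le_iff by linarith
  have hg: "h t = g (idx j) (t - of_int j)" if "\<bar>t - of_int j\<bar> < 1 / 2" for t j
    by (simp add: h_def near[OF that])
  have hc: "h t = c t" if "\<rho> (idx (near t)) \<le> \<bar>t - of_int (near t)\<bar>" for t
    unfolding h_def using G(5)[OF idx that] near_le[of t] cc_idx by simp
  \<comment> \<open>A common margin around the half-integers on which no corner has been modified,
    so that a tie in \<open>near\<close> is harmless.\<close>
  obtain \<mu> where \<mu>: "0 < \<mu>" "\<mu> < 1 / 2" "\<And>i. i < k \<Longrightarrow> \<rho> i \<le> 1 / 2 - \<mu>"
  proof -
    have "\<forall>\<^sub>F \<mu> in at_right 0. \<rho> i \<le> 1 / 2 - \<mu>" if "i < k" for i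
    proof -
      have "\<rho> i < 1 / 2" using G(2)[OF that] dd(4)[OF that] by simp
      then show ?thesis by (auto simp: eventually_at_right_field intro!: exI[of _ "1 / 2 - \<rho> i"])
    qed
    then have "\<forall>\<^sub>F \<mu> in at_right 0. \<forall>i\<in>{..<k}. \<rho> i \<le> 1 / 2 - \<mu>"
      by (intro eventually_ball_finite) auto
    moreover have "\<forall>\<^sub>F \<mu> in at_right 0. \<mu> < (1 / 2 :: real)"
      by (auto simp: eventually_at_right_field intro!: exI[of _ "1 / 2"])
    ultimately have "\<forall>\<^sub>F \<mu> in at_right 0. 0 < \<mu> \<and> \<mu> < 1 / 2 \<and> (\<forall>i\<in>{..<k}. \<rho> i \<le> 1 / 2 - \<mu>)"
      by (intro eventually_conj eventually_at_right_less)
    from eventually_happens'[OF trivial_limit_at_right_real this] show ?thesis using that by auto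
  qed
  have loc: "\<exists>U f. open U \<and> t \<in> U \<and> smooth_on U f \<and> (\<forall>s\<in>U. h s = f s) \<and>
      vector_derivative f (at t) \<noteq> 0 \<and> vector_derivative f (at t) \<in> contact_plane (f t)" for t
  proof (cases "\<bar>t - of_int (near t)\<bar> < 1 / 2")
    case True
    define j where "j = near t"
    define U where "U = {of_int j - 1 / 2<..<of_int j + (1 / 2 :: real)}"
    have t: "t \<in> U" using True unfolding U_def j_def greaterThanLessThan_iff by linarith
    define f where "f s = g (idx j) (- of_int j + s)" for s
    have "smooth_on U f"
      unfolding f_def by (rule smooth_on_compose[OF G(3)[OF idx]]) (auto intro!: smooth_intros simp: U_def)
    moreover have "h s = f s" if "s \<in> U" for s
    proof -
      have "\<bar>s - of_int j\<bar> < 1 / 2" using that unfolding U_def greaterThanLessThan_iff by linarith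
      from hg[OF this] show ?thesis by (simp add: f_def)
    qed
    moreover have "- of_int j + t \<in> {-1<..<1}" using t by (auto simp: U_def)
    note G(4)[OF idx[of j] this]
    moreover have "vector_derivative f (at t) = vector_derivative (g (idx j)) (at (- of_int j + t))"
      unfolding f_def by (rule vector_derivative_translate)
    moreover have "open U" by (simp add: U_def)
    ultimately show ?thesis using t unfolding f_def by metis
  next
    case False
    define j where "j = \<lfloor>t\<rfloor>"
    have tj: "t = of_int j + 1 / 2"
    proof -
      have "\<bar>t - of_int (near t)\<bar> = 1 / 2" using False near_le[of t] by simp
      then have "t = of_int (near t) + 1 / 2 \<or> t = of_int (near t) - 1 / 2" by linarith
      then have "t = of_int (near t) + 1 / 2 \<or> t = of_int (near t - 1) + 1 / 2" by auto
      then obtain n :: int where n: "t = of_int n + 1 / 2" by blast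
      moreover have "j = n" unfolding j_def n by linarith
      ultimately show ?thesis by simp
    qed
    define U where "U = {t - \<mu><..<t + \<mu>}"
    have "h s = c s" if "s \<in> U" for s
    proof (rule hc)
      have s: "of_int j + 1 / 2 - \<mu> < s" "s < of_int j + 1 / 2 + \<mu>" using that tj by (auto simp: U_def)
      then have "near s = j \<or> near s = j + 1" unfolding near_def using \<mu>(2) by linarith
      then have "1 / 2 - \<mu> \<le> \<bar>s - of_int (near s)\<bar>" using s by auto
      then show "\<rho> (idx (near s)) \<le> \<bar>s - of_int (near s)\<bar>" using \<mu>(3)[OF idx[of "near s"]] by linarith
    qed
    moreover have "U \<subseteq> {of_int j..of_int j + 1}" using \<mu>(2) tj by (auto simp: U_def)
    then have "smooth_on U c"
      using smooth_on_subset legendrian_on_D(1)[OF leg[of j] Icc_nontrivial] by fastforce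
    moreover have "vector_derivative c (at t) \<noteq> 0 \<and> vector_derivative c (at t) \<in> contact_plane (c t)"
    proof -
      have *: "of_int j < t" "t < of_int j + 1" using tj by auto
      show ?thesis using leg[of j] * unfolding noninteger(2)[OF *] legendrian_on_def by auto
    qed
    ultimately show ?thesis
      using \<mu>(1) by (intro exI[of _ U] exI[of _ c]) (auto simp: U_def)
  qed
  have "smooth_on UNIV h"
  proof (rule smooth_on_local)
    fix t
    obtain U f where "open U" "t \<in> U" "smooth_on U f" "\<forall>s\<in>U. h s = f s" using loc[of t] by blast
    then show "\<exists>U. open U \<and> t \<in> U \<and> smooth_on U h" using smooth_on_cong[of U h f] by blast
  qed simp
  moreover have "vector_derivative h (at t) \<noteq> 0 \<and> vector_derivative h (at t) \<in> contact_plane (h t)" for t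
  proof -
    obtain U f where U: "open U" "t \<in> U" "smooth_on U f" "\<forall>s\<in>U. h s = f s"
      and f: "vector_derivative f (at t) \<noteq> 0" "vector_derivative f (at t) \<in> contact_plane (f t)"
      using loc[of t] by blast
    have "(f has_vector_derivative vector_derivative f (at t)) (at t)"
      using smooth_on_has_vector_derivative[OF U(3,2)] at_within_open[OF U(2,1)] by simp
    then have e: "vector_derivative h (at t) = vector_derivative f (at t)"
      by (rule vector_derivative_eqI_open(1)[OF _ U(1,2)]) (rule bspec[OF U(4)])
    show ?thesis unfolding e bspec[OF U(4,2)] using f by (rule conjI)
  qed
  ultimately have "legendrian_on UNIV h"
    unfolding legendrian_on_def using smooth_on_curve[of UNIV h] by simp
  moreover have "h (t + real k) = h t" for t
  proof -
    have "near (t + real k) = near t + int k" by (simp add: near_def floor_eq_iff algebra_simps) linarith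
    then show ?thesis by (simp add: h_def idx_def)
  qed
  moreover have "rounds_corners k c h"
    unfolding rounds_corners_def
  proof (rule exI[of _ r], intro conjI allI impI)
    fix t assume out: "\<forall>i<k. c t \<notin> ball (c (real i)) r"
    show "h t = c t"
    proof (rule hc, rule ccontr)
      define j where "j = near t"
      assume "\<not> \<rho> (idx (near t)) \<le> \<bar>t - of_int (near t)\<bar>"
      then have "\<bar>t - of_int j\<bar> < dd (idx j)" using G(2)[OF idx[of j]] by (simp add: j_def)
      then have "cc (idx j) (t - of_int j) \<in> ball (c (real (idx j))) r"
        by (intro Wb idx) (auto simp: dd_def abs_less_iff)
      then show False using out idx[of j] cc_idx[of j "t - of_int j"] by simp
    qed
  next
    fix i assume i: "i < k"
    have pos: "0 < a i \<bullet> vector_derivative c (at (real i + \<tau>))" "vector_derivative c (at (real i + \<tau>)) = vector_derivative (cc i) (at \<tau>)"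
      "(c has_vector_derivative vector_derivative c (at (real i + \<tau>))) (at (real i + \<tau>))"
      if tau: "\<tau> \<noteq> 0" "\<bar>\<tau>\<bar> < d i" for \<tau>
    proof -
      show eq: "vector_derivative c (at (real i + \<tau>)) = vector_derivative (cc i) (at \<tau>)"
        unfolding cc_def[abs_def] by (simp add: vector_derivative_translate)
      consider "0 < \<tau>" | "\<tau> < 0" using tau by linarith
      then show "0 < a i \<bullet> vector_derivative c (at (real i + \<tau>))"
        "(c has_vector_derivative vector_derivative c (at (real i + \<tau>))) (at (real i + \<tau>))"
      proof (atomize(full), cases)
        case 1
        have "vector_derivative (cc i) (at \<tau>) = vector_derivative (cc i) (at \<tau> within {0..1})"
          by (rule legendrian_on_open_subset(2)[OF lr Icc_nontrivial, of "{0<..<1}"]) (use 1 tau HP(3)[of i] in auto)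
        then show "0 < a i \<bullet> vector_derivative c (at (real i + \<tau>)) \<and>
            (c has_vector_derivative vector_derivative c (at (real i + \<tau>))) (at (real i + \<tau>))"
          using eq HP(5)[of \<tau> i] 1 tau noninteger(1)[of "int i" "real i + \<tau>"] HP(3)[of i] by auto
      next
        case 2
        have "vector_derivative (cc i) (at \<tau>) = vector_derivative (cc i) (at \<tau> within {-1..0})"
          by (rule legendrian_on_open_subset(2)[OF ll Icc_nontrivial, of "{-1<..<0}"]) (use 2 tau HP(3)[of i] in auto)
        then show "0 < a i \<bullet> vector_derivative c (at (real i + \<tau>)) \<and>
            (c has_vector_derivative vector_derivative c (at (real i + \<tau>))) (at (real i + \<tau>))"
          using eq HP(4)[of \<tau> i] 2 tau noninteger(1)[of "int i - 1" "real i + \<tau>"] HP(3)[of i] by auto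
      qed
    qed
    note w = W[OF i] and ei = e[of i]
    have win: "c t \<in> ball (c (real i)) r \<longleftrightarrow> t \<in> {real i + p i<..<real i + q i}"
      if "t \<in> {real i - 1..<real i - 1 + real k}" for t
      using w(5)[of "t - real i"] that by (auto simp: cc_def)
    have ins: "h t \<in> ball (c (real i)) r \<and> 0 < a i \<bullet> vector_derivative h (at t) \<and>
        (t \<noteq> real i \<longrightarrow> 0 < a i \<bullet> vector_derivative c (at t))"
      if t: "t \<in> {real i + p i<..<real i + q i}" for t
    proof -
      have ti: "\<bar>t - real i\<bar> < e i" using t w(1-4) by (auto simp: abs_less_iff)
      have near_i: "h s = g i (s - real i)" if "\<bar>s - real i\<bar> < 1 / 2" for s
        using hg[of s "int i"] that idx_nat[OF i] by simp
      have pc: "0 < a i \<bullet> vector_derivative c (at t)" if "t \<noteq> real i"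
        using pos(1)[of "t - real i"] that ti ei(2) by simp
      show ?thesis
      proof (cases "\<bar>t - real i\<bar> < dd i")
        case True
        have "vector_derivative h (at t) = vector_derivative (\<lambda>s. g i (- real i + s)) (at t)"
        proof (rule vector_derivative_eqI_open(1)[of _ _ _ "{real i - 1/2<..<real i + 1/2}"])
          have "(g i has_vector_derivative vector_derivative (g i) (at (- real i + t))) (at (- real i + t))"
            using smooth_on_has_vector_derivative[OF G(3)[OF i], of "- real i + t"]
              at_within_open[of "- real i + t" "{-1<..<1}"] True dd(2)[OF i] by (simp add: abs_less_iff)
          then show "((\<lambda>s. g i (- real i + s)) has_vector_derivative
              vector_derivative (\<lambda>s. g i (- real i + s)) (at t)) (at t)"
            unfolding vector_derivative_translate[of "g i" "- real i" t]
              has_vector_derivative_translate[of "g i" "- real i"] .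
          show "t \<in> {real i - 1/2<..<real i + 1/2}"
            using True dd(4)[OF i] unfolding greaterThanLessThan_iff by linarith
          fix s assume "s \<in> {real i - 1/2<..<real i + 1/2}"
          then have "\<bar>s - real i\<bar> < 1 / 2" unfolding greaterThanLessThan_iff by linarith
          from near_i[OF this] show "h s = g i (- real i + s)" by simp
        qed simp
        then have "vector_derivative h (at t) = vector_derivative (g i) (at (t - real i))"
          using vector_derivative_translate[of "g i" "- real i" t] by simp
        then show ?thesis using G(6)[OF i True] near_i[of t] True dd(4)[OF i] pc by simp
      next
        case False
        have \<rho>: "\<rho> i < \<bar>t - real i\<bar>" using False G(2)[OF i] by simp
        define U where "U = {s. \<rho> i < \<bar>s - real i\<bar>} \<inter> {s. \<bar>s - real i\<bar> < 1 / 2}"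
        have U: "open U" unfolding U_def by (intro open_Int open_Collect_less continuous_intros)
        have tU: "t \<in> U" using \<rho> ti ei(3) by (auto simp: U_def)
        have hU: "h s = c s" if "s \<in> U" for s
          using near_i[of s] G(5)[OF i, of "s - real i"] that by (simp add: U_def cc_def)
        have tn: "t \<noteq> real i" using \<rho> G(1)[OF i] by auto
        have "vector_derivative h (at t) = vector_derivative c (at t)"
          by (rule vector_derivative_eqI_open(1)[OF _ U tU hU])
            (use pos(3)[of "t - real i"] tn ti ei(2) in auto)
        then show ?thesis using pc[OF tn] hU[OF tU] Wb[OF i, of "t - real i"] t by (auto simp: cc_def)
      qed
    qed
    show "\<exists>p q a. real i - 1 < p \<and> p < real i \<and> real i < q \<and> q < real i + 1 \<and> a $ 3 = 0 \<and>
        (\<forall>t\<in>{real i - 1..<real i - 1 + real k}. (c t \<in> ball (c (real i)) r) = (t \<in> {p<..<q})) \<and>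
        (\<forall>t\<in>{p<..<q}. h t \<in> ball (c (real i)) r \<and> 0 < a \<bullet> vector_derivative h (at t) \<and>
          (t \<noteq> real i \<longrightarrow> 0 < a \<bullet> vector_derivative c (at t)))"
      using win ins w(1-4) ei HP(1)[of i]
      by (intro exI[of _ "real i + p i"] exI[of _ "real i + q i"] exI[of _ "a i"]) auto
  qed (use r in auto)
  ultimately show ?thesis by blast
qed

end

subsection \<open>The Thurston--Bennequin number of a rounded polygon\<close>

text \<open>The inequalities place \<open>g\<close> before \<open>s\<close> in the ball of radius
  \<open>norm n\<close> around \<open>g s - n\<close>, and after \<open>s\<close> in the one around
  \<open>g s + n\<close>; these balls touch at \<open>g s\<close>. First order gives
  \<open>0 \<le> g' s \<bullet> n\<close>. If this were 0, second order would bound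
  \<open>g'' \<bullet> n\<close> below by the square of \<open>norm (g' s)\<close> and above by its
  negative.\<close>

lemma touching_balls_transversal:
  fixes g g' :: "real \<Rightarrow> 'a::real_inner"
  assumes \<delta>: "0 < \<delta>" and g: "\<And>t. t \<in> {s - \<delta><..<s + \<delta>} \<Longrightarrow> (g has_vector_derivative g' t) (at t)"
    and g2: "(g' has_vector_derivative g'') (at s)" and nz: "g' s \<noteq> 0"
    and left: "\<And>t. t \<in> {s - \<delta><..<s} \<Longrightarrow> 2 * ((g t - g s) \<bullet> n) \<le> - (norm (g t - g s))\<^sup>2"
    and right: "\<And>t. t \<in> {s<..<s + \<delta>} \<Longrightarrow> (norm (g t - g s))\<^sup>2 \<le> 2 * ((g t - g s) \<bullet> n)"
  shows "0 < g' s \<bullet> n"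
proof (rule ccontr)
  assume neg: "\<not> 0 < g' s \<bullet> n"
  define q where "q t = (1 / (t - s)) *\<^sub>R (g t - g s)" for t
  have gs: "(g has_vector_derivative g' s) (at s)" using g[of s] \<delta> by simp
  have q: "(q \<longlongrightarrow> g' s) (at s)"
  proof -
    let ?R = "\<lambda>y. g y - (g s + (y - s) *\<^sub>R g' s)"
    have "((\<lambda>y. (1 / norm (y - s)) *\<^sub>R ?R y) \<longlongrightarrow> 0) (at s)"
      using gs unfolding has_vector_derivative_def has_derivative_within by simp
    then have "((\<lambda>y. norm ((1 / norm (y - s)) *\<^sub>R ?R y)) \<longlongrightarrow> 0) (at s)"
      by (rule tendsto_norm_zero)
    moreover have "norm ((1 / norm (y - s)) *\<^sub>R ?R y) = norm (q y - g' s)" if "y \<noteq> s" for y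
    proof -
      have "q y - g' s = (1 / (y - s)) *\<^sub>R ?R y"
        using that by (simp add: q_def scaleR_diff_right scaleR_add_right)
      then show ?thesis by simp
    qed
    then have "\<forall>\<^sub>F y in at s. norm ((1 / norm (y - s)) *\<^sub>R ?R y) = norm (q y - g' s)"
      by (simp add: eventually_at_filter)
    ultimately have "((\<lambda>y. norm (q y - g' s)) \<longlongrightarrow> 0) (at s)"
      by (rule Lim_transform_eventually)
    then show ?thesis by (rule LIM_zero_cancel[OF tendsto_norm_zero_cancel])
  qed
  have qn: "((\<lambda>t. q t \<bullet> n) \<longlongrightarrow> g' s \<bullet> n) (at s)" "((\<lambda>t. (norm (q t))\<^sup>2) \<longlongrightarrow> (norm (g' s))\<^sup>2) (at s)"
    by (intro tendsto_intros q)+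
  have evr: "\<forall>\<^sub>F t in at_right s. t \<in> {s<..<s + \<delta>}" and evl: "\<forall>\<^sub>F t in at_left s. t \<in> {s - \<delta><..<s}"
    using \<delta> by (auto simp: eventually_at_right_field eventually_at_left_field
        intro: exI[of _ "s + \<delta>"] exI[of _ "s - \<delta>"])
  have "0 \<le> g' s \<bullet> n"
  proof (rule tendsto_lowerbound[OF tendsto_mono[OF at_le qn(1)], of "{s<..}"])
    show "\<forall>\<^sub>F t in at_right s. 0 \<le> q t \<bullet> n"
      using evr
    proof (rule eventually_mono)
      fix t assume t: "t \<in> {s<..<s + \<delta>}"
      have "0 \<le> (g t - g s) \<bullet> n" using right[OF t] zero_le_power2[of "norm (g t - g s)"] by linarith
      then show "0 \<le> q t \<bullet> n" using t by (simp add: q_def)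
    qed
  qed auto
  with neg have A0: "g' s \<bullet> n = 0" by simp
  define f where "f t = (g t - g s) \<bullet> n" for t
  \<comment> \<open>L'Hospital's rule takes the place of a Taylor expansion, as \<open>g'\<close> is
    only assumed to be differentiable at \<open>s\<close>.\<close>
  have lim: "((\<lambda>t. f t / (t - s)\<^sup>2) \<longlongrightarrow> g'' \<bullet> n / 2) (at s)"
  proof (rule lhopital[where f' = "\<lambda>t. g' t \<bullet> n" and g' = "\<lambda>t. 2 * (t - s)"])
    have "isCont g s" by (rule has_vector_derivative_continuous[OF gs])
    then have "((\<lambda>t. (g t - g s) \<bullet> n) \<longlongrightarrow> (g s - g s) \<bullet> n) (at s)"
      unfolding isCont_def by (intro tendsto_intros)
    then show "(f \<longlongrightarrow> 0) (at s)" by (simp add: f_def[abs_def])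
    have "((\<lambda>t. (t - s)\<^sup>2) \<longlongrightarrow> (s - s)\<^sup>2) (at s)" by (intro tendsto_intros)
    then show "((\<lambda>t. (t - s)\<^sup>2) \<longlongrightarrow> 0) (at s)" by simp
    show "\<forall>\<^sub>F t in at s. (t - s)\<^sup>2 \<noteq> 0" "\<forall>\<^sub>F t in at s. 2 * (t - s) \<noteq> 0"
      by (auto simp: eventually_at_filter)
    have "\<forall>\<^sub>F t in nhds s. t \<in> {s - \<delta><..<s + \<delta>}"
      using \<delta> by (intro eventually_nhds_in_open) auto
    then show "\<forall>\<^sub>F t in at s. (f has_real_derivative g' t \<bullet> n) (at t)"
      unfolding eventually_at_filter
    proof (rule eventually_mono, intro impI)
      fix t assume "t \<in> {s - \<delta><..<s + \<delta>}"
      then have "((\<lambda>t. g t - g s) has_vector_derivative g' t) (at t)"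
        using has_vector_derivative_diff_const g by blast
      from bounded_linear.has_vector_derivative[OF bounded_linear_inner_left this]
      show "(f has_real_derivative g' t \<bullet> n) (at t)"
        by (simp add: f_def[abs_def] has_real_derivative_iff_has_vector_derivative)
    qed
    show "\<forall>\<^sub>F t in at s. ((\<lambda>t. (t - s)\<^sup>2) has_real_derivative 2 * (t - s)) (at t)"
      by (intro always_eventually allI) (auto intro!: derivative_eq_intros)
    have "((\<lambda>t. g' t \<bullet> n) has_real_derivative g'' \<bullet> n) (at s)"
      using bounded_linear.has_vector_derivative[OF bounded_linear_inner_left g2]
      by (simp add: has_real_derivative_iff_has_vector_derivative)
    then have "((\<lambda>t. (g' t \<bullet> n - g' s \<bullet> n) / (t - s) / 2) \<longlongrightarrow> g'' \<bullet> n / 2) (at s)"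
      unfolding has_field_derivative_iff by (intro tendsto_intros) simp_all
    then show "((\<lambda>t. g' t \<bullet> n / (2 * (t - s))) \<longlongrightarrow> g'' \<bullet> n / 2) (at s)"
      by (simp add: A0 mult.commute)
  qed
  then have lim2: "((\<lambda>t. 2 * (f t / (t - s)\<^sup>2)) \<longlongrightarrow> 2 * (g'' \<bullet> n / 2)) (at s)"
    by (rule tendsto_mult_left)
  have nq: "(norm (q t))\<^sup>2 = (norm (g t - g s))\<^sup>2 / (t - s)\<^sup>2" for t
    by (simp add: q_def power_mult_distrib power_divide)
  have "(norm (g' s))\<^sup>2 \<le> 2 * (g'' \<bullet> n / 2)"
  proof (rule tendsto_le[OF _ tendsto_mono[OF at_le lim2] tendsto_mono[OF at_le qn(2)]])
    show "\<forall>\<^sub>F t in at_right s. (norm (q t))\<^sup>2 \<le> 2 * (f t / (t - s)\<^sup>2)"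
      using evr by (rule eventually_mono) (use right in \<open>auto simp: nq f_def divide_right_mono\<close>)
  qed auto
  moreover have "2 * (g'' \<bullet> n / 2) \<le> - (norm (g' s))\<^sup>2"
  proof (rule tendsto_le[OF _ tendsto_mono[OF at_le tendsto_minus[OF qn(2)]] tendsto_mono[OF at_le lim2]])
    show "\<forall>\<^sub>F t in at_left s. 2 * (f t / (t - s)\<^sup>2) \<le> - (norm (q t))\<^sup>2"
      using evl
    proof (rule eventually_mono)
      fix t assume t: "t \<in> {s - \<delta><..<s}"
      have "2 * f t / (t - s)\<^sup>2 \<le> - (norm (g t - g s))\<^sup>2 / (t - s)\<^sup>2"
        using left[OF t] by (intro divide_right_mono) (auto simp: f_def)
      then show "2 * (f t / (t - s)\<^sup>2) \<le> - (norm (q t))\<^sup>2" by (simp add: nq)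
    qed
  qed auto
  moreover have "0 < (norm (g' s))\<^sup>2" using nz by simp
  ultimately show False by linarith
qed

text \<open>The unrolled form of \<open>rounds_corners\<close>, with windows, directions and balls
  indexed by all integers. Periodicity enters through the shift in \<open>ball_window\<close>, and
  corners congruent modulo \<open>k\<close> share their ball.\<close>

locale rounded_polygon = legendrian_polygon +
  fixes h :: "real \<Rightarrow> real^3" and r :: real and P Q :: "int \<Rightarrow> real" and a :: "int \<Rightarrow> real^3"
  assumes h_leg: "legendrian_on UNIV h"
    and h_periodic: "h (t + real k) = h t"
    and r: "0 < r"
    and PQ: "of_int j - 1 < P j" "P j < of_int j" "of_int j < Q j" "Q j < of_int j + 1"
    and a3: "a j $ 3 = 0"
    and ball_window: "c t \<in> ball (c (of_int j)) r \<longleftrightarrow> (\<exists>m::int. t + of_int m * real k \<in> {P j<..<Q j})"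
    and outside: "(\<And>j. t \<notin> {P j<..<Q j}) \<Longrightarrow> h t = c t"
    and inside: "t \<in> {P j<..<Q j} \<Longrightarrow> h t \<in> ball (c (of_int j)) r"
    and a_h: "t \<in> {P j<..<Q j} \<Longrightarrow> 0 < a j \<bullet> vector_derivative h (at t)"
    and a_c: "t \<in> {P j<..<Q j} \<Longrightarrow> t \<noteq> of_int j \<Longrightarrow> 0 < a j \<bullet> vector_derivative c (at t)"
    and separated: "\<not> int k dvd i - j \<Longrightarrow> disjnt (ball (c (of_int i)) r) (ball (c (of_int j)) r)"

context legendrian_polygon
begin

lemma rounded_polygonI:
  assumes h: "legendrian_on UNIV h" "\<And>t. h (t + real k) = h t" and rc: "rounds_corners k c h"
  shows "\<exists>r P Q a. rounded_polygon k c h r P Q a"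
proof -
  define WIN where "WIN r i p q a \<longleftrightarrow>
     real i - 1 < p \<and> p < real i \<and> real i < q \<and> q < real i + 1 \<and> a $ 3 = 0 \<and>
     (\<forall>t\<in>{real i - 1..<real i - 1 + real k}. c t \<in> ball (c (real i)) r \<longleftrightarrow> t \<in> {p<..<q}) \<and>
     (\<forall>t\<in>{p<..<q}. h t \<in> ball (c (real i)) r \<and> 0 < a \<bullet> vector_derivative h (at t) \<and>
        (t \<noteq> real i \<longrightarrow> 0 < a \<bullet> vector_derivative c (at t)))" for r i p q and a :: "real^3"
  obtain r where r: "0 < r" "\<forall>i<k. \<forall>j<k. i \<noteq> j \<longrightarrow> disjnt (ball (c (real i)) r) (ball (c (real j)) r)"
    "\<forall>t. (\<forall>i<k. c t \<notin> ball (c (real i)) r) \<longrightarrow> h t = c t" "\<forall>i<k. \<exists>p q a. WIN r i p q a"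
    using rc unfolding rounds_corners_def WIN_def by blast
  have "\<forall>i. \<exists>p q a. i < k \<longrightarrow> WIN r i p q a" using r(4) by blast
  then obtain p q b where W: "\<And>i. i < k \<Longrightarrow> WIN r i (p i) (q i) (b i)" by metis
  define idx where "idx j = nat (j mod int k)" for j
  define sh where "sh j = of_int (j div int k) * real k" for j
  have kp: "0 < int k" using k by simp
  have idx: "idx j < k" for j using kp by (simp add: idx_def nat_less_iff)
  have ij: "of_int j = real (idx j) + sh j" for j
  proof -
    have "real (idx j) = of_int (j mod int k)" using kp by (simp add: idx_def)
    then show ?thesis by (simp add: sh_def minus_div_mult_eq_mod[symmetric])
  qed
  have cj: "c (of_int j) = c (real (idx j))" for j
    using arg_cong[where f = c, OF ij[of j, unfolded sh_def]] by (simp only: per)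
  note W' = W[OF idx, unfolded WIN_def]
  have pb: "real (idx j) - 1 < p (idx j)" "p (idx j) < real (idx j)" "real (idx j) < q (idx j)"
    "q (idx j) < real (idx j) + 1" "b (idx j) $ 3 = 0" for j
    using W'[of j] by auto
  have win: "c t \<in> ball (c (real (idx j))) r \<longleftrightarrow> t \<in> {p (idx j)<..<q (idx j)}"
    if "t \<in> {real (idx j) - 1..<real (idx j) - 1 + real k}" for j t
    using W'[of j] that by blast
  have ins: "h t \<in> ball (c (real (idx j))) r" "0 < b (idx j) \<bullet> vector_derivative h (at t)"
    "t \<noteq> real (idx j) \<Longrightarrow> 0 < b (idx j) \<bullet> vector_derivative c (at t)"
    if "t \<in> {p (idx j)<..<q (idx j)}" for j t
    using W'[of j] that by blast+
  have hper: "h (t + of_int m * real k) = h t" for t m by (rule periodic_int) (rule h(2))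
  have vdh: "vector_derivative h (at (t + of_int m * real k)) = vector_derivative h (at t)" for t m
    by (rule periodic_vector_derivative) (rule h(2))
  have vdc: "vector_derivative c (at (t + of_int m * real k)) = vector_derivative c (at t)" for t m
    by (rule periodic_vector_derivative) (rule periodic)
  have shift: "t - sh j = t + of_int (- (j div int k)) * real k" for t j by (simp add: sh_def)
  have bw: "c t \<in> ball (c (of_int j)) r \<longleftrightarrow>
      (\<exists>m::int. t + of_int m * real k \<in> {p (idx j) + sh j<..<q (idx j) + sh j})" for t j
  proof -
    \<comment> \<open>The shift that moves \<open>t\<close> into the one period for which
      \<open>rounds_corners\<close> describes the visits to this ball.\<close>
    define m where "m = - \<lfloor>(t - (real (idx j) - 1)) / real k\<rfloor>"
    have "of_int (- m) \<le> (t - (real (idx j) - 1)) / real k" "(t - (real (idx j) - 1)) / real k < of_int (- m) + 1"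
      unfolding m_def by simp_all
    then have t': "t + of_int m * real k \<in> {real (idx j) - 1..<real (idx j) - 1 + real k}"
      using k by (simp add: field_simps)
    have "c t \<in> ball (c (of_int j)) r \<longleftrightarrow> t + of_int m * real k \<in> {p (idx j)<..<q (idx j)}"
      using win[OF t'] by (simp only: per cj)
    also have "\<dots> \<longleftrightarrow> (\<exists>m::int. t + of_int m * real k \<in> {p (idx j) + sh j<..<q (idx j) + sh j})"
    proof
      assume "t + of_int m * real k \<in> {p (idx j)<..<q (idx j)}"
      then have "t + of_int (m + j div int k) * real k \<in> {p (idx j) + sh j<..<q (idx j) + sh j}"
        by (simp add: sh_def algebra_simps)
      then show "\<exists>m::int. t + of_int m * real k \<in> {p (idx j) + sh j<..<q (idx j) + sh j}" by blast
    next
      assume "\<exists>m::int. t + of_int m * real k \<in> {p (idx j) + sh j<..<q (idx j) + sh j}"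
      then obtain n :: int where n: "t + of_int n * real k \<in> {p (idx j) + sh j<..<q (idx j) + sh j}" by blast
      define t2 where "t2 = t + of_int (n - j div int k) * real k"
      have t2: "t2 \<in> {p (idx j)<..<q (idx j)}" using n by (simp add: t2_def sh_def algebra_simps)
      have "t2 \<in> {real (idx j) - 1..<real (idx j) - 1 + real k}"
        using t2 pb[of j] k by auto
      from win[OF this] t2 have "c t2 \<in> ball (c (real (idx j))) r" by blast
      then have "c (t + of_int m * real k) \<in> ball (c (real (idx j))) r" by (simp only: t2_def per)
      then show "t + of_int m * real k \<in> {p (idx j)<..<q (idx j)}" using win[OF t'] by blast
    qed
    finally show ?thesis .
  qed
  have "rounded_polygon k c h r (\<lambda>j. p (idx j) + sh j) (\<lambda>j. q (idx j) + sh j) (\<lambda>j. b (idx j))"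
  proof unfold_locales
    fix t :: real and i j :: int
    show "of_int j - 1 < p (idx j) + sh j" "p (idx j) + sh j < of_int j"
      "of_int j < q (idx j) + sh j" "q (idx j) + sh j < of_int j + 1" "b (idx j) $ 3 = 0"
      using pb[of j] ij[of j] by linarith+
    show "c t \<in> ball (c (of_int j)) r \<longleftrightarrow>
      (\<exists>m::int. t + of_int m * real k \<in> {p (idx j) + sh j<..<q (idx j) + sh j})" by (rule bw)
    show "h t = c t" if out: "\<And>j. t \<notin> {p (idx j) + sh j<..<q (idx j) + sh j}"
    proof -
      have "c t \<notin> ball (c (real i)) r" if i: "i < k" for i
      proof
        assume "c t \<in> ball (c (real i)) r"
        then obtain m :: int where m: "t + of_int m * real k \<in> {p (idx (int i)) + sh (int i)<..<q (idx (int i)) + sh (int i)}"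
          using bw[of t "int i"] by auto
        have "idx (int i - m * int k) = idx (int i)" "sh (int i - m * int k) = sh (int i) - of_int m * real k"
        proof -
          have e: "int i - m * int k = int i + (- m) * int k" by simp
          have d: "(int i + (- m) * int k) div int k = - m + int i div int k"
            using kp by (intro div_mult_self1) simp
          show "sh (int i - m * int k) = sh (int i) - of_int m * real k"
            unfolding sh_def e d by (simp add: algebra_simps)
          show "idx (int i - m * int k) = idx (int i)" unfolding idx_def e mod_mult_self1 ..
        qed
        then have "t \<in> {p (idx (int i - m * int k)) + sh (int i - m * int k)<..<
            q (idx (int i - m * int k)) + sh (int i - m * int k)}"
          using m by simp
        then show False using out by blast
      qed
      then show ?thesis using r(3) by blast
    qed
    assume t: "t \<in> {p (idx j) + sh j<..<q (idx j) + sh j}"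
    then have t2: "t - sh j \<in> {p (idx j)<..<q (idx j)}" by simp
    show "h t \<in> ball (c (of_int j)) r"
      using ins(1)[OF t2] unfolding shift hper cj .
    show "0 < b (idx j) \<bullet> vector_derivative h (at t)"
      using ins(2)[OF t2] unfolding shift vdh .
    show "0 < b (idx j) \<bullet> vector_derivative c (at t)" if "t \<noteq> of_int j"
    proof -
      have "t - sh j \<noteq> real (idx j)" using that ij[of j] by linarith
      from ins(3)[OF t2 this] show ?thesis unfolding shift vdc .
    qed
  next
    fix i j :: int assume "\<not> int k dvd i - j"
    then have "idx i \<noteq> idx j"
      using kp by (auto simp: idx_def mod_eq_dvd_iff[symmetric] eq_nat_nat_iff)
    then show "disjnt (ball (c (of_int i)) r) (ball (c (of_int j)) r)"
      using r(2) idx by (simp add: cj)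
  qed (use h r(1) in auto)
  then show ?thesis by blast
qed

end

context rounded_polygon
begin

lemma hper: "h (t + of_int m * real k) = h t"
  using h_periodic by (rule periodic_int)

lemma h_deriv: "(h has_vector_derivative vector_derivative h (at t)) (at t)"
  and h_smooth: "smooth_on UNIV h"
  and h_contact: "vector_derivative h (at t) \<in> contact_plane (h t)"
  and h_nz: "vector_derivative h (at t) \<noteq> 0"
  using legendrian_on_D(1)[OF h_leg] legendrian_on_D(3)[OF h_leg] h_leg by (auto simp: legendrian_on_def)

lemma h_cont: "continuous_on UNIV h"
  by (rule smooth_on_continuous[OF h_smooth])

lemma in_window: "of_int j \<in> {P j<..<Q j}"
  using PQ[of j] by simp

lemma c_in_ball: "t \<in> {P j<..<Q j} \<Longrightarrow> c t \<in> ball (c (of_int j)) r"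
  using ball_window[of t j] by (metis add.right_neutral mult_zero_left of_int_0)

lemma increasing_on_open:
  assumes "x < y" "\<And>t. t \<in> {x<..<y} \<Longrightarrow> (f has_vector_derivative f' t) (at t) \<and> 0 < b \<bullet> f' t"
    "continuous_on {x..y} f"
  shows "b \<bullet> f x < b \<bullet> f y"
proof (rule DERIV_pos_imp_increasing_open[OF assms(1)])
  fix t assume "x < t" "t < y"
  then have "(f has_vector_derivative f' t) (at t)" "0 < b \<bullet> f' t" using assms(2) by auto
  then show "\<exists>d. ((\<lambda>t. b \<bullet> f t) has_real_derivative d) (at t) \<and> 0 < d"
    using bounded_linear.has_vector_derivative[OF bounded_linear_inner_right, of f "f' t" "at t" b]
    by (auto simp: has_real_derivative_iff_has_vector_derivative)
qed (intro continuous_intros assms(3))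

lemma h_window_mono:
  assumes "P j < x" "x < y" "y < Q j"
  shows "a j \<bullet> h x < a j \<bullet> h y"
proof (rule increasing_on_open[OF assms(2)])
  show "(h has_vector_derivative vector_derivative h (at t)) (at t) \<and> 0 < a j \<bullet> vector_derivative h (at t)"
    if "t \<in> {x<..<y}" for t
    using h_deriv a_h[of t j] that assms by simp
qed (rule continuous_on_subset[OF h_cont], simp)

lemma c_deriv_window:
  assumes "t \<in> {P j<..<Q j}" "t \<noteq> of_int j"
  shows "(c has_vector_derivative vector_derivative c (at t)) (at t)"
  using noninteger(1)[of j t] noninteger(1)[of "j - 1" t] assms PQ[of j] by (cases "t < of_int j") auto

lemma c_window_mono:
  assumes "P j < x" "x < y" "y < Q j"
  shows "a j \<bullet> c x < a j \<bullet> c y"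
proof -
  have *: "a j \<bullet> c x < a j \<bullet> c y" if "P j < x" "x < y" "y < Q j" "of_int j \<notin> {x<..<y}" for x y
  proof (rule increasing_on_open[OF that(2)])
    fix t assume t: "t \<in> {x<..<y}"
    then have "t \<noteq> of_int j" using that(4) by auto
    then show "(c has_vector_derivative vector_derivative c (at t)) (at t) \<and> 0 < a j \<bullet> vector_derivative c (at t)"
      using c_deriv_window[of t j] a_c[of t j] t that by simp
  qed (rule continuous_on_subset[OF cont], simp)
  show ?thesis
  proof (cases "of_int j \<in> {x<..<y}")
    case True
    then have "a j \<bullet> c x < a j \<bullet> c (of_int j)" "a j \<bullet> c (of_int j) < a j \<bullet> c y"
      using *[of x "of_int j"] *[of "of_int j" y] assms by auto
    then show ?thesis by simp
  qed (use * assms in blast)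
qed

section \<open>The linear homotopy from the rounded curve to the polygon\<close>

definition H :: "real \<Rightarrow> real \<Rightarrow> real^3" where
  "H l t = (1 - l) *\<^sub>R h t + l *\<^sub>R c t"

lemma H_per: "H l (t + of_int m * real k) = H l t"
  by (simp add: H_def hper per)

lemma H_mono:
  assumes "b \<bullet> h x < b \<bullet> h y" "b \<bullet> c x < b \<bullet> c y" "l \<in> {0..1}"
  shows "b \<bullet> H l x < b \<bullet> H l y"
proof (cases "l = 1")
  case False
  then have "(1 - l) * (b \<bullet> h x) < (1 - l) * (b \<bullet> h y)" using assms by simp
  moreover have "l * (b \<bullet> c x) \<le> l * (b \<bullet> c y)" using assms by (intro mult_left_mono) auto
  ultimately show ?thesis by (simp add: H_def inner_add_right)
qed (use assms in \<open>simp add: H_def\<close>)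

lemma H_in_ball:
  assumes "t \<in> {P j<..<Q j}" "l \<in> {0..1}"
  shows "H l t \<in> ball (c (of_int j)) r"
  unfolding H_def
  by (rule convexD[OF convex_ball inside[OF assms(1)] c_in_ball[OF assms(1)]]) (use assms(2) in auto)

text \<open>Inside a window the homotopy stays in the convex ball of that corner, and outside it
  does not move. Coinciding points therefore belong to one window up to a period, and there the
  component along \<open>a j\<close> increases strictly.\<close>

lemma H_inj:
  assumes "H l s = H l t" "l \<in> {0..1}"
  shows "\<exists>m::int. s = t + of_int m * real k"
proof -
  have main: "\<exists>m::int. s = t + of_int m * real k"
    if eq: "H l s = H l t" and s: "s \<in> {P i<..<Q i}" for s t i
  proof -
    have Hs: "H l t \<in> ball (c (of_int i)) r" using H_in_ball[OF s assms(2)] eq by simp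
    have "c t \<in> ball (c (of_int i)) r"
    proof (cases "\<exists>j. t \<in> {P j<..<Q j}")
      case True
      then obtain j where j: "t \<in> {P j<..<Q j}" by blast
      then have "\<not> disjnt (ball (c (of_int i)) r) (ball (c (of_int j)) r)"
        using H_in_ball[OF j assms(2)] Hs by (auto simp: disjnt_iff)
      then obtain n where "i - j = int k * n" using separated by blast
      then have "i = j + n * int k" by (simp add: algebra_simps)
      then have "(of_int i :: real) = of_int j + of_int n * real k" by simp
      then have "c (of_int i) = c (of_int j)" by (simp only: per)
      then show ?thesis using c_in_ball[OF j] by simp
    next
      case False
      then have "h t = c t" using outside by blast
      then show ?thesis using Hs by (simp add: H_def scaleR_left_distrib[symmetric])
    qed
    then obtain m :: int where m: "t + of_int m * real k \<in> {P i<..<Q i}" using ball_window by blast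
    define t' where "t' = t + of_int m * real k"
    have "H l t' = H l s" using eq by (simp add: t'_def H_per)
    then have "\<not> s < t'" "\<not> t' < s"
      using H_mono[OF h_window_mono[of i s t'] c_window_mono[of i s t'] assms(2)]
        H_mono[OF h_window_mono[of i t' s] c_window_mono[of i t' s] assms(2)] s m
      by (auto simp: t'_def)
    then have "s = t'" by simp
    then show ?thesis unfolding t'_def by blast
  qed
  consider i where "s \<in> {P i<..<Q i}" | i where "t \<in> {P i<..<Q i}"
    | "\<And>i. s \<notin> {P i<..<Q i}" "\<And>i. t \<notin> {P i<..<Q i}" by blast
  then show ?thesis
  proof cases
    case 1
    then show ?thesis using main assms(1) by blast
  next
    case 2
    then obtain m :: int where "t = s + of_int m * real k" using main[OF assms(1)[symmetric]] by blast
    then have "s = t + of_int (- m) * real k" by simp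
    then show ?thesis by blast
  next
    case 3
    then have "h s = c s" "h t = c t" using outside by blast+
    then have "c s = c t" using assms(1) by (simp add: H_def scaleR_left_distrib[symmetric])
    then show ?thesis by (rule inj_mod)
  qed
qed

lemma legendrian_knot_h: "legendrian_knot (real k) h"
proof -
  have "inj_on h {0..<real k}"
  proof (rule inj_onI)
    fix s t assume st: "s \<in> {0..<real k}" "t \<in> {0..<real k}" "h s = h t"
    then have "H 0 s = H 0 t" by (simp add: H_def)
    then obtain m :: int where m: "s = t + of_int m * real k" using H_inj[of 0] by auto
    have "m = 0"
    proof (rule ccontr)
      assume "m \<noteq> 0"
      then have "1 \<le> m \<or> m \<le> -1" by linarith
      then show False
      proof
        assume "1 \<le> m"
        then have "1 * real k \<le> of_int m * real k" by (intro mult_right_mono) auto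
        then show False using st(1,2) unfolding m atLeastLessThan_iff by linarith
      next
        assume "m \<le> -1"
        then have "of_int m * real k \<le> -1 * real k" by (intro mult_right_mono) auto
        then show False using st(1,2) unfolding m atLeastLessThan_iff by linarith
      qed
    qed
    then show "s = t" using m by simp
  qed
  then show ?thesis using h_leg h_periodic k by (simp add: legendrian_knot_def)
qed

section \<open>A common direction of increase at every parameter\<close>

lemma window_unique:
  assumes "t \<in> {P i<..<Q i}" "of_int j < t" "t < of_int j + 1"
  shows "i = j \<or> i = j + 1"
proof -
  have "of_int i - 1 < t" "t < of_int i + 1" using assms(1) PQ[of i] by auto
  then have "real_of_int i < of_int (j + 2)" "real_of_int (j - 1) < of_int i" using assms by simp_all
  then have "i < j + 2" "j - 1 < i" unfolding of_int_less_iff by auto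
  then show ?thesis by linarith
qed

text \<open>If the free time between two consecutive windows has positive length, \<open>h\<close>
  and \<open>c\<close> agree on it and have equal derivatives there, even at its ends. Otherwise the
  windows meet at \<open>s\<close>, where nothing is known about the derivative of \<open>h\<close>
  except through the two touching balls.\<close>

lemma common_direction:
  assumes s: "\<And>j. s \<notin> {P j<..<Q j}"
  shows "\<exists>n. 0 < n \<bullet> vector_derivative h (at s) \<and> 0 < n \<bullet> vector_derivative c (at s)"
proof -
  define j where "j = \<lfloor>s\<rfloor>"
  have "s \<noteq> of_int j" using s[of j] in_window[of j] by auto
  then have sj: "of_int j < s" "s < of_int j + 1" unfolding j_def by linarith+
  have sQ: "Q j \<le> s" and sP: "s \<le> P (j + 1)"
    using s[of j] s[of "j + 1"] sj PQ[of j] PQ[of "j + 1"] by auto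
  have hs: "h s = c s" using outside s by blast
  note cd = noninteger(1)[OF sj]
  have cnz: "vector_derivative c (at s) \<noteq> 0"
    unfolding noninteger(2)[OF sj] using leg[of j] sj by (auto simp: legendrian_on_def)
  have eq: ?thesis if S: "at s within S \<noteq> bot" and "\<And>t. t \<in> S \<Longrightarrow> h t = c t" "s \<in> S" for S
  proof -
    have "(h has_vector_derivative vector_derivative c (at s)) (at s within S)"
      by (rule has_vector_derivative_transform[OF _ _ has_vector_derivative_at_within[OF cd]]) (use that in auto)
    then have "vector_derivative h (at s) = vector_derivative c (at s)"
      using vector_derivative_unique_within[OF S] has_vector_derivative_at_within[OF h_deriv] by blast
    then show ?thesis using cnz by (intro exI[of _ "vector_derivative c (at s)"]) auto
  qed
  have free: "h t = c t" if "Q j \<le> t" "t \<le> P (j + 1)" for t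
  proof (rule outside)
    fix i
    have "of_int j < t" "t < of_int j + 1" using that PQ[of j] PQ[of "j + 1"] by auto
    then show "t \<notin> {P i<..<Q i}" using window_unique[of t i j] that by auto
  qed
  consider "s < P (j + 1)" | "Q j < s" | "s = Q j" "s = P (j + 1)" using sQ sP by linarith
  then show ?thesis
  proof cases
    case 1
    show ?thesis
      by (rule eq[OF Icc_nontrivial[OF 1]]) (use free sQ 1 in auto)
  next
    case 2
    show ?thesis
      by (rule eq[OF Icc_nontrivial[OF 2]]) (use free sP 2 in auto)
  next
    case 3
    \<comment> \<open>By continuity \<open>c s\<close> lies in both closed balls, while the open
      balls are disjoint. The aim is to see that \<open>c s\<close> is the midpoint of the two
      centres, so that the common direction can be the line joining them.\<close>
    define o1 o2 where "o1 = c (of_int j)" and "o2 = c (of_int (j + 1))"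
    have in1: "h t \<in> ball o1 r" "c t \<in> ball o1 r" if "t \<in> {P j<..<s}" for t
      using inside[of t j] c_in_ball[of t j] that 3 by (auto simp: o1_def)
    have in2: "h t \<in> ball o2 r" "c t \<in> ball o2 r" if "t \<in> {s<..<Q (j + 1)}" for t
      using inside[of t "j + 1"] c_in_ball[of t "j + 1"] that 3 by (auto simp: o2_def)
    have Pjs: "P j < s" and sQj: "s < Q (j + 1)" using sj PQ[of j] PQ[of "j + 1"] by auto
    have ct: "(c \<longlongrightarrow> c s) (at s within S)" for S
      using cont by (metis UNIV_I continuous_on_def subset_UNIV tendsto_within_subset)
    have n1: "dist o1 (c s) \<le> r"
    proof (rule tendsto_upperbound[of "\<lambda>t. dist o1 (c t)" _ "at_left s"])
      show "\<forall>\<^sub>F t in at_left s. dist o1 (c t) \<le> r"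
        using in1(2) Pjs by (auto simp: eventually_at_left_field intro!: exI[of _ "P j"] less_imp_le)
    qed (auto intro!: tendsto_intros ct)
    have n2: "dist o2 (c s) \<le> r"
    proof (rule tendsto_upperbound[of "\<lambda>t. dist o2 (c t)" _ "at_right s"])
      show "\<forall>\<^sub>F t in at_right s. dist o2 (c t) \<le> r"
        using in2(2) sQj by (auto simp: eventually_at_right_field intro!: exI[of _ "Q (j + 1)"] less_imp_le)
    qed (auto intro!: tendsto_intros ct)
    have "\<not> int k dvd j - (j + 1)" using k by simp
    then have dj: "disjnt (ball o1 r) (ball o2 r)" unfolding o1_def o2_def by (rule separated)
    have far: "2 * r \<le> dist o1 o2"
    proof (rule ccontr)
      assume "\<not> 2 * r \<le> dist o1 o2"
      then have "midpoint o1 o2 \<in> ball o1 r" "midpoint o1 o2 \<in> ball o2 r" by (auto simp: dist_midpoint)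
      then show False using dj by (auto simp: disjnt_iff)
    qed
    define n where "n = c s - o1"
    define u where "u = o2 - c s"
    have nu: "norm n \<le> r" "norm u \<le> r" "2 * r \<le> norm (n + u)"
      using n1 n2 far by (auto simp: n_def u_def dist_norm norm_minus_commute)
    have sq: "(norm n)\<^sup>2 \<le> r\<^sup>2" "(norm u)\<^sup>2 \<le> r\<^sup>2" "(2 * r)\<^sup>2 \<le> (norm (n + u))\<^sup>2"
      using power_mono[OF nu(1), of 2] power_mono[OF nu(2), of 2] power_mono[OF nu(3), of 2] r by simp_all
    \<comment> \<open>The parallelogram law with \<open>norm n\<close> and \<open>norm u\<close> at
      most \<open>r\<close> and \<open>norm (n + u)\<close> at least \<open>2 * r\<close> forces
      \<open>n = u\<close> and \<open>norm n = r\<close>.\<close>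
    have par: "(norm (n - u))\<^sup>2 + (norm (n + u))\<^sup>2 = 2 * (norm n)\<^sup>2 + 2 * (norm u)\<^sup>2"
      by (simp add: power2_norm_eq_inner algebra_simps inner_commute)
    have sq3: "4 * r\<^sup>2 \<le> (norm (n + u))\<^sup>2" using sq(3) by (simp add: power_mult_distrib)
    have "(norm (n - u))\<^sup>2 \<le> 0" using sq(1,2) sq3 par by linarith
    then have un: "u = n" by simp
    have "norm (n + u) = 2 * norm n" using un by (simp add: scaleR_2[symmetric])
    then have nr: "(norm n)\<^sup>2 = r\<^sup>2" using sq(1) sq3 by (simp add: power_mult_distrib)
    define \<delta> where "\<delta> = min (s - P j) (Q (j + 1) - s)"
    have \<delta>: "0 < \<delta>" using Pjs sQj by (simp add: \<delta>_def)
    have o12: "o1 = c s - n" "o2 = c s + n" using un by (auto simp: n_def u_def)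
    have lft: "2 * ((g t - g s) \<bullet> n) \<le> - (norm (g t - g s))\<^sup>2"
      if "g t \<in> ball o1 r" "g s = c s" for g :: "real \<Rightarrow> real^3" and t
    proof -
      have "(norm ((g t - g s) + n))\<^sup>2 \<le> r\<^sup>2"
        using that r by (intro power_mono) (auto simp: o12 dist_norm norm_minus_commute algebra_simps)
      then show ?thesis using nr by (simp add: power2_norm_eq_inner algebra_simps inner_commute)
    qed
    have rgt: "(norm (g t - g s))\<^sup>2 \<le> 2 * ((g t - g s) \<bullet> n)"
      if "g t \<in> ball o2 r" "g s = c s" for g :: "real \<Rightarrow> real^3" and t
    proof -
      have "(norm ((g t - g s) - n))\<^sup>2 \<le> r\<^sup>2"
        using that r by (intro power_mono) (auto simp: o12 dist_norm norm_minus_commute algebra_simps)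
      then show ?thesis using nr by (simp add: power2_norm_eq_inner algebra_simps inner_commute)
    qed
    have "0 < vector_derivative h (at s) \<bullet> n"
    proof (rule touching_balls_transversal[OF \<delta> h_deriv])
      have "smooth_on UNIV (\<lambda>t. vector_derivative h (at t))" by (rule smooth_on_UNIV_D(2)[OF h_smooth])
      from smooth_on_UNIV_D(1)[OF this]
      show "((\<lambda>t. vector_derivative h (at t)) has_vector_derivative
        vector_derivative (\<lambda>t. vector_derivative h (at t)) (at s)) (at s)" .
      show "2 * ((h t - h s) \<bullet> n) \<le> - (norm (h t - h s))\<^sup>2" if "t \<in> {s - \<delta><..<s}" for t
        by (rule lft[of h, OF in1(1) hs]) (use that in \<open>auto simp: \<delta>_def\<close>)
      show "(norm (h t - h s))\<^sup>2 \<le> 2 * ((h t - h s) \<bullet> n)" if "t \<in> {s<..<s + \<delta>}" for t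
        by (rule rgt[of h, OF in2(1) hs]) (use that in \<open>auto simp: \<delta>_def\<close>)
    qed (rule h_nz)
    moreover have "0 < vector_derivative c (at s) \<bullet> n"
    proof -
      let ?U = "{real_of_int j<..<of_int j + 1}" and ?S = "{real_of_int j..of_int j + 1}"
      have nt: "at t within ?S \<noteq> bot" if "t \<in> ?S" for t by (rule Icc_nontrivial) (use that in auto)
      have "smooth_on ?S c" by (rule legendrian_on_D(1)[OF leg nt])
      then have "smooth_on ?S (\<lambda>t. vector_derivative c (at t within ?S))"
        by (rule smooth_on_vector_derivative[OF _ nt])
      then have "smooth_on ?U (\<lambda>t. vector_derivative c (at t within ?S))"
        by (rule smooth_on_subset) auto
      then have "smooth_on ?U (\<lambda>t. vector_derivative c (at t))"
        by (rule smooth_on_cong[THEN iffD1, rotated]) (use noninteger(2)[of j] in auto)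
      from smooth_on_has_vector_derivative[OF this, of s]
      have c2: "((\<lambda>t. vector_derivative c (at t)) has_vector_derivative
        vector_derivative (\<lambda>t. vector_derivative c (at t)) (at s within ?U)) (at s)"
        using at_within_open[of s ?U] sj by simp
      have \<delta>_le: "of_int j \<le> s - \<delta>'" "s + \<delta>' \<le> of_int j + 1" if "\<delta>' \<le> min (s - of_int j) (of_int j + 1 - s)" for \<delta>'
        using that by auto
      define \<delta>' where "\<delta>' = min \<delta> (min (s - of_int j) (of_int j + 1 - s))"
      have \<delta>': "0 < \<delta>'" "\<delta>' \<le> \<delta>" using \<delta> sj by (auto simp: \<delta>'_def)
      show ?thesis
      proof (rule touching_balls_transversal[OF \<delta>'(1) _ c2 cnz])
        show "(c has_vector_derivative vector_derivative c (at t)) (at t)" if "t \<in> {s - \<delta>'<..<s + \<delta>'}" for t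
          by (rule noninteger(1)[of j]) (use that in \<open>auto simp: \<delta>'_def\<close>)
        show "2 * ((c t - c s) \<bullet> n) \<le> - (norm (c t - c s))\<^sup>2" if "t \<in> {s - \<delta>'<..<s}" for t
          by (rule lft[of c, OF in1(2) refl]) (use that \<delta>'(2) in \<open>auto simp: \<delta>_def\<close>)
        show "(norm (c t - c s))\<^sup>2 \<le> 2 * ((c t - c s) \<bullet> n)" if "t \<in> {s<..<s + \<delta>'}" for t
          by (rule rgt[of c, OF in2(2) refl]) (use that \<delta>'(2) in \<open>auto simp: \<delta>_def\<close>)
      qed
    qed
    ultimately show ?thesis by (auto simp: inner_commute)
  qed
qed

text \<open>Outside the windows the direction from \<open>common_direction\<close> need not be
  horizontal. It only shows that the tangents of \<open>h\<close> and \<open>c\<close>, which lie in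
  one contact plane, are not opposite, and \<open>contact_half_plane\<close> then yields a
  horizontal \<open>b\<close>. Horizontality makes the vertical push-off invisible to
  \<open>b\<close>.\<close>

lemma local_mono:
  "\<exists>b \<delta>. b $ 3 = 0 \<and> 0 < \<delta> \<and>
     (\<forall>x y. s - \<delta> < x \<and> x < y \<and> y < s + \<delta> \<longrightarrow> b \<bullet> h x < b \<bullet> h y \<and> b \<bullet> c x < b \<bullet> c y)"
proof (cases "\<exists>j. s \<in> {P j<..<Q j}")
  case True
  then obtain j where j: "s \<in> {P j<..<Q j}" by blast
  define \<delta> where "\<delta> = min (s - P j) (Q j - s)"
  have "0 < \<delta>" using j by (simp add: \<delta>_def)
  moreover have "a j \<bullet> h x < a j \<bullet> h y \<and> a j \<bullet> c x < a j \<bullet> c y" if "s - \<delta> < x" "x < y" "y < s + \<delta>" for x y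
    using h_window_mono[of j x y] c_window_mono[of j x y] that by (auto simp: \<delta>_def)
  ultimately show ?thesis using a3 by (intro exI[of _ "a j"] exI[of _ \<delta>]) auto
next
  case False
  then have s: "\<And>j. s \<notin> {P j<..<Q j}" by blast
  define j where "j = \<lfloor>s\<rfloor>"
  have "s \<noteq> of_int j" using s[of j] in_window[of j] by auto
  then have sj: "of_int j < s" "s < of_int j + 1" unfolding j_def by linarith+
  obtain n where n: "0 < n \<bullet> vector_derivative h (at s)" "0 < n \<bullet> vector_derivative c (at s)"
    using common_direction[OF s] by blast
  have hs: "h s = c s" using outside s by blast
  have "vector_derivative c (at s) \<in> contact_plane (c s)"
    unfolding noninteger(2)[OF sj] using leg[of j] sj by (auto simp: legendrian_on_def)
  moreover have "vector_derivative h (at s) \<in> contact_plane (c s)" using h_contact[of s] hs by simp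
  moreover have "vector_derivative c (at s) \<noteq> 0" using n(2) by auto
  moreover have "sgn (vector_derivative h (at s)) \<noteq> - sgn (vector_derivative c (at s))"
  proof
    assume eq: "sgn (vector_derivative h (at s)) = - sgn (vector_derivative c (at s))"
    have "0 < n \<bullet> sgn (vector_derivative h (at s))" "0 < n \<bullet> sgn (vector_derivative c (at s))"
      using n h_nz[of s] calculation(3) by (simp_all add: sgn_div_norm)
    then show False unfolding eq by simp
  qed
  ultimately obtain b where b: "b $ 3 = 0" "0 < b \<bullet> vector_derivative h (at s)" "0 < b \<bullet> vector_derivative c (at s)"
    using contact_half_plane h_nz by blast
  let ?U = "{real_of_int j<..<of_int j + 1}"
  have U: "open ?U" "s \<in> ?U" using sj by auto
  have "continuous_on ?U (\<lambda>t. vector_derivative c (at t))"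
  proof -
    have "continuous_on {of_int j..of_int j + 1} (\<lambda>t. vector_derivative c (at t within {of_int j..of_int j + 1}))"
      by (rule legendrian_on_D(4)[OF leg Icc_nontrivial]) auto
    then have "continuous_on ?U (\<lambda>t. vector_derivative c (at t within {of_int j..of_int j + 1}))"
      by (rule continuous_on_subset) auto
    then show ?thesis
      by (rule continuous_on_cong[THEN iffD1, rotated -1]) (use noninteger(2)[of j] in auto)
  qed
  then have c': "isCont (\<lambda>t. b \<bullet> vector_derivative c (at t)) s"
    using U by (intro continuous_intros) (simp add: continuous_on_eq_continuous_at)
  have h': "isCont (\<lambda>t. b \<bullet> vector_derivative h (at t)) s"
    using smooth_on_continuous[OF smooth_on_UNIV_D(2)[OF h_smooth]]
    by (intro continuous_intros) (simp add: continuous_on_eq_continuous_at)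
  have "\<forall>\<^sub>F t in nhds s. t \<in> ?U \<and> 0 < b \<bullet> vector_derivative h (at t) \<and> 0 < b \<bullet> vector_derivative c (at t)"
    using order_tendstoD(1)[OF c'[unfolded continuous_at tendsto_at_iff_tendsto_nhds[symmetric]] b(3)]
      order_tendstoD(1)[OF h'[unfolded continuous_at tendsto_at_iff_tendsto_nhds[symmetric]] b(2)]
      b U eventually_nhds_in_open[OF U]
    by (intro eventually_conj) (simp_all add: eventually_nhds_conv_at)
  then obtain \<delta> where \<delta>: "0 < \<delta>" "\<And>t. dist t s < \<delta> \<Longrightarrow>
      t \<in> ?U \<and> 0 < b \<bullet> vector_derivative h (at t) \<and> 0 < b \<bullet> vector_derivative c (at t)"
    unfolding eventually_nhds_metric by blast
  have "b \<bullet> h x < b \<bullet> h y \<and> b \<bullet> c x < b \<bullet> c y" if xy: "s - \<delta> < x" "x < y" "y < s + \<delta>" for x y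
  proof -
    have t: "dist t s < \<delta>" if "t \<in> {x<..<y}" for t using that xy by (auto simp: dist_real_def)
    have "b \<bullet> h x < b \<bullet> h y"
      by (rule increasing_on_open[OF xy(2), of _ "\<lambda>t. vector_derivative h (at t)"])
        (use \<delta>(2) t h_deriv continuous_on_subset[OF h_cont] in auto)
    moreover have "b \<bullet> c x < b \<bullet> c y"
      by (rule increasing_on_open[OF xy(2), of _ "\<lambda>t. vector_derivative c (at t)"])
        (use \<delta>(2) t noninteger(1)[of j] continuous_on_subset[OF cont] in auto)
    ultimately show ?thesis ..
  qed
  then show ?thesis using b(1) \<delta>(1) by (intro exI[of _ b] exI[of _ \<delta>]) auto
qed

text \<open>Counterexamples with push-offs tending to 0 accumulate at a coincidence of one stage of
  the homotopy, which by \<open>H_inj\<close> is trivial up to a period. Near it, equal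
  \<open>b\<close>-components force equal parameters by \<open>local_mono\<close>, and then the
  push-off would have to be 0.\<close>

lemma pushoff_disjoint:
  "\<exists>e0>0. \<forall>e\<in>{0<..e0}. \<forall>l\<in>{0..1}. \<forall>s t. H l s \<noteq> H l t + e *\<^sub>R axis 3 1"
proof (rule ccontr)
  assume "\<not> ?thesis"
  then have neg: "\<exists>e l s t. e \<in> {0<..e0} \<and> l \<in> {0..1} \<and> H l s = H l t + e *\<^sub>R axis 3 1" if "0 < e0" for e0
    using that by blast
  have kp: "0 < real k" using k by simp
  have red: "\<exists>m::int. x + of_int m * real k \<in> {0..real k}" for x
  proof
    have "of_int \<lfloor>x / real k\<rfloor> * real k \<le> x" "x < (of_int \<lfloor>x / real k\<rfloor> + 1) * real k"
      using kp by (simp_all add: pos_le_divide_eq[symmetric] pos_divide_less_eq[symmetric])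
    then show "x + of_int (- \<lfloor>x / real k\<rfloor>) * real k \<in> {0..real k}" by (simp add: algebra_simps)
  qed
  have "\<exists>z. fst z \<in> {0<..1 / real (Suc n)} \<and> snd z \<in> {0..1} \<times> ({0..real k} \<times> {0..real k}) \<and>
    H (fst (snd z)) (fst (snd (snd z))) = H (fst (snd z)) (snd (snd (snd z))) + fst z *\<^sub>R axis 3 1" for n
  proof -
    obtain e l s t where *: "e \<in> {0<..1 / real (Suc n)}" "l \<in> {0..1}" "H l s = H l t + e *\<^sub>R axis 3 1"
      using neg[of "1 / real (Suc n)"] by auto
    obtain m m' :: int where "s + of_int m * real k \<in> {0..real k}" "t + of_int m' * real k \<in> {0..real k}"
      using red by blast
    then show ?thesis
      using * by (intro exI[of _ "(e, l, s + of_int m * real k, t + of_int m' * real k)"]) (simp add: H_per)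
  qed
  then obtain z where z: "\<And>n. fst (z n) \<in> {0<..1 / real (Suc n)}"
    "\<And>n. snd (z n) \<in> {0..1} \<times> ({0..real k} \<times> {0..real k})"
    "\<And>n. H (fst (snd (z n))) (fst (snd (snd (z n)))) = H (fst (snd (z n))) (snd (snd (snd (z n)))) + fst (z n) *\<^sub>R axis 3 1"
    by metis
  have "compact ({0..1::real} \<times> ({0..real k} \<times> {0..real k}))" by (intro compact_Times compact_Icc)
  then obtain w \<phi> where w: "w \<in> {0..1} \<times> ({0..real k} \<times> {0..real k})" "strict_mono \<phi>"
    "((\<lambda>n. snd (z n)) \<circ> \<phi>) \<longlonglongrightarrow> w"
    using z(2) unfolding compact_def by metis
  define e l s t where "e n = fst (z (\<phi> n))" and "l n = fst (snd (z (\<phi> n)))"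
    and "s n = fst (snd (snd (z (\<phi> n))))" and "t n = snd (snd (snd (z (\<phi> n))))" for n
  obtain l0 s0 t0 where w': "w = (l0, s0, t0)" by (cases w)
  have lims: "l \<longlonglongrightarrow> l0" "s \<longlonglongrightarrow> s0" "t \<longlonglongrightarrow> t0"
    using tendsto_fst[OF w(3)] tendsto_fst[OF tendsto_snd[OF w(3)]] tendsto_snd[OF tendsto_snd[OF w(3)]]
    by (simp_all add: w' o_def l_def[abs_def] s_def[abs_def] t_def[abs_def])
  have epos: "0 < e n" for n using z(1)[of "\<phi> n"] by (simp add: e_def)
  have e0: "e \<longlonglongrightarrow> 0"
  proof (rule tendsto_sandwich[OF _ _ tendsto_const])
    show "\<forall>\<^sub>F n in sequentially. e n \<le> 1 / real (Suc n)"
    proof (intro always_eventually allI)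
      fix n
      have "e n \<le> 1 / real (Suc (\<phi> n))" using z(1)[of "\<phi> n"] by (simp add: e_def)
      also have "\<dots> \<le> 1 / real (Suc n)" using seq_suble[OF w(2), of n] by (intro divide_left_mono) auto
      finally show "e n \<le> 1 / real (Suc n)" .
    qed
    show "(\<lambda>n. 1 / real (Suc n)) \<longlonglongrightarrow> 0" by (rule LIMSEQ_Suc[OF lim_1_over_n])
  qed (auto intro!: always_eventually less_imp_le epos)
  have ln: "l n \<in> {0..1}" for n using z(2)[of "\<phi> n"] by (auto simp: l_def mem_Times_iff)
  have eq: "H (l n) (s n) = H (l n) (t n) + e n *\<^sub>R axis 3 1" for n
    using z(3)[of "\<phi> n"] by (simp add: e_def l_def s_def t_def)
  have l0: "l0 \<in> {0..1}" using w(1) w' by auto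
  have hc: "(\<lambda>n. h (x n)) \<longlonglongrightarrow> h x0" "(\<lambda>n. c (x n)) \<longlonglongrightarrow> c x0" if "x \<longlonglongrightarrow> x0" for x x0
    using continuous_on_tendsto_compose[OF h_cont that] continuous_on_tendsto_compose[OF cont that] by auto
  have H1: "(\<lambda>n. H (l n) (s n)) \<longlonglongrightarrow> H l0 s0" unfolding H_def by (intro tendsto_intros lims hc)
  have "(\<lambda>n. H (l n) (t n) + e n *\<^sub>R axis 3 1) \<longlonglongrightarrow> H l0 t0 + 0 *\<^sub>R axis 3 1"
    unfolding H_def by (intro tendsto_intros lims hc e0)
  then have "(\<lambda>n. H (l n) (s n)) \<longlonglongrightarrow> H l0 t0" by (simp only: eq scaleR_zero_left add_0_right)
  with H1 have "H l0 s0 = H l0 t0" by (rule LIMSEQ_unique)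
  then obtain m :: int where m: "s0 = t0 + of_int m * real k" using H_inj l0 by blast
  obtain b \<delta> where b: "b $ 3 = 0" "0 < \<delta>"
    "\<And>x y. s0 - \<delta> < x \<Longrightarrow> x < y \<Longrightarrow> y < s0 + \<delta> \<Longrightarrow> b \<bullet> h x < b \<bullet> h y \<and> b \<bullet> c x < b \<bullet> c y"
    using local_mono[of s0] by blast
  define t' where "t' n = t n + of_int m * real k" for n
  have t': "t' \<longlonglongrightarrow> s0" unfolding t'_def m by (intro tendsto_intros lims)
  have "\<forall>\<^sub>F n in sequentially. dist (s n) s0 < \<delta> \<and> dist (t' n) s0 < \<delta>"
    using tendstoD[OF lims(2) b(2)] tendstoD[OF t' b(2)] by (rule eventually_conj)
  then obtain n where n: "dist (s n) s0 < \<delta>" "dist (t' n) s0 < \<delta>"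
    using eventually_happens'[OF sequentially_bot] by blast
  have eq': "H (l n) (s n) = H (l n) (t' n) + e n *\<^sub>R axis 3 1" using eq[of n] by (simp add: t'_def H_per)
  have "b \<bullet> axis 3 1 = 0" using b(1) by (simp add: inner_axis)
  then have "b \<bullet> H (l n) (s n) = b \<bullet> H (l n) (t' n)" unfolding eq' by (simp add: inner_add_right)
  moreover have lt: "b \<bullet> H (l n) x < b \<bullet> H (l n) y" if "s0 - \<delta> < x" "x < y" "y < s0 + \<delta>" for x y
    using H_mono b(3)[OF that] ln by blast
  moreover have "s0 - \<delta> < s n" "s n < s0 + \<delta>" "s0 - \<delta> < t' n" "t' n < s0 + \<delta>"
    using n unfolding dist_real_def by linarith+
  ultimately have "s n = t' n"
    using lt[of "s n" "t' n"] lt[of "t' n" "s n"] by linarith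
  then have "e n *\<^sub>R axis 3 1 = (0 :: real^3)" using eq' by simp
  then show False using epos[of n] by (simp add: axis_eq_0_iff)
qed

section \<open>Replacing the rounded curve by the polygon in the Gauss integral\<close>

definition gauss_sum :: "real \<Rightarrow> real" where
  "gauss_sum e = 1 / (4 * pi) * (\<Sum>i<k. \<Sum>j<k.
     gauss_integral (\<lambda>s. c (real i + s)) (\<lambda>t. c (real j + t) + e *\<^sub>R axis 3 1))"

lemma pieces:
  assumes "f \<in> {h, c}"
  shows "cdiff (Suc 0) {0..1} (\<lambda>t. f (real i + t))" "i < k \<Longrightarrow> f (real i + 1) = f (real (Suc i mod k) + 0)"
proof -
  have "smooth_on {0..1} (\<lambda>t. c (real i + t))"
    using legendrian_on_D(1)[OF leg_right[of "int i"] unit_interval_nontrivial] by simp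
  moreover have "smooth_on {0..1} (\<lambda>t. h (real i + t))"
    by (intro smooth_on_compose[OF h_smooth] smooth_intros) simp
  ultimately show "cdiff (Suc 0) {0..1} (\<lambda>t. f (real i + t))" using assms unfolding smooth_on_def by blast
  assume i: "i < k"
  show "f (real i + 1) = f (real (Suc i mod k) + 0)"
  proof (cases "Suc i = k")
    case True
    then have "real i + 1 = 0 + real k" by auto
    then show ?thesis using assms periodic[of 0] h_periodic[of 0] True by (auto simp: add.commute)
  next
    case False
    then show ?thesis using i by (simp add: add.commute)
  qed
qed

text \<open>One homotopy moves \<open>h\<close> to \<open>c\<close> at a fixed push-off, another
  changes the push-off of \<open>c\<close>. The result is stated for all small \<open>e\<close>, so
  that finitely many cycles can later share the same push-off.\<close>

lemma tb_eq_gauss_sum: "\<forall>\<^sub>F e in at_right 0. tb (real k) h = gauss_sum e"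
proof -
  let ?z = "axis 3 1 :: real^3"
  obtain e0 where e0: "0 < e0" "\<And>e l s t. e \<in> {0<..e0} \<Longrightarrow> l \<in> {0..1} \<Longrightarrow> H l s \<noteq> H l t + e *\<^sub>R ?z"
    using pushoff_disjoint by blast
  have cz: "cdiff (Suc 0) {0..1} (\<lambda>t. f (real i + t) + e *\<^sub>R ?z)" if "f \<in> {h, c}" for f i e
    by (intro cdiff_add cdiff_const pieces(1) that)
  have lk: "linking_number (real k) h (\<lambda>t. h t + e *\<^sub>R ?z) = gauss_sum e" if e: "e \<in> {0<..e0}" for e
  proof -
    have "linking_number (real k) h (\<lambda>t. h t + e *\<^sub>R ?z) = 1 / (4 * pi) * (\<Sum>i<k. \<Sum>j<k.
        gauss_integral (\<lambda>s. h (real i + s)) (\<lambda>t. h (real j + t) + e *\<^sub>R ?z))"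
    proof (rule linking_number_pieces[OF h_deriv _ _ _])
      show "continuous_on UNIV (\<lambda>t. vector_derivative h (at t))"
        by (rule smooth_on_continuous[OF smooth_on_UNIV_D(2)[OF h_smooth]])
      then show "continuous_on UNIV (\<lambda>t. vector_derivative h (at t))" .
      show "((\<lambda>t. h t + e *\<^sub>R ?z) has_vector_derivative vector_derivative h (at t)) (at t)" for t
        using has_vector_derivative_add_const h_deriv by blast
      show "h s \<noteq> h t + e *\<^sub>R ?z" for s t using e0(2)[OF e, of 0 s t] by (simp add: H_def)
    qed
    also have "(\<Sum>i<k. \<Sum>j<k. gauss_integral (\<lambda>s. h (real i + s)) (\<lambda>t. h (real j + t) + e *\<^sub>R ?z)) =
      (\<Sum>i<k. \<Sum>j<k. gauss_integral (\<lambda>s. c (real i + s) + (h (real i + s) - c (real i + s)))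
        (\<lambda>t. (c (real j + t) + e *\<^sub>R ?z) + (h (real j + t) - c (real j + t))))"
      by (simp add: algebra_simps)
    also have "\<dots> = (\<Sum>i<k. \<Sum>j<k. gauss_integral (\<lambda>s. c (real i + s)) (\<lambda>t. c (real j + t) + e *\<^sub>R ?z))"
    proof (rule gauss_sum_homotopy)
      have "cdiff (Suc 0) {0..1} (\<lambda>s. h (real i + s) + - 1 *\<^sub>R c (real i + s))" for i
        by (intro cdiff_add cdiff_linear[OF bounded_linear_scaleR_right] pieces(1)) auto
      then show "cdiff (Suc 0) {0..1} (\<lambda>s. h (real i + s) - c (real i + s))"
        "cdiff (Suc 0) {0..1} (\<lambda>s. h (real i + s) - c (real i + s))" for i by auto
      show "c (real i + s) + l *\<^sub>R (h (real i + s) - c (real i + s)) \<noteq>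
          c (real j + t) + e *\<^sub>R ?z + l *\<^sub>R (h (real j + t) - c (real j + t))"
        if "l \<in> {0..1}" for i j l s t
        using e0(2)[OF e, of "1 - l" "real i + s" "real j + t"] that by (simp add: H_def algebra_simps)
    qed (simp_all del: cdiff.simps add: pieces(1) pieces(2)[of h, simplified] pieces(2)[of c, simplified] cz)
    finally show ?thesis by (simp add: gauss_sum_def)
  qed
  \<comment> \<open>The sum must not depend on the push-off, for otherwise the description in
    \<open>tb\<close> would have no eventual value to return. Here the homotopy is the vertical
    shift from \<open>e\<close> to \<open>e0\<close> at the polygon stage
    \<open>l = 1\<close>.\<close>
  have const: "gauss_sum e = gauss_sum e0" if e: "e \<in> {0<..e0}" for e
  proof -
    have "(\<Sum>i<k. \<Sum>j<k. gauss_integral (\<lambda>s. c (real i + s) + 0) (\<lambda>t. (c (real j + t) + e *\<^sub>R ?z) + (e0 - e) *\<^sub>R ?z)) =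
      (\<Sum>i<k. \<Sum>j<k. gauss_integral (\<lambda>s. c (real i + s)) (\<lambda>t. c (real j + t) + e *\<^sub>R ?z))"
    proof (rule gauss_sum_homotopy)
      show "c (real i + s) + l *\<^sub>R 0 \<noteq> c (real j + t) + e *\<^sub>R ?z + l *\<^sub>R ((e0 - e) *\<^sub>R ?z)"
        if l: "l \<in> {0..1}" for i j l s t
      proof -
        have "l * (e0 - e) \<le> 1 * (e0 - e)" "0 \<le> l * (e0 - e)" using l e mult_right_mono[of l 1 "e0 - e"] by auto
        then have "e + l * (e0 - e) \<in> {0<..e0}" using e by auto
        from e0(2)[OF this, of 1 "real i + s" "real j + t"] show ?thesis
          by (simp add: H_def scaleR_left_distrib add.assoc)
      qed
    qed (simp_all del: cdiff.simps add: pieces(1) pieces(2)[of c, simplified] cz cdiff_const)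
    then show ?thesis by (simp add: gauss_sum_def scaleR_left_distrib[symmetric] add.assoc)
  qed
  have ev: "\<forall>\<^sub>F e in at_right 0. e \<in> {0<..e0}"
    using e0(1) by (auto simp: eventually_at_right_field intro!: exI[of _ e0])
  have lk0: "linking_number (real k) h (\<lambda>t. h t + e *\<^sub>R ?z) = gauss_sum e0" if "e \<in> {0<..e0}" for e
    using lk[OF that] const[OF that] by (rule trans)
  have tb0: "tb (real k) h = gauss_sum e0"
    unfolding tb_def
  proof (rule the_equality)
    show "\<forall>\<^sub>F e in at_right 0. linking_number (real k) h (\<lambda>t. h t + e *\<^sub>R ?z) = gauss_sum e0"
      using ev by (rule eventually_mono) (rule lk0)
    fix x assume "\<forall>\<^sub>F e in at_right 0. linking_number (real k) h (\<lambda>t. h t + e *\<^sub>R ?z) = x"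
    from eventually_conj[OF this ev] obtain e where "e \<in> {0<..e0}"
      "linking_number (real k) h (\<lambda>t. h t + e *\<^sub>R ?z) = x"
      using eventually_happens'[OF trivial_limit_at_right_real] by blast
    then show "x = gauss_sum e0" using lk0[of e] by (metis trans)
  qed
  show ?thesis
    using ev by (rule eventually_mono) (rule trans[OF tb0 const[symmetric]])
qed

end

subsection \<open>Polygons in the geometric realisation\<close>

lemma in_realization:
  "x \<in> realization E \<longleftrightarrow> (\<exists>v w u. {v, w} \<in> E \<and> u \<in> {0..1} \<and> x = linepath (axis v 1) (axis w 1) u)"
proof -
  have "x \<in> closed_segment a b \<longleftrightarrow> (\<exists>u. u \<in> {0..1} \<and> x = linepath a b u)" for a b :: "real ^ 'a"
    by (auto simp: closed_segment_def linepath_def)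
  then show ?thesis by (auto simp: realization_def)
qed

lemma linepath_axis_nth:
  "linepath (axis v 1) (axis w 1) u $ z = (if z = v then 1 - u else 0) + (if z = w then u else (0::real))"
  by (auto simp: linepath_def axis_def)

lemma linepath_swap: "linepath b a u = linepath a b (1 - u)"
  by (simp add: linepath_def)

definition polygon :: "'v::finite list \<Rightarrow> real \<Rightarrow> real ^ 'v" where
  "polygon vs t =
     (let k = length vs; i = nat (\<lfloor>t\<rfloor> mod int k)
      in linepath (axis (vs ! i) 1) (axis (vs ! ((i + 1) mod k)) 1) (frac t))"

lemma cycle_curve_polygon: "cycle_curve f vs t = f (polygon vs t)"
  by (simp add: cycle_curve_def polygon_def edge_curve_def Let_def)

text \<open>Three vertices are required because \<open>traverses\<close> also accepts shorter lists,
  such as one edge run to and fro. With three, indices differing by 1 or 2 name different vertices,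
  on which injectivity and the edge count rest.\<close>

locale cyclic_list =
  fixes vs :: "'v::finite list"
  assumes distinct: "distinct vs" and length: "3 \<le> length vs"
begin

definition v where "v j = vs ! nat (j mod int (length vs))"

lemma kp: "0 < int (length vs)" using length by linarith

lemma v_eq_iff: "v i = v j \<longleftrightarrow> i mod int (length vs) = j mod int (length vs)"
  using kp by (simp add: v_def nth_eq_iff_index_eq[OF distinct] nat_less_iff eq_nat_nat_iff)

lemma v_nat: "i < length vs \<Longrightarrow> v (int i) = vs ! i"
  by (simp add: v_def)

lemma v_Suc_nat: "v (int i + 1) = vs ! ((i + 1) mod length vs)"
proof -
  have "(int i + 1) mod int (length vs) = int ((i + 1) mod length vs)" by (simp add: zmod_int add.commute)
  then show ?thesis by (simp add: v_def)
qed

lemma next_index: "(nat (j mod int (length vs)) + 1) mod length vs = nat ((j + 1) mod int (length vs))"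
proof -
  have "int ((nat (j mod int (length vs)) + 1) mod length vs) = (j mod int (length vs) + 1) mod int (length vs)"
    using kp by (simp add: zmod_int add.commute)
  also have "\<dots> = (j + 1) mod int (length vs)" by (simp add: mod_add_left_eq)
  finally show ?thesis by linarith
qed

lemma small_shift: "\<bar>d\<bar> < 3 \<Longrightarrow> d \<noteq> 0 \<Longrightarrow> v (i + d) \<noteq> v i"
proof
  assume d: "\<bar>d\<bar> < 3" "d \<noteq> 0" "v (i + d) = v i"
  then have "int (length vs) dvd d" by (simp add: v_eq_iff mod_eq_dvd_iff)
  then have "\<bar>int (length vs)\<bar> \<le> \<bar>d\<bar>" using d(2) dvd_imp_le_int by blast
  then show False using d length by linarith
qed

lemma v_Suc_neq: "v (i + 1) \<noteq> v i" "v i \<noteq> v (i + 1)" "v (i - 1) \<noteq> v (i + 1)"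
  using small_shift[of 1 i] small_shift[of 2 "i - 1"] by (auto simp: algebra_simps)

lemma polygon_piece:
  assumes "\<tau> \<in> {0..1}"
  shows "polygon vs (of_int j + \<tau>) = linepath (axis (v j) 1) (axis (v (j + 1)) 1) \<tau>"
proof (cases "\<tau> = 1")
  case True
  then have "\<lfloor>of_int j + \<tau>\<rfloor> = j + 1" "frac (of_int j + \<tau>) = 0" by (simp_all add: frac_def)
  then show ?thesis using True by (simp add: polygon_def Let_def v_def linepath_def)
next
  case False
  then have "\<lfloor>of_int j + \<tau>\<rfloor> = j" "frac (of_int j + \<tau>) = \<tau>" using assms by (auto simp: frac_def floor_eq_iff)
  then show ?thesis by (simp add: polygon_def Let_def v_def next_index[simplified])
qed

lemma polygon_periodic: "polygon vs (t + real (length vs)) = polygon vs t"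
proof -
  have "\<lfloor>t + real (length vs)\<rfloor> = \<lfloor>t\<rfloor> + int (length vs)" by linarith
  moreover have "frac (t + real (length vs)) = frac t" by (simp add: frac_def calculation)
  ultimately show ?thesis by (simp add: polygon_def Let_def)
qed

lemma polygon_floor: "polygon vs t = linepath (axis (v \<lfloor>t\<rfloor>) 1) (axis (v (\<lfloor>t\<rfloor> + 1)) 1) (frac t)"
  using polygon_piece[of "frac t" "\<lfloor>t\<rfloor>"] frac_ge_0[of t] frac_lt_1[of t] by (simp add: frac_def)

lemma polygon_inj: "inj_on (polygon vs) {0..<real (length vs)}"
proof (rule inj_onI)
  fix s t assume st: "s \<in> {0..<real (length vs)}" "t \<in> {0..<real (length vs)}" "polygon vs s = polygon vs t"
  define i j where "i = \<lfloor>s\<rfloor>" and "j = \<lfloor>t\<rfloor>"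
  have fr: "0 \<le> frac s" "frac s < 1" "0 \<le> frac t" "frac t < 1" by (simp_all add: frac_lt_1)
  have eq: "(if z = v i then 1 - frac s else 0) + (if z = v (i + 1) then frac s else 0) =
     (if z = v j then 1 - frac t else 0) + (if z = v (j + 1) then frac t else 0)" for z
    using arg_cong[where f = "\<lambda>x. x $ z", OF st(3)[unfolded polygon_floor]]
    by (simp only: linepath_axis_nth i_def j_def)
  have range: "i \<in> {0..<int (length vs)}" "j \<in> {0..<int (length vs)}"
    using st(1,2) by (auto simp: i_def j_def floor_less_iff)
  \<comment> \<open>The coordinate of the first point at \<open>v i\<close> is
    \<open>1 - frac s\<close>, which is positive, so \<open>v i\<close> must be an end of the second
    edge. Opposite traversal of the same edge would identify \<open>v (j + 2)\<close> with
    \<open>v j\<close>.\<close>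
  consider "v i = v j" | "v i \<noteq> v j" "v i = v (j + 1)" | "v i \<noteq> v j" "v i \<noteq> v (j + 1)" by blast
  then show "s = t"
  proof cases
    case 1
    then have "i = j" using range by (simp add: v_eq_iff)
    moreover have "frac s = frac t" using eq[of "v i"] 1 v_Suc_neq[of i] v_Suc_neq[of j] by simp
    ultimately show ?thesis unfolding i_def j_def frac_def by linarith
  next
    case 2
    have "v j = v i \<or> v j = v (i + 1)"
      using eq[of "v j"] v_Suc_neq[of j] fr by (auto split: if_splits)
    moreover have "v j \<noteq> v (i + 1)"
    proof
      assume "v j = v (i + 1)"
      then have "i mod int (length vs) = (j + 1) mod int (length vs)" "j mod int (length vs) = (i + 1) mod int (length vs)"
        using 2(2) by (simp_all add: v_eq_iff)
      then have "j mod int (length vs) = (j + 1 + 1) mod int (length vs)" by (metis mod_add_left_eq)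
      then have "v (j + 2) = v j" by (simp add: v_eq_iff add.commute)
      then show False using small_shift[of 2 j] by simp
    qed
    ultimately show ?thesis using 2 by simp
  next
    case 3
    then show ?thesis using eq[of "v i"] v_Suc_neq[of i] fr by simp
  qed
qed

lemma edges_image:
  assumes "traverses vs C"
  shows "C = (\<lambda>i. {v (int i), v (int i + 1)}) ` {..<length vs}"
proof -
  have "C = (\<lambda>i. {vs ! i, vs ! ((i + 1) mod length vs)}) ` {..<length vs}"
    using assms unfolding traverses_def by auto
  also have "\<dots> = (\<lambda>i. {v (int i), v (int i + 1)}) ` {..<length vs}"
    by (rule image_cong) (simp_all only: lessThan_iff v_nat v_Suc_nat)
  finally show ?thesis .
qed

lemma edge_in:
  assumes "traverses vs C"
  shows "{v j, v (j + 1)} \<in> C"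
proof -
  define i where "i = nat (j mod int (length vs))"
  have i: "i < length vs" using kp by (simp add: i_def nat_less_iff)
  have "v (int i) = v j" "v (int i + 1) = v (j + 1)"
    using kp by (simp_all add: v_eq_iff i_def mod_add_left_eq)
  then show ?thesis using edges_image[OF assms] i by (metis (no_types, lifting) imageI lessThan_iff)
qed

lemma polygon_image:
  assumes C: "traverses vs C"
  shows "polygon vs ` {0..real (length vs)} = realization C" "polygon vs t \<in> realization C"
proof -
  note edge = edge_in[OF C]
  have in_R: "polygon vs t \<in> realization C" for t
  proof -
    have "frac t \<in> {0..1}" using frac_lt_1[of t] by (simp add: less_imp_le)
    then show ?thesis unfolding in_realization polygon_floor using edge[of "\<lfloor>t\<rfloor>"] by blast
  qed
  then show "polygon vs t \<in> realization C" .
  show "polygon vs ` {0..real (length vs)} = realization C"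
  proof
    show "polygon vs ` {0..real (length vs)} \<subseteq> realization C" using in_R by blast
    show "realization C \<subseteq> polygon vs ` {0..real (length vs)}"
    proof
      fix x assume "x \<in> realization C"
      then obtain a b u where ab: "{a, b} \<in> C" "u \<in> {0..1}" "x = linepath (axis a 1) (axis b 1) u"
        unfolding in_realization by blast
      then obtain i where i: "i < length vs" "{a, b} = {v (int i), v (int i + 1)}" using edges_image[OF C] ab(1) by blast
      have r: "of_int (int i) + u \<in> {0..real (length vs)}" if "u \<in> {0..1}" for u :: real
        using that i(1) by auto
      consider "a = v (int i)" "b = v (int i + 1)" | "b = v (int i)" "a = v (int i + 1)"
        using i(2) by (auto simp: doubleton_eq_iff)
      then show "x \<in> polygon vs ` {0..real (length vs)}"
      proof cases
        case 1
        then have "x = polygon vs (of_int (int i) + u)" using polygon_piece[OF ab(2), of "int i"] by (simp only: 1 ab(3))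
        then show ?thesis using r[OF ab(2)] by blast
      next
        case 2
        have u: "1 - u \<in> {0..1}" using ab(2) by simp
        have "x = polygon vs (of_int (int i) + (1 - u))"
          unfolding polygon_piece[OF u] using 2 ab(3) linepath_swap[of "axis a 1" "axis b 1" u] by simp
        then show ?thesis using r[OF u] by blast
      qed
    qed
  qed
qed

lemma card_edges:
  assumes "traverses vs C"
  shows "card C = length vs"
proof -
  note edges_image[OF assms]
  moreover have "inj_on (\<lambda>i. {v (int i), v (int i + 1)}) {..<length vs}"
  proof (rule inj_onI)
    fix i j assume ij: "i \<in> {..<length vs}" "j \<in> {..<length vs}"
      "{v (int i), v (int i + 1)} = {v (int j), v (int j + 1)}"
    then consider "v (int i) = v (int j)" | "v (int i) = v (int j + 1)" "v (int i + 1) = v (int j)"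
      by (auto simp: doubleton_eq_iff)
    then show "i = j"
    proof cases
      case 1
      then show ?thesis using ij by (simp add: v_eq_iff)
    next
      case 2
      then have "int i mod int (length vs) = (int j + 1) mod int (length vs)"
        "(int i + 1) mod int (length vs) = int j mod int (length vs)" by (simp_all add: v_eq_iff)
      then have "(int j + 1 + 1) mod int (length vs) = int j mod int (length vs)" by (metis mod_add_left_eq)
      then have "v (int j + 2) = v (int j)" by (simp add: v_eq_iff add.commute)
      then show ?thesis using small_shift[of 2 "int j"] by simp
    qed
  qed
  ultimately show ?thesis by (simp add: card_image)
qed

lemma polygon_continuous: "continuous_on UNIV (polygon vs)"
proof -
  have cs: "continuous_on {of_int j..of_int j + 1} (polygon vs)" for j
  proof -
    have "polygon vs t = linepath (axis (v j) 1) (axis (v (j + 1)) 1) (t - of_int j)"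
      if "t \<in> {of_int j..of_int j + 1}" for t
      using polygon_piece[of "t - of_int j" j] that by simp
    then show ?thesis
      by (rule continuous_on_cong[THEN iffD2, OF refl])
        (auto simp: linepath_def intro!: continuous_intros)
  qed
  have "isCont (polygon vs) t" for t
  proof -
    define j where "j = \<lfloor>t\<rfloor>"
    have "continuous_on ({of_int (j - 1)..of_int (j - 1) + 1} \<union> {of_int j..of_int j + 1}) (polygon vs)"
      by (intro continuous_on_closed_Un cs closed_atLeastAtMost)
    moreover have "{of_int (j - 1)..of_int (j - 1) + 1} \<union> {of_int j..of_int j + 1} = {of_int j - 1..of_int j + (1::real)}"
      by auto
    ultimately have "continuous_on {of_int j - 1..of_int j + 1} (polygon vs)" by simp
    then have "continuous_on {of_int j - 1<..<of_int j + 1} (polygon vs)" by (rule continuous_on_subset) auto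
    moreover have "t \<in> {of_int j - 1<..<of_int j + 1}" by (auto simp: j_def) linarith+
    ultimately show ?thesis by (simp add: continuous_on_eq_continuous_at)
  qed
  then show ?thesis by (simp add: continuous_at_imp_continuous_on)
qed

lemma realization_circle:
  assumes "traverses vs C"
  shows "realization C homeomorphic sphere (0::complex) 1"
proof -
  define k where "k = real (length vs)"
  have k: "0 < k" using kp by (simp add: k_def)
  define \<gamma> where "\<gamma> x = polygon vs (x * k)" for x
  have p0: "polygon vs k = polygon vs 0" using polygon_periodic[of 0] by (simp add: k_def)
  have "path \<gamma>" unfolding path_def \<gamma>_def
    by (intro continuous_on_compose2[OF polygon_continuous] continuous_intros) auto
  moreover have "loop_free \<gamma>"
    unfolding loop_free_def
  proof (intro ballI impI)
    fix x y :: real assume xy: "x \<in> {0..1}" "y \<in> {0..1}" "\<gamma> x = \<gamma> y"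
    have r: "z * k \<in> {0..<k}" if "z \<in> {0..1}" "z \<noteq> 1" for z
      using that k by (auto simp: mult_less_cancel_right2)
    have 1: "x = y" if "x \<noteq> 1" "y \<noteq> 1"
      using inj_onD[OF polygon_inj, of "x * k" "y * k"] xy r that k by (auto simp: \<gamma>_def k_def)
    have 2: "z = 0" if "\<gamma> z = \<gamma> 1" "z \<in> {0..1}" "z \<noteq> 1" for z
      using inj_onD[OF polygon_inj, of "z * k" 0] that r[OF that(2,3)] p0 k by (auto simp: \<gamma>_def k_def)
    show "x = y \<or> x = 0 \<and> y = 1 \<or> x = 1 \<and> y = 0"
      using 1 2[of x] 2[of y] xy by metis
  qed
  moreover have "pathfinish \<gamma> = pathstart \<gamma>"
    using p0 by (simp add: pathfinish_def pathstart_def \<gamma>_def)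
  ultimately have "path_image \<gamma> homeomorphic sphere (0::complex) 1"
    by (intro homeomorphic_simple_path_image_circle) (auto simp: simple_path_def)
  moreover have "path_image \<gamma> = realization C"
  proof -
    have "(\<lambda>x. x * k) ` {0..1} = {0..k}"
      using k by (simp add: image_mult_atLeastAtMost mult.commute[of _ k])
    moreover have "path_image \<gamma> = polygon vs ` ((\<lambda>x. x * k) ` {0..1})"
      by (simp only: path_image_def image_image \<gamma>_def[abs_def])
    ultimately show ?thesis using polygon_image(1)[OF assms] by (simp only: k_def)
  qed
  ultimately show ?thesis by simp
qed

end

lemma legendrian_on_cong:
  assumes eq: "\<And>t. t \<in> S \<Longrightarrow> g t = h t" and S: "\<And>t. t \<in> S \<Longrightarrow> at t within S \<noteq> bot"
  shows "legendrian_on S g \<longleftrightarrow> legendrian_on S h"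
    and "t \<in> S \<Longrightarrow> vector_derivative g (at t within S) = vector_derivative h (at t within S)"
proof -
  show vd: "vector_derivative g (at t within S) = vector_derivative h (at t within S)" if "t \<in> S" for t
  proof -
    have "(g has_vector_derivative d) (at t within S) \<longleftrightarrow> (h has_vector_derivative d) (at t within S)" for d
      using that eq has_vector_derivative_transform[of t S] by metis
    then show ?thesis by (simp add: vector_derivative_def)
  qed
  show "legendrian_on S g \<longleftrightarrow> legendrian_on S h"
    using vd eq smooth_on_cong[OF eq] smooth_on_curve[OF S] unfolding legendrian_on_def by auto
qed

context cyclic_list
begin

text \<open>The incoming tangent at a vertex is minus the outgoing tangent along the reversed edge.
  Hence the absence of cusps is exactly the distinctness of the outgoing directions towards the two
  neighbours, which are different vertices.\<close>

lemma legendrian_polygon_cycle_curve: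
  assumes f: "legendrian_embedding E f" and C: "traverses vs C" "C \<subseteq> E"
  shows "legendrian_polygon (length vs) (cycle_curve f vs)"
proof
  let ?c = "cycle_curve f vs"
  have edge: "{v j, v (j + 1)} \<in> E" for j
  proof -
    have "{v j, v (j + 1)} \<in> C" by (rule edge_in[OF C(1)])
    then show ?thesis using C(2) by blast
  qed
  have piece: "?c (of_int j + \<tau>) = edge_curve f (v j) (v (j + 1)) \<tau>" if "\<tau> \<in> {0..1}" for j \<tau>
    using polygon_piece[OF that] by (simp add: cycle_curve_polygon edge_curve_def)
  have leg: "legendrian_on {0..1} (edge_curve f (v j) (v (j + 1)))" for j
    using f edge by (simp add: legendrian_embedding_def)
  have nt: "at t within {of_int j..of_int j + 1} \<noteq> bot" if "t \<in> {of_int j..of_int j + (1::real)}" for j :: int and t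
    by (rule Icc_nontrivial[OF _ that]) simp
  define g where "g j t = edge_curve f (v j) (v (j + 1)) (- of_int j + t)" for j t
  have cg: "?c t = g j t" if "t \<in> {of_int j..of_int j + 1}" for j t
    using piece[of "- of_int j + t" j] that by (simp add: g_def)
  have gl: "legendrian_on {of_int j..of_int j + 1} (g j)"
    "t \<in> {of_int j..of_int j + 1} \<Longrightarrow> vector_derivative (g j) (at t within {of_int j..of_int j + 1}) =
       piece_deriv (edge_curve f (v j) (v (j + 1))) (- of_int j + t)" for j t
    unfolding g_def using legendrian_on_shift[of "- of_int j" "of_int j" "of_int j + 1" "edge_curve f (v j) (v (j + 1))"] leg
    by simp_all
  have vd: "vector_derivative ?c (at t within {of_int j..of_int j + 1}) =
      piece_deriv (edge_curve f (v j) (v (j + 1))) (- of_int j + t)" if "t \<in> {of_int j..of_int j + 1}" for j t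
    using legendrian_on_cong(2)[OF cg nt that] gl(2)[OF that] by simp
  show "3 \<le> length vs" by (rule length)
  show "?c (t + real (length vs)) = ?c t" for t by (simp add: cycle_curve_polygon polygon_periodic)
  show "inj_on ?c {0..<real (length vs)}"
  proof (rule inj_onI)
    have inj_f: "inj_on f (realization E)"
      using f unfolding legendrian_embedding_def embedding_map_def homeomorphic_eq_everything_map by simp
    have "realization C \<subseteq> realization E" using C(2) unfolding subset_iff in_realization by blast
    fix s t assume st: "s \<in> {0..<real (length vs)}" "t \<in> {0..<real (length vs)}" "?c s = ?c t"
    then have "polygon vs s = polygon vs t"
      using inj_onD[OF inj_f, of "polygon vs s" "polygon vs t"] polygon_image(2)[OF C(1)]
        \<open>realization C \<subseteq> realization E\<close> by (auto simp: cycle_curve_polygon)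
    then show "s = t" using inj_onD[OF polygon_inj] st by blast
  qed
  show "legendrian_on {of_int j..of_int j + 1} ?c" for j
    using legendrian_on_cong(1)[OF cg nt] gl(1) by simp
  show "sgn (vector_derivative ?c (at (of_int j) within {of_int j - 1..of_int j})) \<noteq>
      - sgn (vector_derivative ?c (at (of_int j) within {of_int j..of_int j + 1}))" for j
  proof -
    have R: "vector_derivative ?c (at (of_int j) within {of_int j..of_int j + 1}) =
        piece_deriv (edge_curve f (v j) (v (j + 1))) 0" using vd[of "of_int j" j] by simp
    have L0: "vector_derivative ?c (at (of_int j) within {of_int j - 1..of_int j}) =
        piece_deriv (edge_curve f (v (j - 1)) (v j)) 1" using vd[of "of_int j" "j - 1"] by simp
    have rev: "edge_curve f (v (j - 1)) (v j) = (\<lambda>s. edge_curve f (v j) (v (j - 1)) (1 - s))"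
      by (auto simp: edge_curve_def linepath_swap[of "axis (v j) 1" "axis (v (j - 1)) 1"])
    have e: "{v j, v (j - 1)} \<in> E" using edge[of "j - 1"] by (simp add: insert_commute)
    have "legendrian_on {0..1} (edge_curve f (v j) (v (j - 1)))"
      using f e by (simp add: legendrian_embedding_def)
    then have "smooth_on {0..1} (edge_curve f (v j) (v (j - 1)))"
      by (rule legendrian_on_D(1)[OF _ unit_interval_nontrivial])
    then have "cdiff (Suc 0) {0..1} (edge_curve f (v j) (v (j - 1)))" unfolding smooth_on_def by blast
    from piece_deriv_reverse[OF this, of 1]
    have L: "vector_derivative ?c (at (of_int j) within {of_int j - 1..of_int j}) =
        - piece_deriv (edge_curve f (v j) (v (j - 1))) 0" unfolding L0 rev by simp
    have "outgoing_direction f (v j) (v (j - 1)) \<noteq> outgoing_direction f (v j) (v (j + 1))"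
      using f e edge[of j] v_Suc_neq(3)[of j] unfolding legendrian_embedding_def by blast
    then show ?thesis unfolding L R outgoing_direction_def by (simp add: Real_Vector_Spaces.sgn_minus)
  qed
qed

end

section \<open>The Thurston--Bennequin number as a double sum over edges\<close>

definition pushoff_linking ::
  "(real ^ 'v \<Rightarrow> real ^ 3) \<Rightarrow> real \<Rightarrow> 'v::finite \<Rightarrow> 'v \<Rightarrow> 'v \<Rightarrow> 'v \<Rightarrow> real" where
  "pushoff_linking f e v w v' w' =
     1 / (4 * pi) * gauss_integral (edge_curve f v w) (\<lambda>t. edge_curve f v' w' t + e *\<^sub>R axis 3 1)"

definition cyclic_sum :: "('v \<Rightarrow> 'v \<Rightarrow> 'v \<Rightarrow> 'v \<Rightarrow> real) \<Rightarrow> 'v list \<Rightarrow> real" where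
  "cyclic_sum W vs = (\<Sum>i<length vs. \<Sum>j<length vs.
     W (vs ! i) (vs ! ((i + 1) mod length vs)) (vs ! j) (vs ! ((j + 1) mod length vs)))"

text \<open>The list \<open>ws\<close> serves to show that a smoothing exists. The chosen smoothing
  comes with its own traversal, possibly with another base point or direction, and the formula holds
  for that one.\<close>

lemma cycle_tb_eq:
  assumes f: "legendrian_embedding E f" and C: "C \<subseteq> E" "traverses ws C" "3 \<le> length ws"
  shows "\<exists>vs. traverses vs C \<and> 3 \<le> length vs \<and>
    (\<forall>\<^sub>F e in at_right 0. cycle_tb f C = cyclic_sum (pushoff_linking f e) vs)"
proof -
  have cl: "cyclic_list vs" if "traverses vs C" "3 \<le> length vs" for vs
    using that by unfold_locales (auto simp: traverses_def)
  have card: "card C = length ws" by (rule cyclic_list.card_edges[OF cl[OF C(2,3)] C(2)])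
  have "\<exists>h. legendrian_smoothing f C h"
  proof -
    interpret cyclic_list ws by (rule cl[OF C(2,3)])
    interpret legendrian_polygon "length ws" "cycle_curve f ws"
      by (rule legendrian_polygon_cycle_curve[OF f C(2,1)])
    obtain h where h: "legendrian_on UNIV h" "\<And>t. h (t + real (length ws)) = h t"
      "rounds_corners (length ws) (cycle_curve f ws) h" using smoothing_exists by blast
    obtain r P Q a where "rounded_polygon (length ws) (cycle_curve f ws) h r P Q a"
      using rounded_polygonI[OF h] by blast
    then have "legendrian_knot (real (length ws)) h" by (rule rounded_polygon.legendrian_knot_h)
    then show ?thesis using h(3) C(2) card unfolding legendrian_smoothing_def by auto
  qed
  then have "legendrian_smoothing f C (SOME h. legendrian_smoothing f C h)" by (rule someI_ex)
  then obtain h vs where h: "cycle_tb f C = tb (real (card C)) h" "legendrian_knot (real (card C)) h"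
    "traverses vs C" "rounds_corners (length vs) (cycle_curve f vs) h"
    unfolding legendrian_smoothing_def cycle_tb_def by blast
  \<comment> \<open>The traversal of the chosen smoothing is not known to have three vertices;
    comparing the number of edges with \<open>ws\<close> shows it.\<close>
  have "C = (\<lambda>i. {vs ! i, vs ! ((i + 1) mod length vs)}) ` {..<length vs}"
    using h(3) by (auto simp: traverses_def)
  then have "card C \<le> length vs" using card_image_le[of "{..<length vs}"] by (metis card_lessThan finite_lessThan)
  then have len: "3 \<le> length vs" using card C(3) by simp
  interpret cyclic_list vs by (rule cl[OF h(3) len])
  interpret legendrian_polygon "length vs" "cycle_curve f vs"
    by (rule legendrian_polygon_cycle_curve[OF f h(3) C(1)])
  have cardvs: "card C = length vs" by (rule card_edges[OF h(3)])
  obtain r P Q a where "rounded_polygon (length vs) (cycle_curve f vs) h r P Q a"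
    using rounded_polygonI[OF _ _ h(4)] h(2) unfolding legendrian_knot_def cardvs by blast
  then interpret R: rounded_polygon "length vs" "cycle_curve f vs" h r P Q a .
  have g: "gauss_integral (\<lambda>s. cycle_curve f vs (real i + s)) (\<lambda>t. cycle_curve f vs (real j + t) + e *\<^sub>R axis 3 1) =
     gauss_integral (edge_curve f (vs ! i) (vs ! ((i + 1) mod length vs)))
       (\<lambda>t. edge_curve f (vs ! j) (vs ! ((j + 1) mod length vs)) t + e *\<^sub>R axis 3 1)"
    if "i < length vs" "j < length vs" for i j e
  proof -
    have "cycle_curve f vs (real i + s) = edge_curve f (vs ! i) (vs ! ((i + 1) mod length vs)) s"
      if "i < length vs" "s \<in> {0..1}" for i s
      using polygon_piece[OF that(2), of "int i"] v_nat[OF that(1)] v_Suc_nat[of i]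
      by (simp add: cycle_curve_polygon edge_curve_def)
    then show ?thesis using that by (intro gauss_integral_cong) simp_all
  qed
  have "R.gauss_sum e = cyclic_sum (pushoff_linking f e) vs" for e
    unfolding R.gauss_sum_def cyclic_sum_def pushoff_linking_def sum_distrib_left
    by (intro sum.cong refl) (simp only: g lessThan_iff)
  then show ?thesis using h(1,3) len R.tb_eq_gauss_sum cardvs by auto
qed

subsection \<open>Topological and combinatorial cycles\<close>

lemma circle_punctured:
  fixes R :: "'a::euclidean_space set"
  assumes R: "R homeomorphic sphere (0::complex) 1" and x: "x \<in> R"
  shows "(R - {x}) homeomorphic (UNIV :: real set)"
proof -
  obtain \<phi> \<psi> where h: "homeomorphism R (sphere (0::complex) 1) \<phi> \<psi>" using R by (auto simp: homeomorphic_def)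
  have "inj_on \<phi> R"
    by (rule inj_on_inverseI[of R \<psi>]) (use h in \<open>simp add: homeomorphism_def\<close>)
  then have "\<phi> ` (R - {x}) = \<phi> ` R - \<phi> ` {x}"
    by (rule inj_on_image_set_diff) (use x in auto)
  then have "\<phi> ` (R - {x}) = sphere (0::complex) 1 - {\<phi> x}"
    using h by (simp add: homeomorphism_def)
  then have "homeomorphism (R - {x}) (sphere (0::complex) 1 - {\<phi> x}) \<phi> \<psi>"
    by (intro homeomorphism_of_subsets[OF h]) auto
  then have "(R - {x}) homeomorphic (sphere (0::complex) 1 - {\<phi> x})" by (auto simp: homeomorphic_def)
  moreover have "\<phi> x \<in> sphere (0::complex) 1" using h x by (auto simp: homeomorphism_def)
  then have "(sphere (0::complex) 1 - {\<phi> x}) homeomorphic (UNIV :: real set)"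
    by (intro homeomorphic_punctured_sphere_affine) (auto simp: aff_dim_UNIV)
  ultimately show ?thesis by (rule homeomorphic_trans)
qed

lemma circle_punctured_connected:
  fixes R :: "'a::euclidean_space set"
  assumes "R homeomorphic sphere (0::complex) 1"
  shows "connected (R - {x})"
proof (cases "x \<in> R")
  case True
  show ?thesis
    using homeomorphic_connectedness[OF circle_punctured[OF assms True]] by simp
next
  case False
  then show ?thesis
    using homeomorphic_connectedness[OF assms] connected_sphere[of "0::complex" 1] by simp
qed

text \<open>Removing from \<open>R\<close> a point outside \<open>S\<close> would place
  \<open>S\<close> into a line. A circle stays connected when a point is removed, but a subset of
  the line does not when the point lies strictly between two of its points.\<close>

lemma circle_subset_circle:
  fixes R :: "'a::euclidean_space set"
  assumes R: "R homeomorphic sphere (0::complex) 1" and S: "S homeomorphic sphere (0::complex) 1" "S \<subseteq> R"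
  shows "S = R"
proof (rule ccontr)
  assume "S \<noteq> R"
  then obtain x where x: "x \<in> R" "x \<notin> S" using S by blast
  obtain \<phi> \<psi> where h: "homeomorphism (R - {x}) (UNIV :: real set) \<phi> \<psi>"
    using circle_punctured[OF R x(1)] by (auto simp: homeomorphic_def)
  have "homeomorphism S (\<phi> ` S) \<phi> \<psi>"
    by (rule homeomorphism_of_subsets[OF h]) (use S x in auto)
  then have "S homeomorphic (\<phi> ` S)" by (auto simp: homeomorphic_def)
  then have T: "(\<phi> ` S) homeomorphic sphere (0::complex) 1" using S(1) by (meson homeomorphic_sym homeomorphic_trans)
  then obtain f g where fg: "homeomorphism (\<phi> ` S) (sphere (0::complex) 1) f g" by (auto simp: homeomorphic_def)
  have "g 1 \<in> \<phi> ` S" "g (-1) \<in> \<phi> ` S" "g 1 \<noteq> g (-1)"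
  proof -
    have s: "1 \<in> sphere (0::complex) 1" "- 1 \<in> sphere (0::complex) 1" by auto
    then show "g 1 \<in> \<phi> ` S" "g (-1) \<in> \<phi> ` S" using fg unfolding homeomorphism_def by blast+
    have "f (g 1) = 1" "f (g (-1)) = - 1" using fg s unfolding homeomorphism_def by blast+
    then show "g 1 \<noteq> g (-1)" by force
  qed
  then obtain a b where ab: "a \<in> \<phi> ` S" "b \<in> \<phi> ` S" "a < b" by (metis linorder_neqE)
  define m where "m = (a + b) / 2"
  have "connected (\<phi> ` S - {m})" by (rule circle_punctured_connected[OF T])
  moreover have "a \<in> \<phi> ` S - {m}" "b \<in> \<phi> ` S - {m}" "a \<le> m" "m \<le> b"
    using ab by (auto simp: m_def)
  ultimately have "m \<in> \<phi> ` S - {m}" unfolding connected_iff_interval by blast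
  then show False by simp
qed

text \<open>If \<open>{v, w}\<close> were the only edge at \<open>v\<close>, its midpoint would be
  the only point of the realisation with coordinate 1/2 at \<open>v\<close>. Removing it would
  separate \<open>v\<close> from \<open>w\<close>, which is impossible on a circle.\<close>

lemma circle_degree:
  assumes R: "realization C homeomorphic sphere (0::complex) 1"
    and vw: "{v, w} \<in> C" and loop: "\<And>v. {v} \<notin> C"
  shows "\<exists>w'. w' \<noteq> w \<and> {v, w'} \<in> C"
proof (rule ccontr)
  assume neg: "\<not> ?thesis"
  have vnw: "v \<noteq> w" using vw loop[of w] by auto
  define m where "m = linepath (axis v 1) (axis w (1::real)) (1 / 2)"
  let ?A = "{x :: real ^ 'a. x $ v < 1 / 2}" and ?B = "{x :: real ^ 'a. 1 / 2 < x $ v}"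
  have mid: "x = m" if x: "x \<in> realization C" "x $ v = 1 / 2" for x
  proof -
    obtain p q u where pq: "{p, q} \<in> C" "u \<in> {0..1}" "x = linepath (axis p 1) (axis q 1) u"
      using x(1) unfolding in_realization by blast
    have pnq: "p \<noteq> q" using pq(1) loop[of q] by auto
    have "(if v = p then 1 - u else 0) + (if v = q then u else 0) = 1 / 2"
      using x(2) unfolding pq(3) linepath_axis_nth .
    then consider "v = p" "u = 1 / 2" | "v = q" "u = 1 / 2" using pnq by (auto split: if_splits)
    then show ?thesis
    proof cases
      case 1
      then have "q = w" using neg pq(1) by auto
      then show ?thesis using pq(3) unfolding 1 m_def by simp
    next
      case 2
      then have "p = w" using neg pq(1) by (auto simp: insert_commute)
      then show ?thesis
        using pq(3) linepath_swap[of "axis w 1" "axis q 1" "1 / 2"] unfolding 2 m_def by simp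
    qed
  qed
  have "connected (realization C - {m})" by (rule circle_punctured_connected[OF R])
  moreover have "open ?A" "open ?B"
    by (intro open_Collect_less continuous_intros)+
  moreover have "?A \<inter> ?B \<inter> (realization C - {m}) = {}" by auto
  moreover have "realization C - {m} \<subseteq> ?A \<union> ?B" using mid by force
  ultimately have "?A \<inter> (realization C - {m}) = {} \<or> ?B \<inter> (realization C - {m}) = {}"
    by (rule connectedD)
  moreover have mv: "m $ v = 1 / 2" using vnw by (simp add: m_def linepath_axis_nth)
  have "axis v 1 \<in> ?B \<inter> (realization C - {m})"
  proof -
    have "axis v 1 \<in> realization C" unfolding in_realization
      by (intro exI[of _ v] exI[of _ w] exI[of _ 0]) (use vw in \<open>auto simp: linepath_def\<close>)
    then show ?thesis using mv by (auto simp: axis_def)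
  qed
  moreover have "axis w 1 \<in> ?A \<inter> (realization C - {m})"
  proof -
    have "axis w 1 \<in> realization C" unfolding in_realization
      by (intro exI[of _ v] exI[of _ w] exI[of _ 1]) (use vw in \<open>auto simp: linepath_def\<close>)
    then show ?thesis using mv vnw by (auto simp: axis_def)
  qed
  ultimately show False by blast
qed

text \<open>A neighbour of the first vertex of a longest path lies on the path. Taking one different
  from the second vertex closes an initial segment of at least three vertices.\<close>

lemma min_degree_two_cycle:
  fixes C :: "'v::finite set set"
  assumes ne: "{x0, y0} \<in> C" and loop: "\<And>v. {v} \<notin> C"
    and deg: "\<And>v w. {v, w} \<in> C \<Longrightarrow> \<exists>w'. w' \<noteq> w \<and> {v, w'} \<in> C"
  shows "\<exists>vs C'. C' \<subseteq> C \<and> traverses vs C' \<and> 3 \<le> length vs"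
proof -
  define path where "path p \<longleftrightarrow> 2 \<le> length p \<and> distinct p \<and> (\<forall>i. Suc i < length p \<longrightarrow> {p ! i, p ! Suc i} \<in> C)" for p
  have "x0 \<noteq> y0" using ne loop[of y0] by auto
  then have "path [x0, y0]" using ne by (auto simp: path_def less_Suc_eq)
  moreover have bound: "\<forall>p. path p \<longrightarrow> length p < Suc (CARD('v))"
    using card_mono[of UNIV] distinct_card by (metis path_def finite less_Suc_eq_le top_greatest)
  ultimately obtain p where p: "path p" "\<And>q. path q \<Longrightarrow> length q \<le> length p"
    using ex_has_greatest_nat[of path "[x0, y0]" length "Suc (CARD('v))"] by auto
  obtain x y zs where xy: "p = x # y # zs"
    using p(1) by (cases p; cases "tl p") (auto simp: path_def)
  have "{x, y} \<in> C" using p(1) by (auto simp: path_def xy)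
  then obtain w where w: "w \<noteq> y" "{x, w} \<in> C" using deg by blast
  have "w \<noteq> x" using w(2) loop[of x] by auto
  have "w \<in> set p"
  proof (rule ccontr)
    assume "w \<notin> set p"
    then have "path (w # p)"
      using p(1) w(2) unfolding path_def by (auto simp: nth_Cons xy insert_commute split: nat.splits)
    then show False using p(2)[of "w # p"] by simp
  qed
  then obtain j where j: "j < length p" "p ! j = w" by (auto simp: in_set_conv_nth)
  have j2: "2 \<le> j"
  proof (rule ccontr)
    assume "\<not> 2 \<le> j"
    then have "j = 0 \<or> j = 1" by linarith
    then show False using j \<open>w \<noteq> x\<close> w(1) by (auto simp: xy)
  qed
  define vs where "vs = take (Suc j) p"
  have len: "length vs = Suc j" using j by (simp add: vs_def)
  have nth: "vs ! i = p ! i" if "i \<le> j" for i using that by (simp add: vs_def)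
  define C' where "C' = {{vs ! i, vs ! ((i + 1) mod length vs)} | i. i < length vs}"
  have "C' \<subseteq> C"
  proof
    fix e assume "e \<in> C'"
    then obtain i where "i < Suc j" and e: "e = {vs ! i, vs ! ((i + 1) mod Suc j)}"
      unfolding C'_def len by blast
    then have i: "i \<le> j" "e = {vs ! i, vs ! ((i + 1) mod Suc j)}" by simp_all
    show "e \<in> C"
    proof (cases "i = j")
      case True
      then show ?thesis using i(2) nth[of j] nth[of 0] j(2) w(2) by (simp add: xy insert_commute)
    next
      case False
      then show ?thesis using i nth[of i] nth[of "Suc i"] p(1) j(1) by (auto simp: path_def)
    qed
  qed
  moreover have "traverses vs C'" using p(1) by (auto simp: traverses_def C'_def path_def vs_def)
  ultimately show ?thesis using j2 len by (intro exI[of _ vs] exI[of _ C']) auto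
qed

text \<open>Minimum degree 2 yields a polygon inside a topological cycle. Both realisations are
  circles and hence equal, and the midpoint of an edge lies on no other edge, so the edge sets are
  equal as well.\<close>

lemma cycles_iff:
  assumes E: "\<And>e. e \<in> E \<Longrightarrow> card e = 2"
  shows "C \<in> cycles E \<longleftrightarrow> C \<subseteq> E \<and> (\<exists>vs. traverses vs C \<and> 3 \<le> length vs)"
proof
  assume "C \<subseteq> E \<and> (\<exists>vs. traverses vs C \<and> 3 \<le> length vs)"
  then obtain vs where C: "C \<subseteq> E" "traverses vs C" "3 \<le> length vs" by blast
  interpret cyclic_list vs using C(2,3) by unfold_locales (auto simp: traverses_def)
  show "C \<in> cycles E" using C(1) realization_circle[OF C(2)] by (simp add: cycles_def)
next
  assume "C \<in> cycles E"
  then have CE: "C \<subseteq> E" and R: "realization C homeomorphic sphere (0::complex) 1" by (auto simp: cycles_def)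
  have loop: "{v} \<notin> C" for v
  proof
    assume "{v} \<in> C"
    then have "card {v} = 2" using CE E by blast
    then show False by simp
  qed
  have "realization C \<noteq> {}"
    using homeomorphic_empty R by (metis sphere_eq_empty zero_neq_one not_one_less_zero)
  then obtain x y where "{x, y} \<in> C" by (auto simp: in_realization)
  then obtain vs C' where C': "C' \<subseteq> C" "traverses vs C'" "3 \<le> length vs"
    using min_degree_two_cycle[OF _ loop circle_degree[OF R _ loop]] by metis
  interpret cyclic_list vs using C'(2,3) by unfold_locales (auto simp: traverses_def)
  have "realization C' \<subseteq> realization C" using C'(1) unfolding subset_iff in_realization by blast
  then have eq: "realization C' = realization C"
    by (rule circle_subset_circle[OF R realization_circle[OF C'(2)]])
  have "C \<subseteq> C'"
  proof
    fix e assume e: "e \<in> C"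
    then have "card e = 2" using CE E by blast
    then obtain v w where vw: "e = {v, w}" "v \<noteq> w" unfolding card_2_iff by blast
    define m where "m = linepath (axis v 1) (axis w (1::real)) (1 / 2)"
    have "m \<in> realization C'" unfolding eq in_realization m_def
      by (intro exI[of _ v] exI[of _ w] exI[of _ "1 / 2"]) (use e vw(1) in simp)
    then obtain a b u where ab: "{a, b} \<in> C'" "m = linepath (axis a 1) (axis b 1) u"
      unfolding in_realization by blast
    have "m $ v \<noteq> 0" "m $ w \<noteq> 0" using vw(2) by (auto simp: m_def linepath_axis_nth)
    moreover have "z = a \<or> z = b" if "m $ z \<noteq> 0" for z
      using that unfolding ab(2) linepath_axis_nth by (auto split: if_splits)
    ultimately have "(v = a \<or> v = b) \<and> (w = a \<or> w = b)" by blast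
    then have "{a, b} = {v, w}" using vw(2) by auto
    then show "e \<in> C'" using ab(1) vw(1) by simp
  qed
  then have "C = C'" using C'(1) by blast
  then show "C \<subseteq> E \<and> (\<exists>vs. traverses vs C \<and> 3 \<le> length vs)" using CE C'(2,3) by blast
qed

subsection \<open>The cycles of the Heawood graph\<close>

text \<open>The vertices \<open>u_i\<close> and \<open>v_i\<close> are encoded by the integers \<open>i\<close> and \<open>7 + i\<close>.\<close>

definition neighbours :: "int \<Rightarrow> int list" where
  "neighbours x =
     (if x < 7
      then if x < 3 then if x = 0 then [7, 13, 9] else if x = 1 then [8, 7, 10] else [9, 8, 11]
        else if x < 5 then if x = 3 then [10, 9, 12] else [11, 10, 13]
        else if x = 5 then [12, 11, 7] else [13, 12, 8]
      else if x < 10 then if x = 7 then [0, 1, 5] else if x = 8 then [1, 2, 6] else [2, 3, 0]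
        else if x < 12 then if x = 10 then [3, 4, 1] else [4, 5, 2]
        else if x = 12 then [5, 6, 3] else [6, 0, 4])"

definition forward_edges :: "(int \<times> int) list" where
  "forward_edges =
     [(0, 7), (0, 13), (0, 9), (1, 8), (1, 7), (1, 10), (2, 9), (2, 8), (2, 11), (3, 10), (3, 9),
      (3, 12), (4, 11), (4, 10), (4, 13), (5, 12), (5, 11), (5, 7), (6, 13), (6, 12), (6, 8)]"

definition extend_paths :: "int \<Rightarrow> int list list \<Rightarrow> int list list" where
  "extend_paths s ps =
     concat (map (\<lambda>p. map (\<lambda>w. w # p) (filter (\<lambda>w. if s < w then w \<notin> set p else False) (neighbours (hd p)))) ps)"

text \<open>Paths are stored backwards. A cycle is recorded once: it starts at its least vertex \<open>s\<close>, and its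
  second vertex is less than its last one.\<close>

definition closing :: "int \<Rightarrow> int list \<Rightarrow> bool" where
  "closing s p \<longleftrightarrow> (if s \<in> set (neighbours (hd p)) then last (butlast p) < hd p else False)"

primrec cycles_from :: "int \<Rightarrow> nat \<Rightarrow> int list list \<Rightarrow> int list list" where
  "cycles_from s 0 ps = filter (closing s) ps"
| "cycles_from s (Suc n) ps = filter (closing s) ps @ cycles_from s n (extend_paths s ps)"

definition directed_edges :: "'a list \<Rightarrow> ('a \<times> 'a) list" where
  "directed_edges p = zip p (tl p @ [hd p])"

definition orientation :: "('a \<times> 'a) \<Rightarrow> 'a list \<Rightarrow> int" where
  "orientation e p = (let d = set (directed_edges p) in of_bool (e \<in> d) - of_bool (prod.swap e \<in> d))"

text \<open>Thirteen extensions lead from one vertex to a path through all fourteen. A path with two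
  vertices never closes, since \<open>closing\<close> would compare its end with itself.\<close>

definition all_cycles :: "int list list" where
  "all_cycles = concat (map (\<lambda>s. cycles_from s 13 [[s]]) [0,1,2,3,4,5,6,7,8,9,10,11,12,13])"

definition dot :: "int list \<Rightarrow> int list \<Rightarrow> int" where
  "dot a b = sum_list (map2 (*) a b)"

text \<open>The diagonal pairs are included, as the matrix identities concern diagonal entries too;
  the remaining half follows by symmetry in \<open>pairwise_mem\<close>.\<close>

fun list_pairwise :: "('a \<Rightarrow> 'a \<Rightarrow> bool) \<Rightarrow> 'a list \<Rightarrow> bool" where
  "list_pairwise P [] \<longleftrightarrow> True"
| "list_pairwise P (x # xs) \<longleftrightarrow> list_all (P x) (x # xs) \<and> list_pairwise P xs"

text \<open>Transposition: from one row per cycle to one column per edge. The dot product of two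
  columns is an entry of the matrix \<open>M_k\<close>, so each entry costs one pass over the cycles
  of that length.\<close>

definition column_lists :: "int list list \<Rightarrow> int list list" where
  "column_lists rs = foldr (map2 (#)) rs (map (\<lambda>_. []) forward_edges)"

definition proportional :: "int \<Rightarrow> int list list \<Rightarrow> int list list \<Rightarrow> bool" where
  "proportional m a b \<longleftrightarrow>
     list_pairwise (\<lambda>(x, y) (x', y'). dot y y' = m * dot x x') (zip (column_lists a) (column_lists b))"

text \<open>Forbidding an edge in both directions makes the absolute value of
  \<open>orientation\<close> the indicator of the undirected edge, which \<open>edges_of_inj\<close>
  relies on.\<close>

definition valid_cycle :: "int list \<Rightarrow> bool" where
  "valid_cycle p \<longleftrightarrow> distinct p \<and> length p \<in> set [6, 8, 10, 12, 14] \<and>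
     (let d = directed_edges p in
      list_all (\<lambda>e. prod.swap e \<notin> set d \<and>
        (if fst e < snd e then e \<in> set forward_edges else prod.swap e \<in> set forward_edges)) d)"

definition orientations :: "nat \<Rightarrow> int list list \<Rightarrow> int list list" where
  "orientations k L = map (\<lambda>p. map (\<lambda>e. orientation e p) forward_edges) (filter (\<lambda>p. length p = k) L)"

text \<open>Up to sign, the incidence vector determines the undirected cycle; distinctness of the
  vectors of absolute values therefore certifies that no cycle is listed twice, in whichever
  direction.\<close>

definition check_cycles :: "int list list \<Rightarrow> bool" where
  "check_cycles L \<longleftrightarrow> list_all valid_cycle L \<and>
     (let x6 = orientations 6 L; x8 = orientations 8 L; x10 = orientations 10 L;
          x12 = orientations 12 L; x14 = orientations 14 L
      in list_all (\<lambda>x. distinct (map (map abs) x)) [x6, x8, x10, x12, x14] \<and>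
         proportional 1 x6 x8 \<and> proportional 5 x6 x10 \<and> proportional 4 x6 x12 \<and> proportional 2 x6 x14)"

text \<open>The evaluation settles soundness, absence of repetitions and the matrix identities. That
  no cycle is missing is proved separately in \<open>all_cycles_complete\<close>.\<close>

lemma check_all_cycles: "check_cycles all_cycles"
  by code_simp

subsection \<open>Sums over directed cycles\<close>

definition consecutive :: "'a list \<Rightarrow> ('a \<times> 'a) set" where
  "consecutive l = set (zip l (tl l))"

lemma consecutive_Cons: "l \<noteq> [] \<Longrightarrow> consecutive (x # l) = insert (x, hd l) (consecutive l)"
  by (cases l) (auto simp: consecutive_def)

lemma consecutive_single: "consecutive [x] = {}"
  by (simp add: consecutive_def)

lemma consecutive_append: "consecutive (xs @ y # ys) = consecutive (xs @ [y]) \<union> consecutive (y # ys)"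
proof (induction xs)
  case Nil
  then show ?case by (simp add: consecutive_single)
next
  case (Cons x xs)
  have "hd (xs @ y # ys) = hd (xs @ [y])" by (cases xs) auto
  then show ?case using Cons by (simp add: consecutive_Cons)
qed

lemma consecutive_rev: "consecutive (rev l) = prod.swap ` consecutive l"
proof (induction l)
  case Nil
  then show ?case by (simp add: consecutive_def)
next
  case (Cons x l)
  show ?case
  proof (cases l)
    case Nil
    then show ?thesis by (simp add: consecutive_single)
  next
    case (Cons y l')
    have "consecutive (rev (x # l)) = consecutive (rev l' @ [y]) \<union> consecutive [y, x]"
      using consecutive_append[of "rev l'" y "[x]"] by (simp add: Cons)
    also have "rev l' @ [y] = rev l" by (simp add: Cons)
    finally show ?thesis using Cons.IH by (simp add: Cons consecutive_Cons consecutive_single)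
  qed
qed

lemma directed_edges_consecutive:
  assumes "p \<noteq> []"
  shows "set (directed_edges p) = consecutive (p @ [hd p])"
proof -
  have "zip (p @ [hd p]) ys = zip p ys" if "length ys = length p" for ys :: "'a list"
    using that by (simp add: zip_append1)
  moreover have "length (tl p @ [hd p]) = length p" using assms by simp
  ultimately have "zip (p @ [hd p]) (tl p @ [hd p]) = zip p (tl p @ [hd p])" by blast
  then show ?thesis using assms by (simp add: directed_edges_def consecutive_def)
qed

lemma directed_edges_rotate:
  "set (directed_edges (as @ bs)) = set (directed_edges (bs @ as))"
proof (cases "as = [] \<or> bs = []")
  case False
  then obtain a as' b bs' where ab: "as = a # as'" "bs = b # bs'" by (meson neq_Nil_conv)
  have "consecutive ((a # as') @ b # (bs' @ [a])) = consecutive ((a # as') @ [b]) \<union> consecutive ((b # bs') @ [a])"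
    using consecutive_append[of "a # as'" b "bs' @ [a]"] by simp
  moreover have "consecutive ((b # bs') @ a # (as' @ [b])) = consecutive ((b # bs') @ [a]) \<union> consecutive ((a # as') @ [b])"
    using consecutive_append[of "b # bs'" a "as' @ [b]"] by simp
  ultimately show ?thesis by (simp add: directed_edges_consecutive ab Un_commute)
qed auto

lemma directed_edges_reverse:
  "set (directed_edges (h # rev xs)) = prod.swap ` set (directed_edges (h # xs))"
  using consecutive_rev[of "h # xs @ [h]"] by (simp add: directed_edges_consecutive)

lemma directed_edges_map: "p \<noteq> [] \<Longrightarrow> directed_edges (map f p) = map (map_prod f f) (directed_edges p)"
  by (cases p) (simp_all add: directed_edges_def zip_map_map[symmetric] map_prod_def zip_map_map)

lemma directed_edges_nth:
  assumes "p \<noteq> []"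
  shows "directed_edges p = map (\<lambda>i. (p ! i, p ! ((i + 1) mod length p))) [0..<length p]"
proof (rule nth_equalityI)
  show "length (directed_edges p) = length (map (\<lambda>i. (p ! i, p ! ((i + 1) mod length p))) [0..<length p])"
    using assms by (simp add: directed_edges_def)
  fix i assume i: "i < length (directed_edges p)"
  then have i: "i < length p" using assms by (simp add: directed_edges_def)
  have "(tl p @ [hd p]) ! i = p ! ((i + 1) mod length p)"
  proof (cases "Suc i = length p")
    case True
    then have i': "i = length (tl p)" by simp
    have "(tl p @ [hd p]) ! i = hd p" unfolding i' by (rule nth_append_length)
    then show ?thesis using True assms by (simp add: hd_conv_nth)
  next
    case False
    then have l: "i < length (tl p)" using i by simp
    have "(tl p @ [hd p]) ! i = tl p ! i" using l by (rule nth_append_left)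
    also have "\<dots> = p ! Suc i" using l by (rule nth_tl)
    finally show ?thesis using i False by simp
  qed
  then show "directed_edges p ! i = map (\<lambda>i. (p ! i, p ! ((i + 1) mod length p))) [0..<length p] ! i"
    using i assms by (simp add: directed_edges_def)
qed

lemma sum_directed_edges:
  assumes "distinct p" "p \<noteq> []"
  shows "(\<Sum>i<length p. f (p ! i) (p ! ((i + 1) mod length p))) = (\<Sum>(a, b)\<in>set (directed_edges p). f a b)"
proof -
  have "inj_on (\<lambda>i. (p ! i, p ! ((i + 1) mod length p))) {..<length p}"
    using assms(1) by (auto simp: inj_on_def nth_eq_iff_index_eq)
  from sum.reindex[OF this, of "\<lambda>(a, b). f a b"] show ?thesis
    by (simp add: directed_edges_nth[OF assms(2)] atLeast0LessThan)
qed

lemma cyclic_sum_directed_edges: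
  assumes "distinct p" "p \<noteq> []"
  shows "cyclic_sum W p = (\<Sum>(a, b)\<in>set (directed_edges p). \<Sum>(a', b')\<in>set (directed_edges p). W a b a' b')"
proof -
  have "cyclic_sum W p = (\<Sum>i<length p. \<Sum>(a', b')\<in>set (directed_edges p).
      W (p ! i) (p ! ((i + 1) mod length p)) a' b')"
    unfolding cyclic_sum_def by (intro sum.cong refl sum_directed_edges[OF assms])
  also have "\<dots> = (\<Sum>(a, b)\<in>set (directed_edges p). \<Sum>(a', b')\<in>set (directed_edges p). W a b a' b')"
    by (rule sum_directed_edges[OF assms, of "\<lambda>a b. \<Sum>(a', b')\<in>set (directed_edges p). W a b a' b'"])
  finally show ?thesis .
qed

lemma cyclic_sum_map: "cyclic_sum W (map f p) = cyclic_sum (\<lambda>a b a' b'. W (f a) (f b) (f a') (f b')) p"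
  unfolding cyclic_sum_def
proof (simp only: length_map, intro sum.cong refl)
  fix i j assume ij: "i \<in> {..<length p}" "j \<in> {..<length p}"
  then have "(i + 1) mod length p < length p" "(j + 1) mod length p < length p"
    by (auto intro!: mod_less_divisor)
  then show "W (map f p ! i) (map f p ! ((i + 1) mod length p)) (map f p ! j) (map f p ! ((j + 1) mod length p)) =
    W (f (p ! i)) (f (p ! ((i + 1) mod length p))) (f (p ! j)) (f (p ! ((j + 1) mod length p)))"
    using ij by simp
qed

lemma traverses_directed_edges:
  assumes "vs \<noteq> []"
  shows "traverses vs C \<longleftrightarrow> distinct vs \<and> C = (\<lambda>(a, b). {a, b}) ` set (directed_edges vs)"
proof -
  have "{{vs ! i, vs ! ((i + 1) mod length vs)} | i. i < length vs} = (\<lambda>(a, b). {a, b}) ` set (directed_edges vs)"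
  proof -
    have "{f i | i. i < n} = f ` {0..<n}" for f :: "nat \<Rightarrow> 'a set" and n by auto
    then show ?thesis
      by (simp only: directed_edges_nth[OF assms] set_map set_upt image_image prod.case)
  qed
  then show ?thesis by (simp add: traverses_def)
qed

text \<open>Reversing a cycle reverses both arguments of \<open>W\<close>, and the two signs cancel.
  A different base point does not change the set of directed edges.\<close>

lemma cyclic_sum_cong_edges:
  assumes p: "distinct p" "p \<noteq> []" and q: "distinct q" "q \<noteq> []"
    and D: "set (directed_edges p) = set (directed_edges q) \<or> set (directed_edges p) = prod.swap ` set (directed_edges q)"
    and W: "\<And>a b a' b'. W b a a' b' = - W a b a' b'" "\<And>a b a' b'. W a b b' a' = - W a b a' b'"
  shows "cyclic_sum W p = (cyclic_sum W q :: real)"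
  using D
proof
  assume "set (directed_edges p) = prod.swap ` set (directed_edges q)"
  then have "cyclic_sum W p = (\<Sum>(a, b)\<in>prod.swap ` set (directed_edges q).
      \<Sum>(a', b')\<in>prod.swap ` set (directed_edges q). W a b a' b')"
    by (simp only: cyclic_sum_directed_edges[OF p])
  also have "\<dots> = (\<Sum>(a, b)\<in>set (directed_edges q). \<Sum>(a', b')\<in>set (directed_edges q). W b a b' a')"
    by (simp add: sum.reindex split_beta)
  also have "\<dots> = cyclic_sum W q"
  proof -
    have "W b a b' a' = W a b a' b'" for a b a' b'
      using W(1)[of a b b' a'] W(2)[of a b a' b'] by linarith
    then show ?thesis
      unfolding cyclic_sum_directed_edges[OF q] split_beta by (intro sum.cong refl)
  qed
  finally show ?thesis .
qed (simp add: cyclic_sum_directed_edges p q)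

text \<open>\<open>F\<close> holds one direction of each edge. Splitting the directed edges by
  membership in \<open>F\<close> and turning the others around by antisymmetry produces the signs
  recorded by \<open>orientation\<close>.\<close>

lemma sum_orientation:
  fixes f :: "'a \<Rightarrow> 'a \<Rightarrow> real"
  assumes F: "finite F" "F \<inter> prod.swap ` F = {}" "set (directed_edges p) \<subseteq> F \<union> prod.swap ` F"
    and f: "\<And>a b. f b a = - f a b"
  shows "(\<Sum>(a, b)\<in>set (directed_edges p). f a b) = (\<Sum>e\<in>F. of_int (orientation e p) * f (fst e) (snd e))"
proof -
  let ?D = "set (directed_edges p)"
  have "(\<Sum>(a, b)\<in>?D. f a b) = (\<Sum>(a, b)\<in>?D \<inter> F. f a b) + (\<Sum>(a, b)\<in>?D \<inter> prod.swap ` F. f a b)"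
    using F by (subst sum.union_disjoint[symmetric]) (auto intro!: sum.cong)
  also have "(\<Sum>(a, b)\<in>?D \<inter> F. f a b) = (\<Sum>e\<in>F. of_bool (e \<in> ?D) * f (fst e) (snd e))"
    using F(1) by (simp add: sum.inter_restrict[symmetric] Int_commute split_beta of_bool_def if_distrib[of "\<lambda>x. x * _"] cong: if_cong)
  also have "(\<Sum>(a, b)\<in>?D \<inter> prod.swap ` F. f a b) = (\<Sum>e\<in>F. - of_bool (prod.swap e \<in> ?D) * f (fst e) (snd e))"
  proof -
    have "?D \<inter> prod.swap ` F = prod.swap ` {e \<in> F. prod.swap e \<in> ?D}" by force
    then have "(\<Sum>(a, b)\<in>?D \<inter> prod.swap ` F. f a b) = (\<Sum>e\<in>{e \<in> F. prod.swap e \<in> ?D}. f (snd e) (fst e))"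
      by (simp add: sum.reindex split_beta)
    also have "\<dots> = (\<Sum>e\<in>{e \<in> F. prod.swap e \<in> ?D}. - f (fst e) (snd e))" by (intro sum.cong refl f)
    also have "\<dots> = (\<Sum>e\<in>F. if prod.swap e \<in> ?D then - f (fst e) (snd e) else 0)"
      by (rule sum.inter_filter[OF F(1)])
    also have "\<dots> = (\<Sum>e\<in>F. - of_bool (prod.swap e \<in> ?D) * f (fst e) (snd e))" by (intro sum.cong) auto
    finally show ?thesis .
  qed
  finally show ?thesis
    by (simp add: sum.distrib[symmetric] orientation_def Let_def algebra_simps)
qed

subsection \<open>Completeness of the enumeration\<close>

lemma neighbours_forward_edges:
  assumes "(a, b) \<in> set forward_edges \<union> prod.swap ` set forward_edges"
  shows "b \<in> set (neighbours a)"
proof -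
  have "list_all (\<lambda>e. snd e \<in> set (neighbours (fst e)) \<and> fst e \<in> set (neighbours (snd e))) forward_edges"
    by code_simp
  then show ?thesis using assms by (auto simp: list_all_iff)
qed

lemma forward_edges_disjoint: "set forward_edges \<inter> prod.swap ` set forward_edges = {}"
proof -
  have "list_all (\<lambda>e. fst e < snd e) forward_edges"
    by code_simp
  then have lt: "fst e < snd e" if "e \<in> set forward_edges" for e
    using that by (simp add: list_all_iff)
  show ?thesis
  proof (rule equals0I)
    fix e assume "e \<in> set forward_edges \<inter> prod.swap ` set forward_edges"
    then obtain e' where "e \<in> set forward_edges" "e' \<in> set forward_edges" "e = prod.swap e'" by blast
    then show False using lt[of e] lt[of e'] by simp
  qed
qed

lemma extend_paths_mem:
  assumes "p \<in> set ps" "w \<in> set (neighbours (hd p))" "s < w" "w \<notin> set p"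
  shows "w # p \<in> set (extend_paths s ps)"
  unfolding extend_paths_def set_concat set_map set_filter using assms by (intro UN_I imageI) auto

text \<open>The induction removes the last vertex, because stored paths grow at their head, which is
  the end of the path.\<close>

lemma extend_paths_complete:
  assumes "distinct (m # xs)" "\<And>x. x \<in> set xs \<Longrightarrow> m < x"
    "\<And>a b. (a, b) \<in> consecutive (m # xs) \<Longrightarrow> b \<in> set (neighbours a)"
  shows "rev (m # xs) \<in> set ((extend_paths m ^^ length xs) [[m]])"
  using assms
proof (induction xs rule: rev_induct)
  case (snoc x xs)
  have sub: "consecutive (m # xs @ [x]) = insert (last (m # xs), x) (consecutive (m # xs))"
  proof -
    obtain ys z where ys: "m # xs = ys @ [z]" by (metis append_butlast_last_id list.distinct(1))
    then have e: "m # xs @ [x] = ys @ z # [x]" by simp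
    have "consecutive [z, x] = {(z, x)}" by (simp add: consecutive_def)
    then show ?thesis
      unfolding e consecutive_append[of ys z "[x]"] ys last_snoc by simp
  qed
  have IH: "rev (m # xs) \<in> set ((extend_paths m ^^ length xs) [[m]])"
    using snoc.prems sub by (intro snoc.IH) auto
  have "x \<in> set (neighbours (last (m # xs)))" using snoc.prems(3) sub by simp
  then have "x \<in> set (neighbours (hd (rev (m # xs))))" by (simp only: hd_rev)
  moreover have "m < x" "x \<notin> set (rev (m # xs))" using snoc.prems(1,2) by auto
  ultimately have "x # rev (m # xs) \<in> set (extend_paths m ((extend_paths m ^^ length xs) [[m]]))"
    using IH by (intro extend_paths_mem)
  then show ?case by simp
qed simp

lemma cycles_from_complete:
  assumes "p \<in> set ((extend_paths s ^^ n) ps)" "closing s p" "n \<le> f"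
  shows "p \<in> set (cycles_from s f ps)"
  using assms
proof (induction f arbitrary: n ps)
  case (Suc f)
  then show ?case
  proof (cases n)
    case (Suc m)
    then have "p \<in> set ((extend_paths s ^^ m) (extend_paths s ps))"
      using Suc.prems(1) by (simp add: funpow_swap1)
    then show ?thesis using Suc.IH[of m "extend_paths s ps"] Suc.prems Suc by simp
  qed auto
qed auto

text \<open>A cycle is rotated to start at its least vertex, which changes no directed edge, and is
  reversed if its second vertex exceeds its last. The result is the normal form that the search
  produces.\<close>

lemma all_cycles_complete:
  assumes q: "distinct q" "set q \<subseteq> {0..13}" "3 \<le> length q"
    and D: "set (directed_edges q) \<subseteq> set forward_edges \<union> prod.swap ` set forward_edges"
  shows "\<exists>p\<in>set all_cycles. length p = length q \<and>
    (set (directed_edges p) = set (directed_edges q) \<or> set (directed_edges p) = prod.swap ` set (directed_edges q))"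
proof -
  define m where "m = Min (set q)"
  have qne: "q \<noteq> []" using q(3) by auto
  then have m: "m \<in> set q" "\<And>x. x \<in> set q \<Longrightarrow> m \<le> x" by (simp_all add: m_def)
  obtain as bs where ab: "q = as @ m # bs" using m(1) by (meson split_list)
  define xs where "xs = bs @ as"
  have E: "set (directed_edges (m # xs)) = set (directed_edges q)"
    using directed_edges_rotate[of as "m # bs"] by (simp add: ab xs_def)
  have xs: "distinct (m # xs)" "set (m # xs) = set q" "length (m # xs) = length q"
    using q(1) by (auto simp: ab xs_def)
  have main: "\<exists>p\<in>set all_cycles. length p = length q \<and>
      (set (directed_edges p) = set (directed_edges q) \<or> set (directed_edges p) = prod.swap ` set (directed_edges q))"
    if ys: "set (directed_edges (m # ys)) = set (directed_edges q) \<or>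
        set (directed_edges (m # ys)) = prod.swap ` set (directed_edges q)"
      "distinct (m # ys)" "set (m # ys) = set q" "length (m # ys) = length q" "hd ys < last ys" for ys
  proof -
    have yne: "ys \<noteq> []" using ys(4) q(3) by auto
    have De: "set (directed_edges (m # ys)) = consecutive (m # ys @ [m])"
      by (simp add: directed_edges_consecutive)
    have adj: "b \<in> set (neighbours a)" if "(a, b) \<in> consecutive (m # ys @ [m])" for a b
    proof (rule neighbours_forward_edges)
      have "(a, b) \<in> set (directed_edges q) \<or> (a, b) \<in> prod.swap ` set (directed_edges q)"
        using ys(1) that De by auto
      then show "(a, b) \<in> set forward_edges \<union> prod.swap ` set forward_edges" using D by force
    qed
    obtain zs z where z: "ys = zs @ [z]" using yne by (metis append_butlast_last_id)
    have cons: "consecutive (m # ys @ [m]) = consecutive (m # ys) \<union> {(last ys, m)}"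
      using consecutive_append[of "m # zs" z "[m]"] by (simp add: z consecutive_Cons consecutive_single)
    \<comment> \<open>In the stored path the head is \<open>last ys\<close>, and the entry just
      before the final \<open>m\<close> is \<open>hd ys\<close>; the test in \<open>closing\<close>
      is thus \<open>hd ys < last ys\<close>. Storing backwards also swaps every directed
      edge.\<close>
    let ?p = "rev (m # ys)"
    have "?p \<in> set ((extend_paths m ^^ length ys) [[m]])"
    proof (rule extend_paths_complete[OF ys(2)])
      show "m < x" if "x \<in> set ys" for x
        using m(2)[of x] ys(2,3) that by (metis distinct.simps(2) le_less list.set_intros(2))
      show "b \<in> set (neighbours a)" if "(a, b) \<in> consecutive (m # ys)" for a b
        using adj that cons by blast
    qed
    moreover have "closing m ?p"
    proof -
      have "hd ?p = last ys" using yne by (simp add: hd_append hd_rev)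
      moreover have "last (butlast ?p) = hd ys" using yne by (simp add: last_rev butlast_append)
      moreover have "m \<in> set (neighbours (last ys))" using adj cons by blast
      ultimately show ?thesis using ys(5) by (simp add: closing_def)
    qed
    moreover have "length ys \<le> 13"
    proof -
      have "card (set (m # ys)) \<le> card {0..13::int}" using ys(3) q(2) by (intro card_mono) auto
      then show ?thesis using distinct_card[OF ys(2)] by simp
    qed
    ultimately have "?p \<in> set (cycles_from m 13 [[m]])" by (rule cycles_from_complete)
    moreover have "m \<in> {0..13}" using m(1) q(2) by blast
    then have "0 \<le> m \<and> m \<le> 13" by simp
    then have "m = 0 \<or> m = 1 \<or> m = 2 \<or> m = 3 \<or> m = 4 \<or> m = 5 \<or> m = 6 \<or> m = 7 \<or> m = 8 \<or> m = 9 \<or>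
      m = 10 \<or> m = 11 \<or> m = 12 \<or> m = 13" by presburger
    then have "m \<in> set [0,1,2,3,4,5,6,7,8,9,10,11,12,13]" by (elim disjE) simp_all
    ultimately have "?p \<in> set all_cycles" unfolding all_cycles_def set_concat set_map by blast
    moreover have "set (directed_edges ?p) = prod.swap ` set (directed_edges (m # ys))"
      using directed_edges_rotate[of "rev ys" "[m]"] directed_edges_reverse[of m ys] by simp
    then have "set (directed_edges ?p) = set (directed_edges q) \<or> set (directed_edges ?p) = prod.swap ` set (directed_edges q)"
      using ys(1) by (auto simp: image_image)
    ultimately show ?thesis using ys(4) by (intro bexI[of _ ?p]) auto
  qed
  have len: "2 \<le> length xs" using xs(3) q(3) by simp
  have "hd xs \<noteq> last xs"
  proof -
    obtain x y zs where "xs = x # y # zs" using len by (cases xs; cases "tl xs") auto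
    then show ?thesis using xs(1) by auto
  qed
  then consider "hd xs < last xs" | "last xs < hd xs" by linarith
  then show ?thesis
  proof cases
    case 1
    then show ?thesis using main[of xs] E xs by simp
  next
    case 2
    have "xs \<noteq> []" using len by auto
    then have "hd (rev xs) < last (rev xs)" using 2 by (simp add: hd_rev last_rev)
    then show ?thesis using main[of "rev xs"] E xs directed_edges_reverse[of m xs] by simp
  qed
qed

subsection \<open>The incidence matrices of cycles\<close>

lemma dot_map: "dot (map f L) (map g L) = (\<Sum>p\<leftarrow>L. f p * g p)"
  by (simp add: dot_def map2_map_map)

lemma dot_commute: "dot a b = dot b a"
proof -
  have "map2 (*) a b = map2 (*) b a"
    by (rule nth_equalityI) (simp_all add: mult.commute)
  then show ?thesis by (simp add: dot_def)
qed

lemma columns_orientations: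
  "column_lists (map (\<lambda>p. map (\<lambda>e. orientation e p) forward_edges) L) = map (\<lambda>e. map (orientation e) L) forward_edges"
  by (induction L) (simp_all add: column_lists_def map2_map_map)

lemma pairwise_mem:
  assumes "list_pairwise P xs" "\<And>x y. P x y \<Longrightarrow> P y x" "x \<in> set xs" "y \<in> set xs"
  shows "P x y"
  using assms(1,3,4) by (induction xs) (auto simp: list_all_iff intro: assms(2))

lemma proportional_orientations:
  assumes "proportional m (orientations i L) (orientations j L)"
    "e \<in> set forward_edges" "e' \<in> set forward_edges"
  shows "(\<Sum>p\<leftarrow>filter (\<lambda>p. length p = j) L. orientation e p * orientation e' p) =
    m * (\<Sum>p\<leftarrow>filter (\<lambda>p. length p = i) L. orientation e p * orientation e' p)"
proof -
  let ?Li = "filter (\<lambda>p. length p = i) L" and ?Lj = "filter (\<lambda>p. length p = j) L"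
  let ?P = "\<lambda>(x, y) (x', y'). dot y y' = m * dot x x'"
  have "list_pairwise ?P (map (\<lambda>e. (map (orientation e) ?Li, map (orientation e) ?Lj)) forward_edges)"
    using assms(1) by (simp add: proportional_def orientations_def columns_orientations zip_map_map
        zip_same_conv_map o_def)
  moreover have "?P y x" if "?P x y" for x y
    using that by (cases x; cases y) (simp add: dot_commute)
  ultimately have "?P (map (orientation e) ?Li, map (orientation e) ?Lj)
      (map (orientation e') ?Li, map (orientation e') ?Lj)"
    by (rule pairwise_mem) (use assms(2,3) in auto)
  then show ?thesis by (simp add: dot_map)
qed

subsection \<open>The Heawood graph\<close>

definition decode :: "int \<Rightarrow> heawood_vertex" where
  "decode x = (if x < 7 then Hu (of_int x) else Hv (of_int (x - 7)))"

lemma residue_cases: "\<exists>z\<in>{0..6}. (i :: 7) = of_int z"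
proof (cases i)
  case (of_int z)
  then show ?thesis by (intro bexI[of _ z]) auto
qed

lemma decode_surj: "\<exists>x\<in>{0..13}. decode x = v"
proof (cases v)
  case (Hu i)
  obtain z where "z \<in> {0..6}" "i = of_int z" using residue_cases by blast
  then show ?thesis using Hu by (intro bexI[of _ z]) (auto simp: decode_def)
next
  case (Hv i)
  obtain z where "z \<in> {0..6}" "i = of_int z" using residue_cases by blast
  then show ?thesis using Hv by (intro bexI[of _ "z + 7"]) (auto simp: decode_def)
qed

lemma card_heawood_vertex: "card (UNIV :: heawood_vertex set) = 14"
proof -
  have "(UNIV :: heawood_vertex set) = range Hu \<union> range Hv"
    by (metis UNIV_eq_I UnCI heawood_vertex.exhaust rangeI)
  moreover have "card (range Hu \<union> range Hv) = card (range Hu) + card (range Hv)"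
    by (intro card_Un_disjoint) auto
  moreover have "card (range Hu) = 7" "card (range Hv) = 7"
    by (simp_all add: card_image inj_on_def)
  ultimately show ?thesis by simp
qed

text \<open>A surjection between two sets of fourteen elements is injective, so no residues have to
  be compared.\<close>

lemma decode_inj: "inj_on decode {0..13}"
proof (rule eq_card_imp_inj_on)
  have "decode ` {0..13} = UNIV" using decode_surj by (metis UNIV_eq_I image_eqI)
  then show "card (decode ` {0..13}) = card {0..13::int}" by (simp add: card_heawood_vertex)
qed simp

text \<open>The offset 2 comes from reindexing the edges \<open>{Hv i, Hu (i - 2)}\<close> by their
  \<open>Hu\<close> end.\<close>

lemma heawood_edge_iff: "{Hu i, Hv j} \<in> heawood \<longleftrightarrow> j = i \<or> j = i - 1 \<or> j = i + 2"
proof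
  assume "j = i \<or> j = i - 1 \<or> j = i + 2"
  moreover have "{Hu i, Hv (i + 2)} = {Hv (i + 2), Hu ((i + 2) - 2)}" by auto
  ultimately show "{Hu i, Hv j} \<in> heawood" unfolding heawood_def by blast
qed (auto simp: heawood_def doubleton_eq_iff)

lemma of_int_mod_7: "of_int (z mod 7) = (of_int z :: 7)"
proof -
  have "(of_int z :: 7) = of_int (7 * (z div 7) + z mod 7)"
    by (simp only: mult_div_mod_eq)
  also have "\<dots> = of_int 7 * of_int (z div 7) + of_int (z mod 7)"
    by (simp only: of_int_add of_int_mult)
  also have "(of_int 7 :: 7) = 0" by simp
  finally show ?thesis by simp
qed

lemma heawood_decode: "heawood = (\<lambda>(a, b). {decode a, decode b}) ` set forward_edges"
proof
  show "(\<lambda>(a, b). {decode a, decode b}) ` set forward_edges \<subseteq> heawood"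
    by (simp add: forward_edges_def decode_def heawood_edge_iff)
  \<comment> \<open>The three kinds of edges are treated at once through the offset
    \<open>c\<close>; reducing \<open>z + c\<close> modulo 7 brings the code of the
    \<open>Hv\<close> end back into the range 7 to 13.\<close>
  have mem: "{Hu (of_int z), Hv (of_int (z + c))} \<in> (\<lambda>(a, b). {decode a, decode b}) ` set forward_edges"
    if z: "z \<in> {0..6}" and c: "c = 0 \<or> c = -1 \<or> c = 2" for z c
  proof (rule image_eqI[of _ _ "(z, 7 + (z + c) mod 7)"])
    have "decode (7 + (z + c) mod 7) = Hv (of_int (z + c))"
      unfolding of_int_mod_7[of "z + c", symmetric] by (simp add: decode_def)
    then show "{Hu (of_int z), Hv (of_int (z + c))} = (case (z, 7 + (z + c) mod 7) of (a, b) \<Rightarrow> {decode a, decode b})"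
      using z by (simp add: decode_def)
    have "z = 0 \<or> z = 1 \<or> z = 2 \<or> z = 3 \<or> z = 4 \<or> z = 5 \<or> z = 6"
      using z unfolding atLeastAtMost_iff by presburger
    then show "(z, 7 + (z + c) mod 7) \<in> set forward_edges"
      using c by (elim disjE) (simp_all add: forward_edges_def)
  qed
  have mem': "{Hu i, Hv i} \<in> (\<lambda>(a, b). {decode a, decode b}) ` set forward_edges"
    "{Hu i, Hv (i - 1)} \<in> (\<lambda>(a, b). {decode a, decode b}) ` set forward_edges"
    "{Hu i, Hv (i + 2)} \<in> (\<lambda>(a, b). {decode a, decode b}) ` set forward_edges" for i
  proof -
    obtain z where z: "z \<in> {0..6}" "i = of_int z" using residue_cases by blast
    show "{Hu i, Hv i} \<in> (\<lambda>(a, b). {decode a, decode b}) ` set forward_edges"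
      using mem[OF z(1), of 0] unfolding z(2) by simp
    show "{Hu i, Hv (i - 1)} \<in> (\<lambda>(a, b). {decode a, decode b}) ` set forward_edges"
      using mem[OF z(1), of "-1"] unfolding z(2) by simp
    show "{Hu i, Hv (i + 2)} \<in> (\<lambda>(a, b). {decode a, decode b}) ` set forward_edges"
      using mem[OF z(1), of 2] unfolding z(2) by simp
  qed
  show "heawood \<subseteq> (\<lambda>(a, b). {decode a, decode b}) ` set forward_edges"
  proof
    fix e assume "e \<in> heawood"
    then obtain i where "e = {Hu i, Hv i} \<or> e = {Hu i, Hv (i - 1)} \<or> e = {Hv i, Hu (i - 2)}"
      by (auto simp: heawood_def)
    moreover have "{Hv i, Hu (i - 2)} = {Hu (i - 2), Hv ((i - 2) + 2)}" by auto
    ultimately show "e \<in> (\<lambda>(a, b). {decode a, decode b}) ` set forward_edges"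
      using mem'(1,2)[of i] mem'(3)[of "i - 2"] by metis
  qed
qed

lemma card_heawood_edge: "e \<in> heawood \<Longrightarrow> card e = 2"
  by (auto simp: heawood_def card_insert_if)

lemma forward_edges_range: "(a, b) \<in> set forward_edges \<Longrightarrow> a \<in> {0..13} \<and> b \<in> {0..13}"
  by (auto simp: forward_edges_def)

section \<open>From enumerated integer lists to cycles of the graph\<close>

definition edges_of :: "int list \<Rightarrow> heawood_vertex set set" where
  "edges_of p = (\<lambda>(a, b). {decode a, decode b}) ` set (directed_edges p)"

lemma fst_directed_edges: "p \<noteq> [] \<Longrightarrow> fst ` set (directed_edges p) = set p"
  unfolding set_map[symmetric] directed_edges_def by (simp add: map_fst_zip)

lemma all_cycles_D:
  assumes "p \<in> set all_cycles"
  shows "distinct p" "length p \<in> {6, 8, 10, 12, 14}" "p \<noteq> []" "3 \<le> length p" "set p \<subseteq> {0..13}"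
    "set (directed_edges p) \<subseteq> set forward_edges \<union> prod.swap ` set forward_edges"
    "set (directed_edges p) \<inter> prod.swap ` set (directed_edges p) = {}"
proof -
  have v: "valid_cycle p"
    using check_all_cycles assms by (simp add: check_cycles_def list_all_iff)
  then show d: "distinct p" and l: "length p \<in> {6, 8, 10, 12, 14}" by (simp_all add: valid_cycle_def)
  show ne: "p \<noteq> []" and "3 \<le> length p" using l by auto
  show F: "set (directed_edges p) \<subseteq> set forward_edges \<union> prod.swap ` set forward_edges"
  proof
    fix e assume "e \<in> set (directed_edges p)"
    then have "e \<in> set forward_edges \<or> prod.swap e \<in> set forward_edges"
      using v by (auto simp: valid_cycle_def Let_def list_all_iff split: if_splits)
    then show "e \<in> set forward_edges \<union> prod.swap ` set forward_edges"
      by (metis UnI1 UnI2 image_eqI swap_swap)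
  qed
  show "set (directed_edges p) \<inter> prod.swap ` set (directed_edges p) = {}"
    using v by (auto simp: valid_cycle_def Let_def list_all_iff)
  show "set p \<subseteq> {0..13}"
  proof
    fix x assume "x \<in> set p"
    then obtain y where "(x, y) \<in> set (directed_edges p)" using fst_directed_edges[OF ne] by force
    then have "(x, y) \<in> set forward_edges \<or> (y, x) \<in> set forward_edges" using F by auto
    then show "x \<in> {0..13}" using forward_edges_range by blast
  qed
qed

lemma edges_of_traverses:
  assumes "distinct p" "p \<noteq> []" "set p \<subseteq> {0..13}"
  shows "traverses (map decode p) (edges_of p)"
proof -
  have "distinct (map decode p)"
    using assms(1) inj_on_subset[OF decode_inj assms(3)] by (simp add: distinct_map)
  moreover have "edges_of p = (\<lambda>(a, b). {a, b}) ` set (directed_edges (map decode p))"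
    by (simp add: edges_of_def directed_edges_map[OF assms(2)] image_image split_beta)
  ultimately show ?thesis using traverses_directed_edges[of "map decode p"] assms(2) by simp
qed

lemma edges_of_cong:
  assumes "set (directed_edges p) = set (directed_edges q) \<or> set (directed_edges p) = prod.swap ` set (directed_edges q)"
  shows "edges_of p = edges_of q"
proof -
  have "(\<lambda>(a, b). {decode a, decode b}) ` prod.swap ` X = (\<lambda>(a, b). {decode a, decode b}) ` X" for X
    unfolding image_image by (intro image_cong refl) auto
  then show ?thesis using assms unfolding edges_of_def by metis
qed

lemma edges_of_cycle:
  assumes p: "p \<in> set all_cycles"
  shows "edges_of p \<in> cycles heawood" "card (edges_of p) = length p"
proof -
  note d = all_cycles_D[OF p]
  have t: "traverses (map decode p) (edges_of p)" by (rule edges_of_traverses[OF d(1,3,5)])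
  have "edges_of p \<subseteq> heawood"
  proof
    fix e assume "e \<in> edges_of p"
    then obtain a b where ab: "(a, b) \<in> set (directed_edges p)" "e = {decode a, decode b}"
      by (auto simp: edges_of_def)
    then have "(a, b) \<in> set forward_edges \<or> (b, a) \<in> set forward_edges" using d(6) by auto
    then show "e \<in> heawood" unfolding heawood_decode ab(2) by (force simp: insert_commute)
  qed
  then show "edges_of p \<in> cycles heawood"
    using cycles_iff[of heawood, OF card_heawood_edge] t d(4) by (metis length_map)
  have "cyclic_list (map decode p)"
    using t d(4) by unfold_locales (auto simp: traverses_def)
  from cyclic_list.card_edges[OF this t] show "card (edges_of p) = length p" by simp
qed

lemma decode_edge_eq_iff:
  assumes "a \<in> {0..13}" "b \<in> {0..13}" "a' \<in> {0..13}" "b' \<in> {0..13}"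
  shows "{decode a, decode b} = {decode a', decode b'} \<longleftrightarrow> a = a' \<and> b = b' \<or> a = b' \<and> b = a'"
  using inj_on_eq_iff[OF decode_inj] assms by (simp add: doubleton_eq_iff)

text \<open>The edge set fixes the length and the absolute values of all orientations, and the
  evaluated check says that lists of one length are told apart by these absolute values.\<close>

lemma edges_of_inj:
  assumes p: "p \<in> set all_cycles" and q: "q \<in> set all_cycles" and eq: "edges_of p = edges_of q"
  shows "p = q"
proof -
  have len: "length p = length q" using edges_of_cycle(2)[OF p] edges_of_cycle(2)[OF q] eq by simp
  have abs: "\<bar>orientation e p\<bar> = of_bool ({decode (fst e), decode (snd e)} \<in> edges_of p)"
    if e: "e \<in> set forward_edges" and p: "p \<in> set all_cycles" for e p
  proof -
    let ?D = "set (directed_edges p)"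
    obtain a b where ab: "e = (a, b)" by (cases e)
    have r: "a \<in> {0..13}" "b \<in> {0..13}" using forward_edges_range e ab by auto
    have "{decode a, decode b} \<in> edges_of p \<longleftrightarrow> (a, b) \<in> ?D \<or> (b, a) \<in> ?D"
    proof
      assume "{decode a, decode b} \<in> edges_of p"
      then obtain a' b' where ab': "(a', b') \<in> ?D" "{decode a, decode b} = {decode a', decode b'}"
        by (auto simp: edges_of_def)
      then have "(a', b') \<in> set forward_edges \<or> (b', a') \<in> set forward_edges"
        using all_cycles_D(6)[OF p] by auto
      then have "a' \<in> {0..13}" "b' \<in> {0..13}" using forward_edges_range by blast+
      then show "(a, b) \<in> ?D \<or> (b, a) \<in> ?D" using ab' decode_edge_eq_iff[OF r] by auto
    qed (auto simp: edges_of_def image_iff insert_commute intro: bexI[rotated])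
    moreover have "\<not> ((a, b) \<in> ?D \<and> (b, a) \<in> ?D)" using all_cycles_D(7)[OF p] by force
    ultimately show ?thesis by (auto simp: orientation_def ab)
  qed
  have "map abs (map (\<lambda>e. orientation e p) forward_edges) = map abs (map (\<lambda>e. orientation e q) forward_edges)"
    using abs[OF _ p] abs[OF _ q] eq by simp
  moreover have "distinct (map (map abs) (orientations (length p) all_cycles))"
    using check_all_cycles all_cycles_D(2)[OF p] by (auto simp: check_cycles_def Let_def)
  then have "inj_on (\<lambda>p. map abs (map (\<lambda>e. orientation e p) forward_edges))
      (set (filter (\<lambda>q. length q = length p) all_cycles))"
    unfolding orientations_def map_map o_def distinct_map by blast
  ultimately show ?thesis using p q len by (auto dest: inj_onD)
qed

lemma distinct_all_cycles: "k \<in> {6, 8, 10, 12, 14} \<Longrightarrow> distinct (filter (\<lambda>p. length p = k) all_cycles)"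
proof -
  assume "k \<in> {6, 8, 10, 12, 14}"
  then have "distinct (map (map abs) (orientations k all_cycles))"
    using check_all_cycles by (auto simp: check_cycles_def Let_def)
  then show ?thesis unfolding orientations_def distinct_map by blast
qed

text \<open>A traversal is determined by its cycle up to base point and direction, and neither
  affects the sum for an antisymmetric \<open>W\<close>. One enumerated \<open>p\<close> therefore
  serves all such \<open>W\<close>.\<close>

lemma heawood_cycle_canonical:
  assumes C: "C \<subseteq> heawood" "traverses vs C" "3 \<le> length vs"
  shows "\<exists>p\<in>set all_cycles. edges_of p = C \<and> length p = length vs \<and>
    (\<forall>W :: heawood_vertex \<Rightarrow> heawood_vertex \<Rightarrow> heawood_vertex \<Rightarrow> heawood_vertex \<Rightarrow> real.
       (\<forall>a b a' b'. W b a a' b' = - W a b a' b' \<and> W a b b' a' = - W a b a' b') \<longrightarrow>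
       cyclic_sum W vs = cyclic_sum W (map decode p))"
proof -
  \<comment> \<open>The traversal in integer codes, on which the completeness of the enumeration is
    stated.\<close>
  define q where "q = map (inv_into {0..13} decode) vs"
  have surj: "v \<in> decode ` {0..13}" for v using decode_surj by (metis image_eqI)
  have q: "map decode q = vs" "set q \<subseteq> {0..13}" "length q = length vs"
    using inv_into_into[OF surj] by (auto simp: q_def map_idI f_inv_into_f[OF surj] simp del: atLeastAtMost_iff)
  have ne: "vs \<noteq> []" "q \<noteq> []" using C(3) q(3) by auto
  have vs: "distinct vs" "C = (\<lambda>(a, b). {a, b}) ` set (directed_edges vs)"
    using C(2) traverses_directed_edges[OF ne(1)] by auto
  have dq: "distinct q" using vs(1) unfolding q(1)[symmetric] by (simp add: distinct_map)
  have Cq: "edges_of q = C"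
    using edges_of_traverses[OF dq ne(2) q(2)] vs(2) traverses_directed_edges[OF ne(1)] q(1) by metis
  have "set (directed_edges q) \<subseteq> set forward_edges \<union> prod.swap ` set forward_edges"
  proof (clarify)
    fix a b assume ab: "(a, b) \<in> set (directed_edges q)" "(a, b) \<notin> prod.swap ` set forward_edges"
    have "a \<in> set q" using ab(1) unfolding directed_edges_def by (rule set_zip_leftD)
    moreover have "b \<in> set (tl q @ [hd q])" using ab(1) unfolding directed_edges_def by (rule set_zip_rightD)
    then have "b \<in> set q" using ne(2) by (auto dest: list.set_sel(2))
    ultimately have r: "a \<in> {0..13}" "b \<in> {0..13}" using q(2) by auto
    have "{decode a, decode b} \<in> edges_of q" using ab(1) by (force simp: edges_of_def)
    then have "{decode a, decode b} \<in> heawood" using Cq C(1) by blast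
    then obtain a' b' where ab': "(a', b') \<in> set forward_edges" "{decode a, decode b} = {decode a', decode b'}"
      by (auto simp: heawood_decode)
    then have "(a, b) \<in> set forward_edges \<or> (b, a) \<in> set forward_edges"
      using decode_edge_eq_iff[OF r] forward_edges_range by blast
    then show "(a, b) \<in> set forward_edges" using ab(2) by (metis image_eqI swap_simp)
  qed
  then obtain p where p: "p \<in> set all_cycles" "length p = length q"
    "set (directed_edges p) = set (directed_edges q) \<or> set (directed_edges p) = prod.swap ` set (directed_edges q)"
    using all_cycles_complete[OF dq q(2)] C(3) q(3) by auto
  have "cyclic_sum W vs = cyclic_sum W (map decode p)"
    if W: "\<forall>a b a' b'. W b a a' b' = - W a b a' b' \<and> W a b b' a' = - W a b a' b'"
    for W :: "heawood_vertex \<Rightarrow> heawood_vertex \<Rightarrow> heawood_vertex \<Rightarrow> heawood_vertex \<Rightarrow> real"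
  proof -
    have "cyclic_sum W (map decode p) = cyclic_sum W (map decode q)"
      unfolding cyclic_sum_map
      by (rule cyclic_sum_cong_edges[OF all_cycles_D(1,3)[OF p(1)] dq ne(2) p(3)]) (use W in blast)+
    then show ?thesis using q(1) by simp
  qed
  moreover have "edges_of p = C" "length p = length vs" using p(2) edges_of_cong[OF p(3)] Cq q(3) by simp_all
  ultimately show ?thesis using p(1) by blast
qed

lemma k_cycles_heawood: "k_cycles heawood k = edges_of ` set (filter (\<lambda>p. length p = k) all_cycles)"
proof
  show "edges_of ` set (filter (\<lambda>p. length p = k) all_cycles) \<subseteq> k_cycles heawood k"
    using edges_of_cycle by (auto simp: k_cycles_def)
  show "k_cycles heawood k \<subseteq> edges_of ` set (filter (\<lambda>p. length p = k) all_cycles)"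
  proof
    fix C assume C: "C \<in> k_cycles heawood k"
    then obtain vs where "C \<subseteq> heawood" "traverses vs C" "3 \<le> length vs"
      using cycles_iff[of heawood, OF card_heawood_edge] by (auto simp: k_cycles_def)
    then obtain p where "p \<in> set all_cycles" "edges_of p = C" using heawood_cycle_canonical by blast
    then show "C \<in> edges_of ` set (filter (\<lambda>p. length p = k) all_cycles)"
      using C edges_of_cycle(2)[of p] by (auto simp: k_cycles_def)
  qed
qed

lemma cyclic_sum_orientation:
  assumes p: "p \<in> set all_cycles"
    and W: "\<And>a b a' b'. W b a a' b' = - W a b a' b'" "\<And>a b a' b'. W a b b' a' = - W a b a' b'"
  shows "cyclic_sum W p = (\<Sum>e\<in>set forward_edges. \<Sum>e'\<in>set forward_edges.
    of_int (orientation e p * orientation e' p) * (W (fst e) (snd e) (fst e') (snd e') :: real))"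
proof -
  note d = all_cycles_D[OF p]
  note so = sum_orientation[OF finite_set forward_edges_disjoint d(6)]
  have "cyclic_sum W p = (\<Sum>(a, b)\<in>set (directed_edges p). \<Sum>(a', b')\<in>set (directed_edges p). W a b a' b')"
    by (rule cyclic_sum_directed_edges[OF d(1,3)])
  also have "\<dots> = (\<Sum>e\<in>set forward_edges. of_int (orientation e p) *
      (\<Sum>(a', b')\<in>set (directed_edges p). W (fst e) (snd e) a' b'))"
  proof (rule so)
    show "(\<Sum>(a', b')\<in>set (directed_edges p). W b a a' b') = - (\<Sum>(a', b')\<in>set (directed_edges p). W a b a' b')" for a b
      unfolding split_beta sum_negf[symmetric] by (intro sum.cong refl W(1))
  qed
  also have "\<dots> = (\<Sum>e\<in>set forward_edges. of_int (orientation e p) *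
      (\<Sum>e'\<in>set forward_edges. of_int (orientation e' p) * W (fst e) (snd e) (fst e') (snd e')))"
    by (intro sum.cong refl arg_cong2[where f = "(*)"] so W(2))
  finally show ?thesis by (simp add: sum_distrib_left mult.assoc)
qed

theorem theorem1p20:
  fixes f :: "real ^ heawood_vertex \<Rightarrow> real ^ 3"
  assumes "legendrian_embedding heawood f"
  shows "TB_k heawood f 8 = TB_k heawood f 6 \<and>
         TB_k heawood f 10 = 5 * TB_k heawood f 6 \<and>
         TB_k heawood f 12 = 4 * TB_k heawood f 6 \<and>
         TB_k heawood f 14 = 2 * TB_k heawood f 6 \<and>
         TB heawood f = 13 * TB_k heawood f 6"
proof -
  have fin: "finite (cycles heawood)"
    by (rule finite_subset[of _ "Pow heawood"]) (auto simp: cycles_def)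
  have "\<forall>C\<in>cycles heawood. \<exists>vs. traverses vs C \<and> 3 \<le> length vs \<and>
      (\<forall>\<^sub>F e in at_right 0. cycle_tb f C = cyclic_sum (pushoff_linking f e) vs)"
  proof
    fix C assume "C \<in> cycles heawood"
    then obtain ws where "C \<subseteq> heawood" "traverses ws C" "3 \<le> length ws"
      using cycles_iff[of heawood C, OF card_heawood_edge] by blast
    then show "\<exists>vs. traverses vs C \<and> 3 \<le> length vs \<and>
      (\<forall>\<^sub>F e in at_right 0. cycle_tb f C = cyclic_sum (pushoff_linking f e) vs)"
      by (rule cycle_tb_eq[OF assms])
  qed
  then obtain V where V: "\<And>C. C \<in> cycles heawood \<Longrightarrow> traverses (V C) C \<and> 3 \<le> length (V C) \<and>
      (\<forall>\<^sub>F e in at_right 0. cycle_tb f C = cyclic_sum (pushoff_linking f e) (V C))" by metis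
  \<comment> \<open>Finitely many cycles allow one push-off \<open>e\<close> for all of them, so
    that all their numbers are values of quadratic forms in one and the same matrix.\<close>
  have "\<forall>\<^sub>F e in at_right 0. \<forall>C\<in>cycles heawood. cycle_tb f C = cyclic_sum (pushoff_linking f e) (V C)"
    using V by (intro eventually_ball_finite[OF fin]) blast
  then obtain e where e: "\<And>C. C \<in> cycles heawood \<Longrightarrow> cycle_tb f C = cyclic_sum (pushoff_linking f e) (V C)"
    using eventually_happens'[OF trivial_limit_at_right_real] by blast
  \<comment> \<open>Antisymmetry of \<open>pushoff_linking\<close> is derived from the regularity of
    the edge curves, hence for edges of the graph only. Extension by 0 makes it hold for all
    vertices, as \<open>heawood_cycle_canonical\<close> requires.\<close>
  define W where "W v w v' w' = (if {v, w} \<in> heawood \<and> {v', w'} \<in> heawood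
    then pushoff_linking f e v w v' w' else 0)" for v w v' w'
  have C1: "cdiff (Suc 0) {0..1} (edge_curve f v w)" if "{v, w} \<in> heawood" for v w
  proof -
    have "legendrian_on {0..1} (edge_curve f v w)" using assms that by (simp add: legendrian_embedding_def)
    then have "smooth_on {0..1} (edge_curve f v w)"
      by (rule legendrian_on_D(1)[OF _ unit_interval_nontrivial])
    then show ?thesis unfolding smooth_on_def by blast
  qed
  have rev: "edge_curve f w v = (\<lambda>s. edge_curve f v w (1 - s))" for v w
    by (auto simp: edge_curve_def linepath_swap[of "axis w 1" "axis v 1"])
  have W: "W b a a' b' = - W a b a' b'" "W a b b' a' = - W a b a' b'" for a b a' b'
  proof -
    have z: "cdiff (Suc 0) {0..1} (\<lambda>t. edge_curve f v w t + e *\<^sub>R axis 3 1)" if "{v, w} \<in> heawood" for v w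
      by (intro cdiff_add cdiff_const C1 that)
    show "W b a a' b' = - W a b a' b'"
    proof (cases "{a, b} \<in> heawood \<and> {a', b'} \<in> heawood")
      case True
      then show ?thesis
        using gauss_integral_reverse(1)[OF C1[of a b] z[of a' b']] rev[where v = a and w = b]
        by (simp add: W_def pushoff_linking_def insert_commute)
    next
      case False
      then show ?thesis by (auto simp: W_def insert_commute)
    qed
    show "W a b b' a' = - W a b a' b'"
    proof (cases "{a, b} \<in> heawood \<and> {a', b'} \<in> heawood")
      case True
      then show ?thesis
        using gauss_integral_reverse(2)[OF C1[of a b] z[of a' b']] rev[where v = a' and w = b']
        by (simp add: W_def pushoff_linking_def insert_commute)
    next
      case False
      then show ?thesis by (auto simp: W_def insert_commute)
    qed
  qed
  define D where "D a b a' b' = W (decode a) (decode b) (decode a') (decode b')" for a b a' b'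
  have tb: "cycle_tb f (edges_of p) = cyclic_sum D p" if p: "p \<in> set all_cycles" for p
  proof -
    define C where "C = edges_of p"
    have C: "C \<in> cycles heawood" unfolding C_def by (rule edges_of_cycle(1)[OF p])
    have CH: "C \<subseteq> heawood" using C by (simp add: cycles_def)
    note v = V[OF C]
    have edge: "{V C ! i, V C ! ((i + 1) mod length (V C))} \<in> heawood" if "i < length (V C)" for i
      using v CH that unfolding traverses_def by blast
    have "cycle_tb f C = cyclic_sum W (V C)"
      unfolding e[OF C] cyclic_sum_def by (intro sum.cong refl) (simp only: W_def edge lessThan_iff simp_thms if_True)
    moreover obtain q where q: "q \<in> set all_cycles" "edges_of q = C"
      "cyclic_sum W (V C) = cyclic_sum W (map decode q)"
      using heawood_cycle_canonical[OF CH] v W by blast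
    \<comment> \<open>The canonical list of a cycle is unique, so the arbitrary traversal
      \<open>V C\<close> may be replaced by the given \<open>p\<close>.\<close>
    have "q = p" using edges_of_inj[OF q(1) p] q(2) by (simp add: C_def)
    ultimately show ?thesis using q(3) by (simp add: C_def cyclic_sum_map D_def[abs_def])
  qed
  \<comment> \<open>The matrix \<open>M_k\<close> of the overview, with integer entries indexed by
    the forward edges. Summing the quadratic forms over all cycles of one length moves the
    dependence on the cycles into this matrix.\<close>
  define M where "M k a b = (\<Sum>p\<leftarrow>filter (\<lambda>p. length p = k) all_cycles. orientation a p * orientation b p)" for k a b
  have TBk: "TB_k heawood f k = (\<Sum>a\<in>set forward_edges. \<Sum>b\<in>set forward_edges.
      of_int (M k a b) * D (fst a) (snd a) (fst b) (snd b))" if k: "k \<in> {6, 8, 10, 12, 14}" for k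
  proof -
    let ?L = "filter (\<lambda>p. length p = k) all_cycles"
    have "inj_on edges_of (set ?L)" using edges_of_inj by (auto simp: inj_on_def)
    then have "TB_k heawood f k = (\<Sum>p\<in>set ?L. cycle_tb f (edges_of p))"
      unfolding TB_k_def k_cycles_heawood by (rule sum.reindex[unfolded o_def])
    also have "\<dots> = (\<Sum>p\<in>set ?L. \<Sum>a\<in>set forward_edges. \<Sum>b\<in>set forward_edges.
        of_int (orientation a p * orientation b p) * D (fst a) (snd a) (fst b) (snd b))"
    proof (rule sum.cong[OF refl])
      fix p assume "p \<in> set ?L"
      then have p: "p \<in> set all_cycles" by simp
      show "cycle_tb f (edges_of p) = (\<Sum>a\<in>set forward_edges. \<Sum>b\<in>set forward_edges.
        of_int (orientation a p * orientation b p) * D (fst a) (snd a) (fst b) (snd b))"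
        unfolding tb[OF p] by (rule cyclic_sum_orientation[OF p]) (unfold D_def, (rule W)+)
    qed
    also have "\<dots> = (\<Sum>a\<in>set forward_edges. \<Sum>p\<in>set ?L. \<Sum>b\<in>set forward_edges.
        of_int (orientation a p * orientation b p) * D (fst a) (snd a) (fst b) (snd b))"
      by (rule sum.swap)
    also have "\<dots> = (\<Sum>a\<in>set forward_edges. \<Sum>b\<in>set forward_edges. \<Sum>p\<in>set ?L.
        of_int (orientation a p * orientation b p) * D (fst a) (snd a) (fst b) (snd b))"
      by (intro sum.cong refl sum.swap)
    also have "\<dots> = (\<Sum>a\<in>set forward_edges. \<Sum>b\<in>set forward_edges.
        of_int (M k a b) * D (fst a) (snd a) (fst b) (snd b))"
      unfolding M_def sum_list_distinct_conv_sum_set[OF distinct_all_cycles[OF k]]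
      by (simp only: of_int_sum sum_distrib_right)
    finally show ?thesis .
  qed
  have multiple: "TB_k heawood f k = of_int m * TB_k heawood f 6"
    if P: "proportional m (orientations 6 all_cycles) (orientations k all_cycles)" and k: "k \<in> {6, 8, 10, 12, 14}" for m k
  proof -
    have "M k a b = m * M 6 a b" if "a \<in> set forward_edges" "b \<in> set forward_edges" for a b
      unfolding M_def by (rule proportional_orientations[OF P that])
    then have "TB_k heawood f k = (\<Sum>a\<in>set forward_edges. \<Sum>b\<in>set forward_edges.
      of_int (m * M 6 a b) * D (fst a) (snd a) (fst b) (snd b))"
      unfolding TBk[OF k] by (intro sum.cong refl) simp
    also have "\<dots> = of_int m * TB_k heawood f 6"
      by (simp add: TBk sum_distrib_left mult.assoc)
    finally show ?thesis .
  qed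
  have P: "proportional 1 (orientations 6 all_cycles) (orientations 8 all_cycles)"
    "proportional 5 (orientations 6 all_cycles) (orientations 10 all_cycles)"
    "proportional 4 (orientations 6 all_cycles) (orientations 12 all_cycles)"
    "proportional 2 (orientations 6 all_cycles) (orientations 14 all_cycles)"
    using check_all_cycles unfolding check_cycles_def Let_def by blast+
  \<comment> \<open>The validity check confines all lengths to these five values, so grouping the
    cycles by length gives the factor 1 + 1 + 5 + 4 + 2 = 13.\<close>
  have "TB heawood f = (\<Sum>k\<in>{6, 8, 10, 12, 14}. TB_k heawood f k)"
    unfolding TB_def TB_k_def k_cycles_def
  proof (rule sum.group[OF fin, symmetric])
    show "card ` cycles heawood \<subseteq> {6, 8, 10, 12, 14}"
    proof
      fix k assume "k \<in> card ` cycles heawood"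
      then obtain C where C: "C \<in> k_cycles heawood k" by (auto simp: k_cycles_def)
      then obtain p where "p \<in> set all_cycles" "length p = k" unfolding k_cycles_heawood by auto
      then show "k \<in> {6, 8, 10, 12, 14}" using all_cycles_D(2) by blast
    qed
  qed simp
  then show ?thesis using multiple[OF P(1)] multiple[OF P(2)] multiple[OF P(3)] multiple[OF P(4)] by simp
qed

end
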